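(* Let $\mathbb{F}$ be an algebraically closed field of characteristic $p>0$, let $n$ be a positive integer, and let $m\ge 0$ be the integer such that $p^m\mid n$ and $p^{m+1}\nmid n$. Then the complexity of the Lie module satisfies $$c_{\mathfrak{S}_n}(\mathrm{Lie}(n))\le m.$$
   Context: Symmetric groups: $\mathfrak{S}_n$ is the group of permutations of $\{1,\dots,n\}$, with elements composed from right to left. Lie module: $\mathrm{Lie}(n)=\mathbb{F}\mathfrak{S}_n\,\omega_n$ is the left ideal of the group algebra $\mathbb{F}\mathfrak{S}_n$ generated by $\omega_n=(1-d_2)(1-d_3)\cdots(1-d_n)$, where $d_i$ is the descending $i$-cycle $(i,i-1,\dots,1)$ (and $\omega_1=1$). Complexity: for a finite group $G$ and a finitely generated $\mathbb{F}G$-module $M$, the complexity $c_G(M)$ is the polynomial rate of growth of the dimensions of the terms in a minimal projective resolution $\cdots\to P_1\to P_0\to M\to 0$, i.e. the least integer $c\ge 0$ such that $\dim_{\mathbb{F}}P_j\le \lambda\, j^{c-1}$ for some constant $\lambda>0$ and all sufficiently large $j$. Equivalently, it is the Krull dimension of the cohomological (support) variety $V_G(M)$, the set of maximal ideals of the cohomology ring $H^{\cdot}(G,\mathbb{F})$ containing the annihilator of $\mathrm{Ext}^*_{\mathbb{F}G}(M,M)$. *)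

theory Defs
  imports
    "HOL-Algebra.Sym_Groups"
    "HOL-Algebra.AbelCoset"
    "HOL-Computational_Algebra.Polynomial"
    "Jordan_Normal_Form.VS_Connect"
begin

section \<open>Group algebras\<close>

text \<open>
  Elements of the group algebra of a finite group \<open>G\<close> over a field are the coefficient functions
  on \<open>carrier G\<close>, extended by zero outside \<open>carrier G\<close>; the product is convolution.
\<close>

definition group_algebra :: "('g, 'x) monoid_scheme \<Rightarrow> ('g \<Rightarrow> 'f::field) ring" where
  "group_algebra G =
     \<lparr>carrier = {a. \<forall>g. g \<notin> carrier G \<longrightarrow> a g = 0},
      mult = (\<lambda>a b g. if g \<in> carrier G
                then \<Sum>h\<in>carrier G. a h * b (inv\<^bsub>G\<^esub> h \<otimes>\<^bsub>G\<^esub> g) else 0),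
      one = (\<lambda>g. if g = \<one>\<^bsub>G\<^esub> then 1 else 0),
      zero = (\<lambda>g. 0),
      add = (\<lambda>a b g. a g + b g)\<rparr>"

definition group_elem :: "'g \<Rightarrow> ('g \<Rightarrow> 'f::field)" where
  "group_elem h = (\<lambda>g. if g = h then 1 else 0)"

definition scalar_elem :: "('g, 'x) monoid_scheme \<Rightarrow> 'f \<Rightarrow> ('g \<Rightarrow> 'f::field)" where
  "scalar_elem G c = (\<lambda>g. if g = \<one>\<^bsub>G\<^esub> then c else 0)"


section \<open>Left modules over a ring\<close>

text \<open>The library locale \<open>module\<close> requires a commutative ring of scalars.\<close>

locale left_module = R?: ring R + M?: abelian_group M
  for R :: "('a, 'x) ring_scheme" (structure) and M :: "('a, 'm, 'y) module_scheme" (structure) +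
  assumes smult_closed:
      "\<lbrakk>a \<in> carrier R; x \<in> carrier M\<rbrakk> \<Longrightarrow> a \<odot>\<^bsub>M\<^esub> x \<in> carrier M"
    and smult_l_distr:
      "\<lbrakk>a \<in> carrier R; b \<in> carrier R; x \<in> carrier M\<rbrakk> \<Longrightarrow>
       (a \<oplus> b) \<odot>\<^bsub>M\<^esub> x = a \<odot>\<^bsub>M\<^esub> x \<oplus>\<^bsub>M\<^esub> b \<odot>\<^bsub>M\<^esub> x"
    and smult_r_distr:
      "\<lbrakk>a \<in> carrier R; x \<in> carrier M; y \<in> carrier M\<rbrakk> \<Longrightarrow>
       a \<odot>\<^bsub>M\<^esub> (x \<oplus>\<^bsub>M\<^esub> y) = a \<odot>\<^bsub>M\<^esub> x \<oplus>\<^bsub>M\<^esub> a \<odot>\<^bsub>M\<^esub> y"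
    and smult_assoc:
      "\<lbrakk>a \<in> carrier R; b \<in> carrier R; x \<in> carrier M\<rbrakk> \<Longrightarrow>
       (a \<otimes> b) \<odot>\<^bsub>M\<^esub> x = a \<odot>\<^bsub>M\<^esub> (b \<odot>\<^bsub>M\<^esub> x)"
    and smult_one:
      "x \<in> carrier M \<Longrightarrow> \<one> \<odot>\<^bsub>M\<^esub> x = x"

text \<open>
  The left ideal \<open>R a\<close> as a left \<open>R\<close>-module. The fields \<open>mult\<close> and \<open>one\<close> of a module record
  carry no meaning.
\<close>

definition principal_left_ideal :: "('a, 'x) ring_scheme \<Rightarrow> 'a \<Rightarrow> ('a, 'a) module" where
  "principal_left_ideal R a =
     \<lparr>carrier = {r \<otimes>\<^bsub>R\<^esub> a | r. r \<in> carrier R}, mult = mult R, one = one R,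
      zero = zero R, add = add R, smult = mult R\<rparr>"

text \<open>
  Finitely generated projective modules, as direct summands of the free modules \<open>R^r\<close> of
  finite rank. (The lifting property would quantify over modules of arbitrary type.)
\<close>

definition fg_projective :: "('a, 'x) ring_scheme \<Rightarrow> ('a, 'p, 'y) module_scheme \<Rightarrow> bool" where
  "fg_projective R P \<longleftrightarrow> left_module R P \<and>
     (\<exists>r::nat. \<exists>i \<in> LinearCombinations.module_hom R P (ring.func_space R {..<r}).
        \<exists>q \<in> LinearCombinations.module_hom R (ring.func_space R {..<r}) P. \<forall>x\<in>carrier P. q (i x) = x)"

definition superfluous ::
    "('a, 'x) ring_scheme \<Rightarrow> ('a, 'm, 'y) module_scheme \<Rightarrow> 'm set \<Rightarrow> bool" where
  "superfluous R M K \<longleftrightarrow>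
     (\<forall>N. Module.submodule N R M \<and> N <+>\<^bsub>M\<^esub> K = carrier M \<longrightarrow> N = carrier M)"

definition projective_cover ::
    "('a, 'x) ring_scheme \<Rightarrow> ('a, 'p, 'y) module_scheme \<Rightarrow> ('a, 'm, 'z) module_scheme \<Rightarrow>
     ('p \<Rightarrow> 'm) \<Rightarrow> bool" where
  "projective_cover R P M f \<longleftrightarrow>
     fg_projective R P \<and> f \<in> LinearCombinations.module_hom R P M \<and> f ` carrier P = carrier M \<and>
     superfluous R P (a_kernel P M f)"

text \<open>
  A minimal projective resolution
  \<open>\<cdots> \<rightarrow> P 2 \<rightarrow> P 1 \<rightarrow> P 0 \<rightarrow> M \<rightarrow> 0\<close> by finitely generated modules, with augmentation
  \<open>e : P 0 \<rightarrow> M\<close> and differentials \<open>d j : P (j + 1) \<rightarrow> P j\<close>: every map is a projective cover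
  of the kernel of the next one (in particular the sequence is exact).
\<close>

definition minimal_projective_resolution ::
    "('a, 'x) ring_scheme \<Rightarrow> ('a, 'm, 'z) module_scheme \<Rightarrow> (nat \<Rightarrow> ('a, 'p) module) \<Rightarrow>
     ('p \<Rightarrow> 'm) \<Rightarrow> (nat \<Rightarrow> 'p \<Rightarrow> 'p) \<Rightarrow> bool" where
  "minimal_projective_resolution R M P e d \<longleftrightarrow>
     projective_cover R (P 0) M e \<and>
     projective_cover R (P 1) ((P 0)\<lparr>carrier := a_kernel (P 0) M e\<rparr>) (d 0) \<and>
     (\<forall>j. projective_cover R (P (j + 2))
            ((P (j + 1))\<lparr>carrier := a_kernel (P (j + 1)) (P j) (d j)\<rparr>) (d (j + 1)))"


section \<open>Complexity\<close>

text \<open>Restriction of scalars from the group algebra to the ground field.\<close>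

definition underlying_space ::
    "('g, 'x) monoid_scheme \<Rightarrow> ('g \<Rightarrow> 'f::field, 'm, 'y) module_scheme \<Rightarrow> ('f, 'm) module" where
  "underlying_space G M =
     \<lparr>carrier = carrier M, mult = mult M, one = one M, zero = zero M, add = add M,
      smult = (\<lambda>c x. scalar_elem G c \<odot>\<^bsub>M\<^esub> x)\<rparr>"

definition module_dim ::
    "('g, 'x) monoid_scheme \<Rightarrow> ('g \<Rightarrow> 'f::field, 'm, 'y) module_scheme \<Rightarrow> nat" where
  "module_dim G M = vectorspace.dim (class_ring :: 'f ring) (underlying_space G M)"

text \<open>
  Minimal projective resolutions are unique up to isomorphism, so the growth condition may be
  tested on any one of them. The terms can be taken with elements of type \<open>nat \<Rightarrow> 'g \<Rightarrow> 'f\<close>,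
  because a finitely generated projective module is isomorphic to a submodule of a free module
  \<open>R^r\<close>. The exponent \<open>c - 1\<close> is an integer, equal to \<open>-1\<close> for \<open>c = 0\<close>.
\<close>

definition complexity ::
    "('g, 'x) monoid_scheme \<Rightarrow> ('g \<Rightarrow> 'f::field, 'm, 'y) module_scheme \<Rightarrow> nat" where
  "complexity G M =
     (LEAST c. \<exists>(P :: nat \<Rightarrow> ('g \<Rightarrow> 'f, nat \<Rightarrow> 'g \<Rightarrow> 'f) module) e d.
        minimal_projective_resolution (group_algebra G) M P e d \<and>
        (\<exists>K>0. \<forall>\<^sub>F j in sequentially.
           real (module_dim G (P j)) \<le> K * real j powi (int c - 1)))"


section \<open>The Lie module\<close>

definition descending_cycle :: "nat \<Rightarrow> nat \<Rightarrow> nat" where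
  "descending_cycle i = cycle_of_list (rev [1..<Suc i])"

definition lie_omega :: "nat \<Rightarrow> ((nat \<Rightarrow> nat) \<Rightarrow> 'f::field)" where
  "lie_omega n =
     (let A = group_algebra (sym_group n) in
      foldr (\<lambda>i a. (\<one>\<^bsub>A\<^esub> \<ominus>\<^bsub>A\<^esub> group_elem (descending_cycle i)) \<otimes>\<^bsub>A\<^esub> a) [2..<Suc n] \<one>\<^bsub>A\<^esub>)"

definition Lie :: "nat \<Rightarrow> ((nat \<Rightarrow> nat) \<Rightarrow> 'f::field, (nat \<Rightarrow> nat) \<Rightarrow> 'f) module" where
  "Lie n = principal_left_ideal (group_algebra (sym_group n)) (lie_omega n)"


section \<open>Well-definedness\<close>

text \<open>The descending cycle \<open>(i, i - 1, \<dots>, 1)\<close> sends \<open>k + 1\<close> to \<open>k\<close> and \<open>1\<close> to \<open>i\<close>.\<close>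

lemma descending_cycle_apply:
  assumes "i \<ge> 1"
  shows "descending_cycle i k = (if k = 1 then i else if 2 \<le> k \<and> k \<le> i then k - 1 else k)"
  using assms
proof (induction i arbitrary: k rule: nat_induct_at_least)
  case base
  then show ?case by (simp add: descending_cycle_def)
next
  case (Suc i)
  have eq: "rev [1..<Suc (Suc i)] = Suc i # i # rev [1..<i]"
    using Suc.hyps by simp
  have "rev [1..<Suc i] = i # rev [1..<i]"
    using Suc.hyps by simp
  then have "descending_cycle (Suc i) = transpose (Suc i) i \<circ> descending_cycle i"
    unfolding descending_cycle_def eq by simp
  then show ?case
    using Suc by (auto simp: transpose_def)
qed

lemma descending_cycle_in_sym_group:
  assumes "1 \<le> i" "i \<le> n"
  shows "descending_cycle i \<in> carrier (sym_group n)"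
proof -
  have "descending_cycle i permutes {1..<Suc i}"
    using cycle_permutes[of "rev [1..<Suc i]"] unfolding descending_cycle_def
    by (simp del: upt_Suc)
  then show ?thesis
    unfolding sym_group_carrier by (rule permutes_subset) (use assms in auto)
qed

lemma finite_sym_group: "finite (carrier (sym_group n))"
  by (simp add: sym_group_def finite_permutations)

lemma group_elem_closed:
  "g \<in> carrier G \<Longrightarrow> group_elem g \<in> carrier (group_algebra G)"
  by (auto simp: group_elem_def group_algebra_def)

lemma group_elem_mult:
  assumes "group G" "finite (carrier G)" "g \<in> carrier G" "h \<in> carrier G"
  shows "group_elem g \<otimes>\<^bsub>group_algebra G\<^esub> group_elem h = group_elem (g \<otimes>\<^bsub>G\<^esub> h)"
proof
  interpret group G by fact
  fix x
  have "(\<Sum>k\<in>carrier G. group_elem g k * (group_elem h (inv\<^bsub>G\<^esub> k \<otimes>\<^bsub>G\<^esub> x) :: 'c))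
      = group_elem h (inv\<^bsub>G\<^esub> g \<otimes>\<^bsub>G\<^esub> x)"
    using assms by (subst sum.remove[of _ g]) (auto simp: group_elem_def intro: sum.neutral)
  moreover have "inv\<^bsub>G\<^esub> g \<otimes>\<^bsub>G\<^esub> x = h \<longleftrightarrow> x = g \<otimes>\<^bsub>G\<^esub> h" if "x \<in> carrier G"
    using assms that by (metis inv_solve_left)
  ultimately show "(group_elem g \<otimes>\<^bsub>group_algebra G\<^esub> group_elem h) x
      = (group_elem (g \<otimes>\<^bsub>G\<^esub> h) x :: 'c)"
    using assms by (auto simp: group_algebra_def group_elem_def)
qed

lemma group_algebra_ring:
  assumes "group G" "finite (carrier G)"
  shows "ring (group_algebra G :: ('g \<Rightarrow> 'f::field) ring)"
proof -
  interpret group G by fact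
  let ?A = "group_algebra G :: ('g \<Rightarrow> 'f) ring"
  note A = group_algebra_def
  have sub: "carrier ?A = {a. \<forall>g. g \<notin> carrier G \<longrightarrow> a g = 0}"
    by (simp add: A)
  have add_inv: "\<exists>y\<in>carrier ?A. y \<oplus>\<^bsub>?A\<^esub> x = \<zero>\<^bsub>?A\<^esub>" if "x \<in> carrier ?A" for x
    using that by (intro bexI[of _ "\<lambda>g. - x g"]) (auto simp: A)
  have ab: "abelian_group ?A"
  proof (rule abelian_groupI)
    fix x assume "x \<in> carrier ?A"
    then show "\<exists>y\<in>carrier ?A. y \<oplus>\<^bsub>?A\<^esub> x = \<zero>\<^bsub>?A\<^esub>" by (rule add_inv)
  qed (auto simp: A algebra_simps)
  have mon: "Group.monoid ?A"
  proof (rule Group.monoidI)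
    fix a b c :: "'g \<Rightarrow> 'f"
    assume mem: "a \<in> carrier ?A" "b \<in> carrier ?A" "c \<in> carrier ?A"
    show "(a \<otimes>\<^bsub>?A\<^esub> b) \<otimes>\<^bsub>?A\<^esub> c = a \<otimes>\<^bsub>?A\<^esub> (b \<otimes>\<^bsub>?A\<^esub> c)"
    proof
      fix g
      show "((a \<otimes>\<^bsub>?A\<^esub> b) \<otimes>\<^bsub>?A\<^esub> c) g = (a \<otimes>\<^bsub>?A\<^esub> (b \<otimes>\<^bsub>?A\<^esub> c)) g"
      proof (cases "g \<in> carrier G")
        case g: True
        have "((a \<otimes>\<^bsub>?A\<^esub> b) \<otimes>\<^bsub>?A\<^esub> c) g
            = (\<Sum>h\<in>carrier G. \<Sum>k\<in>carrier G. a k * b (inv\<^bsub>G\<^esub> k \<otimes>\<^bsub>G\<^esub> h) * c (inv\<^bsub>G\<^esub> h \<otimes>\<^bsub>G\<^esub> g))"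
          using g by (simp add: A sum_distrib_right)
        also have "\<dots> = (\<Sum>k\<in>carrier G. \<Sum>h\<in>carrier G.
                            a k * b (inv\<^bsub>G\<^esub> k \<otimes>\<^bsub>G\<^esub> h) * c (inv\<^bsub>G\<^esub> h \<otimes>\<^bsub>G\<^esub> g))"
          by (rule sum.swap)
        also have "\<dots> = (\<Sum>k\<in>carrier G. \<Sum>l\<in>carrier G.
                            a k * b l * c (inv\<^bsub>G\<^esub> l \<otimes>\<^bsub>G\<^esub> (inv\<^bsub>G\<^esub> k \<otimes>\<^bsub>G\<^esub> g)))"
        proof (rule sum.cong[OF refl])
          fix k assume k: "k \<in> carrier G"
          show "(\<Sum>h\<in>carrier G. a k * b (inv\<^bsub>G\<^esub> k \<otimes>\<^bsub>G\<^esub> h) * c (inv\<^bsub>G\<^esub> h \<otimes>\<^bsub>G\<^esub> g))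
              = (\<Sum>l\<in>carrier G. a k * b l * c (inv\<^bsub>G\<^esub> l \<otimes>\<^bsub>G\<^esub> (inv\<^bsub>G\<^esub> k \<otimes>\<^bsub>G\<^esub> g)))"
          proof (rule sum.reindex_bij_witness
              [where i = "\<lambda>l. k \<otimes>\<^bsub>G\<^esub> l" and j = "\<lambda>h. inv\<^bsub>G\<^esub> k \<otimes>\<^bsub>G\<^esub> h"])
            fix h assume h: "h \<in> carrier G"
            have "inv\<^bsub>G\<^esub> (inv\<^bsub>G\<^esub> k \<otimes>\<^bsub>G\<^esub> h) \<otimes>\<^bsub>G\<^esub> (inv\<^bsub>G\<^esub> k \<otimes>\<^bsub>G\<^esub> g) = inv\<^bsub>G\<^esub> h \<otimes>\<^bsub>G\<^esub> g"
              using h k g by (simp add: inv_mult_group m_assoc) (simp add: m_assoc[symmetric])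
            then show "a k * b (inv\<^bsub>G\<^esub> k \<otimes>\<^bsub>G\<^esub> h)
                * c (inv\<^bsub>G\<^esub> (inv\<^bsub>G\<^esub> k \<otimes>\<^bsub>G\<^esub> h) \<otimes>\<^bsub>G\<^esub> (inv\<^bsub>G\<^esub> k \<otimes>\<^bsub>G\<^esub> g))
              = a k * b (inv\<^bsub>G\<^esub> k \<otimes>\<^bsub>G\<^esub> h) * c (inv\<^bsub>G\<^esub> h \<otimes>\<^bsub>G\<^esub> g)"
              by simp
          qed (use k g in \<open>auto simp: m_assoc[symmetric]\<close>)
        qed
        also have "\<dots> = (a \<otimes>\<^bsub>?A\<^esub> (b \<otimes>\<^bsub>?A\<^esub> c)) g"
          using g by (simp add: A sum_distrib_left mult.assoc)
        finally show ?thesis .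
      qed (simp add: A)
    qed
  next
    fix a :: "'g \<Rightarrow> 'f" assume a: "a \<in> carrier ?A"
    show "\<one>\<^bsub>?A\<^esub> \<otimes>\<^bsub>?A\<^esub> a = a"
    proof
      fix g
      have "(\<Sum>h\<in>carrier G. (if h = \<one>\<^bsub>G\<^esub> then 1 else 0) * a (inv\<^bsub>G\<^esub> h \<otimes>\<^bsub>G\<^esub> g))
          = a (inv\<^bsub>G\<^esub> \<one>\<^bsub>G\<^esub> \<otimes>\<^bsub>G\<^esub> g)"
        using assms by (subst sum.remove[of _ "\<one>\<^bsub>G\<^esub>"]) (auto intro: sum.neutral)
      then show "(\<one>\<^bsub>?A\<^esub> \<otimes>\<^bsub>?A\<^esub> a) g = a g"
        using a by (auto simp: A)
    qed
    show "a \<otimes>\<^bsub>?A\<^esub> \<one>\<^bsub>?A\<^esub> = a"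
    proof
      fix g
      have "(\<Sum>h\<in>carrier G. a h * (if inv\<^bsub>G\<^esub> h \<otimes>\<^bsub>G\<^esub> g = \<one>\<^bsub>G\<^esub> then 1 else 0)) = a g"
        if g: "g \<in> carrier G"
      proof -
        have "inv\<^bsub>G\<^esub> h \<otimes>\<^bsub>G\<^esub> g = \<one>\<^bsub>G\<^esub> \<longleftrightarrow> h = g" if "h \<in> carrier G" for h
          using that g by (metis inv_solve_left one_closed r_one)
        then show ?thesis
          using assms g by (subst sum.remove[of _ g]) (auto intro: sum.neutral)
      qed
      then show "(a \<otimes>\<^bsub>?A\<^esub> \<one>\<^bsub>?A\<^esub>) g = a g"
        using a by (auto simp: A)
    qed
  qed (auto simp: A)
  show ?thesis
    by (rule ringI[OF ab mon]) (auto simp: A algebra_simps sum.distrib)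
qed

lemma principal_left_ideal_left_module:
  assumes "ring R" "a \<in> carrier R"
  shows "left_module R (principal_left_ideal R a)"
proof -
  interpret ring R by fact
  let ?I = "principal_left_ideal R a"
  note I = principal_left_ideal_def
  have ab: "abelian_group ?I"
  proof (rule abelian_groupI)
    fix x y assume "x \<in> carrier ?I" "y \<in> carrier ?I"
    then show "x \<oplus>\<^bsub>?I\<^esub> y \<in> carrier ?I"
      using assms by (auto simp: I l_distr[symmetric])
  next
    show "\<zero>\<^bsub>?I\<^esub> \<in> carrier ?I"
      using assms by (auto simp: I intro!: exI[of _ "\<zero>\<^bsub>R\<^esub>"])
  next
    fix x assume "x \<in> carrier ?I"
    then obtain r where "r \<in> carrier R" "x = r \<otimes>\<^bsub>R\<^esub> a" by (auto simp: I)
    then show "\<exists>y\<in>carrier ?I. y \<oplus>\<^bsub>?I\<^esub> x = \<zero>\<^bsub>?I\<^esub>"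
      using assms by (intro bexI[of _ "(\<ominus>\<^bsub>R\<^esub> r) \<otimes>\<^bsub>R\<^esub> a"])
        (auto simp: I l_distr[symmetric] l_neg)
  qed (use assms in \<open>auto simp: I a_ac\<close>)
  show ?thesis
  proof (intro left_module.intro left_module_axioms.intro)
    fix r x assume r: "r \<in> carrier R" "x \<in> carrier ?I"
    then obtain s where "s \<in> carrier R" "x = s \<otimes>\<^bsub>R\<^esub> a" by (auto simp: I)
    then show "r \<odot>\<^bsub>?I\<^esub> x \<in> carrier ?I"
      using r assms by (auto simp: I m_assoc[symmetric])
  qed (use ab assms in \<open>auto simp: I l_distr r_distr m_assoc\<close>)
qed

lemma lie_omega_closed:
  "lie_omega n \<in> carrier (group_algebra (sym_group n) :: ((nat \<Rightarrow> nat) \<Rightarrow> 'f::field) ring)"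
proof -
  let ?A = "group_algebra (sym_group n) :: ((nat \<Rightarrow> nat) \<Rightarrow> 'f) ring"
  interpret ring ?A
    by (rule group_algebra_ring[OF sym_group_is_group finite_sym_group])
  have closed: "foldr (\<lambda>i a. (\<one>\<^bsub>?A\<^esub> \<ominus>\<^bsub>?A\<^esub> group_elem (descending_cycle i)) \<otimes>\<^bsub>?A\<^esub> a) xs \<one>\<^bsub>?A\<^esub>
      \<in> carrier ?A" if "set xs \<subseteq> {1..n}" for xs
    using that
  proof (induction xs)
    case (Cons i xs)
    have "group_elem (descending_cycle i) \<in> carrier ?A"
      using Cons.prems by (intro group_elem_closed descending_cycle_in_sym_group) auto
    with Cons show ?case by simp
  qed simp
  have "set [2..<Suc n] \<subseteq> {1..n}"
    by auto
  from closed[OF this] show ?thesis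
    by (simp add: lie_omega_def Let_def del: upt_Suc)
qed

lemma Lie_left_module:
  "left_module (group_algebra (sym_group n)) (Lie n :: (_ \<Rightarrow> 'f::field, _) module)"
  unfolding Lie_def
  by (intro principal_left_ideal_left_module group_algebra_ring sym_group_is_group
      finite_sym_group lie_omega_closed)

lemma underlying_space_vectorspace:
  fixes M :: "('g \<Rightarrow> 'f::field, 'm, 'y) module_scheme"
  assumes "group G" "finite (carrier G)" "left_module (group_algebra G) M"
  shows "vectorspace (class_ring :: 'f ring) (underlying_space G M)"
proof -
  interpret group G by fact
  interpret M: left_module "group_algebra G" M by fact
  note U = underlying_space_def
  have closed: "scalar_elem G c \<in> carrier (group_algebra G)" for c :: 'f
    by (auto simp: scalar_elem_def group_algebra_def)
  have add: "scalar_elem G (c + c') = scalar_elem G c \<oplus>\<^bsub>group_algebra G\<^esub> scalar_elem G c'"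
    for c c' :: 'f
    by (auto simp: scalar_elem_def group_algebra_def)
  have one: "scalar_elem G (1::'f) = \<one>\<^bsub>group_algebra G\<^esub>"
    by (auto simp: scalar_elem_def group_algebra_def)
  have mult: "scalar_elem G (c * c') = scalar_elem G c \<otimes>\<^bsub>group_algebra G\<^esub> scalar_elem G c'"
    for c c' :: 'f
  proof
    fix g
    have "(\<Sum>h\<in>carrier G. scalar_elem G c h * scalar_elem G c' (inv\<^bsub>G\<^esub> h \<otimes>\<^bsub>G\<^esub> g))
        = c * scalar_elem G c' (inv\<^bsub>G\<^esub> \<one>\<^bsub>G\<^esub> \<otimes>\<^bsub>G\<^esub> g)"
      using assms(2) by (subst sum.remove[of _ "\<one>\<^bsub>G\<^esub>"])
        (auto simp: scalar_elem_def intro: sum.neutral)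
    then show "scalar_elem G (c * c') g
        = (scalar_elem G c \<otimes>\<^bsub>group_algebra G\<^esub> scalar_elem G c') g"
      by (auto simp: group_algebra_def scalar_elem_def)
  qed
  have "abelian_group (underlying_space G M)"
  proof (rule abelian_groupI)
    fix x assume "x \<in> carrier (underlying_space G M)"
    then show "\<exists>y\<in>carrier (underlying_space G M).
        y \<oplus>\<^bsub>underlying_space G M\<^esub> x = \<zero>\<^bsub>underlying_space G M\<^esub>"
      by (intro bexI[of _ "\<ominus>\<^bsub>M\<^esub> x"]) (auto simp: U M.M.l_neg)
  qed (auto simp: U M.M.a_ac)
  moreover have "cring (class_ring :: 'f ring)"
    using class_field by (rule fieldE)
  ultimately have "Module.module (class_ring :: 'f ring) (underlying_space G M)"
    by (intro Module.moduleI)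
       (auto simp: U closed add one mult M.smult_closed M.smult_l_distr M.smult_r_distr
          M.smult_assoc M.smult_one)
  then show ?thesis
    by (intro vectorspace.intro class_field)
qed

end

theory Submission
  imports Defs
    "HOL-Library.Function_Algebras"
    "HOL-Algebra.Group_Action"
    "HOL-Algebra.Sylow"
    "HOL-Algebra.Multiplicative_Group"
begin

text \<open>
  Let \<open>A\<close> be the group algebra of \<open>G = \<SS>_n\<close> and \<open>L = Lie(n)\<close>. The bound rests on one property of
  \<open>L\<close>: its restriction to the stabiliser of a point is free. Under the identification of \<open>A\<close> with
  the multilinear polynomials in \<open>n\<close> non-commuting letters, \<open>L\<close> is spanned by left-normed brackets;
  by the Jacobi identity those that begin with a prescribed letter \<open>z\<close> suffice, and they are
  independent because each of them contains exactly one word that begins with \<open>z\<close>. Hence restriction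
  to the permutations with \<open>\<sigma> 1 = z\<close> identifies \<open>L\<close> with the space of all functions on them
  (\<open>Lie_determined\<close>, \<open>Lie_extension\<close>), and a group that fixes \<open>z\<close> permutes these \<open>\<sigma>\<close> freely.

  Let \<open>P\<close> be a Sylow \<open>p\<close>-subgroup of \<open>G\<close>. If all its orbits on \<open>{1..n}\<close> had length divisible by
  \<open>p^(m+1)\<close>, then so would \<open>n\<close>; so some orbit has length \<open>p^k\<close> with \<open>k \<le> m\<close>. Let \<open>H\<close> be the
  stabiliser in \<open>P\<close> of one of its points. Then \<open>H\<close> has index \<open>p^k\<close> in \<open>P\<close> and \<open>L\<close> is free over \<open>H\<close>.

  For a subgroup \<open>U\<close> let \<open>X_U\<close> be the \<open>A\<close>-module coinduced from the restriction of \<open>L\<close> to \<open>U\<close>.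
  The module \<open>X_H\<close> is free (\<open>free_res_coind_free\<close>). If \<open>U\<close> is normal in \<open>V\<close> with \<open>V/U\<close> cyclic,
  then the periodic resolution of the trivial module of \<open>V/U\<close> yields an exact sequence
  \<open>0 \<rightarrow> X_V \<rightarrow> X_U \<rightarrow> X_U \<rightarrow> X_V \<rightarrow> 0\<close>, and mapping cones turn a free resolution of \<open>X_U\<close> with ranks
  \<open>b_0, b_1, \<dots>\<close> into one of \<open>X_V\<close> whose ranks are the partial sums \<open>b_0 + \<dots> + b_j\<close>
  (\<open>coind_cyclic_extension\<close>). In a \<open>p\<close>-group, \<open>H\<close> is joined to \<open>P\<close> by a chain of \<open>k\<close> steps of this
  kind, each normal of index \<open>p\<close> (\<open>p_group_cyclic_step\<close>). Starting from the ranks \<open>q, 0, 0, \<dots>\<close>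
  and summing \<open>k\<close> times, \<open>X_P\<close> has a free resolution whose ranks are \<open>O(j^(k-1))\<close>.

  The index of \<open>P\<close> is invertible in the field, so \<open>L\<close> is a retract of \<open>X_P\<close> (\<open>coind_retract\<close>), and
  the terms of a minimal resolution of a retract are no larger than those of any free resolution of
  the module itself (\<open>min_res_dim_le_of_retract\<close>). This gives complexity at most \<open>k \<le> m\<close>.

  Every module in the argument embeds in some \<open>A^r\<close>. It is therefore treated as a subspace of
  \<open>A^r\<close> that is stable under left translation by \<open>G\<close>; homomorphisms are linear maps of the ambient
  space that commute with translation on the subspace. The comparison with modules over the ring
  \<open>A\<close> comes at the end.
\<close>


section \<open>Finite-dimensional function spaces\<close>

definition fscale :: "'f::field \<Rightarrow> (nat \<Rightarrow> 'g \<Rightarrow> 'f) \<Rightarrow> (nat \<Rightarrow> 'g \<Rightarrow> 'f)" where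
  "fscale c u = (\<lambda>i x. c * u i x)"

interpretation fs: vector_space fscale
  by unfold_locales (auto simp: fscale_def fun_eq_iff algebra_simps)

interpretation fsp: vector_space_pair fscale fscale
  by unfold_locales

lemma fscale_apply: "fscale c u i x = c * u i x"
  by (simp add: fscale_def)

text \<open>
  Equations between vectors are kept at the level of functions and unfolded pointwise on request
  only.
\<close>

lemmas pointwise = plus_fun_apply zero_fun_apply minus_apply uminus_apply fscale_apply

declare plus_fun_apply [simp del] zero_fun_apply [simp del] minus_apply [simp del] uminus_apply [simp del]

abbreviation flinear :: "((nat \<Rightarrow> 'g \<Rightarrow> 'f::field) \<Rightarrow> (nat \<Rightarrow> 'g \<Rightarrow> 'f)) \<Rightarrow> bool" where
  "flinear \<equiv> Vector_Spaces.linear fscale fscale"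

lemma sum_apply: "sum f A i = (\<Sum>a\<in>A. f a i)"
  by (induction A rule: infinite_finite_induct) (auto simp: pointwise)

lemma flinearI:
  assumes "\<And>u v. f (u + v) = f u + f v" "\<And>c u. f (fscale c u) = fscale c (f u)"
  shows "flinear f"
  unfolding Vector_Spaces.linear_iff using assms fs.vector_space_axioms by blast

lemma flinear_comp: "flinear f \<Longrightarrow> flinear g \<Longrightarrow> flinear (\<lambda>u. f (g u))"
  using Vector_Spaces.linear_compose[of fscale fscale g fscale f] by (simp add: comp_def)

lemma flinear_0: "flinear f \<Longrightarrow> f 0 = 0"
  and flinear_add: "flinear f \<Longrightarrow> f (u + v) = f u + f v"
  and flinear_scale: "flinear f \<Longrightarrow> f (fscale c u) = fscale c (f u)"
  and flinear_diff: "flinear f \<Longrightarrow> f (u - v) = f u - f v"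
  and flinear_sum: "flinear f \<Longrightarrow> f (sum h A) = (\<Sum>a\<in>A. f (h a))"
  by (rule fsp.linear_0 fsp.linear_add fsp.linear_scale fsp.linear_diff fsp.linear_sum; assumption)+

text \<open>
  The ambient space of all functions has infinite dimension, hence the finite spanning set.
\<close>

definition fin_dim_space :: "(nat \<Rightarrow> 'g \<Rightarrow> 'f::field) set \<Rightarrow> bool" where
  "fin_dim_space V \<longleftrightarrow> fs.subspace V \<and> (\<exists>W. finite W \<and> V \<subseteq> fs.span W)"

lemma fin_dim_space_basis:
  assumes "fin_dim_space V"
  obtains B where "B \<subseteq> V" "finite B" "fs.independent B" "fs.span B = V" "card B = fs.dim V"
proof -
  obtain B where B: "B \<subseteq> V" "fs.independent B" "V \<subseteq> fs.span B" "card B = fs.dim V"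
    using fs.basis_exists by blast
  obtain W where "finite W" "V \<subseteq> fs.span W" using assms by (auto simp: fin_dim_space_def)
  then have "finite B" using B fs.independent_span_bound[of W B] by blast
  moreover have "fs.span B = V"
    using B assms fs.span_minimal[of B V] by (auto simp: fin_dim_space_def)
  ultimately show ?thesis using that B by blast
qed

lemma fin_dim_space_independent_le:
  assumes "fin_dim_space V" "B \<subseteq> V" "fs.independent B"
  shows "finite B" "card B \<le> fs.dim V"
proof -
  obtain C where C: "finite C" "fs.span C = V" "card C = fs.dim V"
    using fin_dim_space_basis[OF assms(1)] by metis
  then show "finite B" "card B \<le> fs.dim V" using fs.independent_span_bound[of C B] assms by auto
qed

lemma fin_dim_space_subset:
  "fin_dim_space V \<Longrightarrow> fs.subspace W \<Longrightarrow> W \<subseteq> V \<Longrightarrow> fin_dim_space W"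
  unfolding fin_dim_space_def by blast

lemma fs_dim_mono:
  assumes "fin_dim_space V" "W \<subseteq> V" shows "fs.dim W \<le> fs.dim V"
proof -
  obtain B where "finite B" "fs.span B = V" "card B = fs.dim V"
    using fin_dim_space_basis[OF assms(1)] by metis
  then show ?thesis using fs.dim_le_card[of W B] assms by auto
qed

lemma fs_subspace_eqI:
  assumes "fin_dim_space V" "fs.subspace W" "W \<subseteq> V" "fs.dim V \<le> fs.dim W"
  shows "W = V"
proof (rule ccontr)
  assume "W \<noteq> V"
  then obtain v where v: "v \<in> V" "v \<notin> W" using assms by blast
  obtain B where B: "B \<subseteq> W" "finite B" "fs.independent B" "fs.span B = W" "card B = fs.dim W"
    using fin_dim_space_basis[OF fin_dim_space_subset[OF assms(1-3)]] by metis
  have "fs.independent (insert v B)" using v B fs.independent_insertI by auto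
  then have "card (insert v B) \<le> fs.dim V"
    using fin_dim_space_independent_le[OF assms(1), of "insert v B"] v B assms by auto
  moreover have "v \<notin> B" using v B by auto
  ultimately show False using B assms by auto
qed

lemma fin_dim_space_image:
  assumes "fin_dim_space V" "flinear f"
  shows "fin_dim_space (f ` V)" "fs.dim (f ` V) \<le> fs.dim V"
proof -
  obtain B where B: "B \<subseteq> V" "finite B" "fs.independent B" "fs.span B = V" "card B = fs.dim V"
    using fin_dim_space_basis[OF assms(1)] by metis
  have s: "f ` V = fs.span (f ` B)" using B fsp.linear_span_image[OF assms(2)] by metis
  show "fin_dim_space (f ` V)" using B s by (auto simp: fin_dim_space_def)
  have "fs.dim (f ` V) \<le> card (f ` B)" using fs.dim_le_card[of "f ` V" "f ` B"] B s by auto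
  also have "\<dots> \<le> card B" using B card_image_le by blast
  finally show "fs.dim (f ` V) \<le> fs.dim V" using B by simp
qed

lemma flinear_dim_image_inj:
  assumes "fin_dim_space V" "flinear f" "inj_on f V"
  shows "fs.dim (f ` V) = fs.dim V"
proof -
  obtain B where B: "B \<subseteq> V" "finite B" "fs.independent B" "fs.span B = V" "card B = fs.dim V"
    using fin_dim_space_basis[OF assms(1)] by metis
  have "fs.independent (f ` B)"
    using fsp.linear_independent_injective_image[OF assms(2)] B assms by auto
  then have "card (f ` B) \<le> fs.dim (f ` V)"
    using fin_dim_space_independent_le[OF fin_dim_space_image(1)[OF assms(1,2)], of "f ` B"] B by auto
  moreover have "card (f ` B) = card B" using B assms card_image inj_on_subset by metis
  ultimately show ?thesis using B fin_dim_space_image(2)[OF assms(1,2)] by simp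
qed

lemma flinear_endo_inj_imp_surj:
  assumes "fin_dim_space V" "flinear f" "f ` V \<subseteq> V" "inj_on f V"
  shows "f ` V = V"
  using fs_subspace_eqI[of V "f ` V"] fin_dim_space_image(1)[OF assms(1,2)]
    flinear_dim_image_inj[OF assms(1,2,4)] assms
  unfolding fin_dim_space_def by (metis le_refl)

lemma flinear_surj_imp_inj:
  assumes "fin_dim_space V" "flinear f" "fs.dim V \<le> fs.dim (f ` V)"
  shows "inj_on f V"
proof -
  obtain B where B: "B \<subseteq> V" "finite B" "fs.independent B" "fs.span B = V" "card B = fs.dim V"
    using fin_dim_space_basis[OF assms(1)] by metis
  have s: "f ` V = fs.span (f ` B)" using B fsp.linear_span_image[OF assms(2)] by metis
  have "card B \<le> card (f ` B)" using fs.dim_le_card[of "f ` V" "f ` B"] B s assms by auto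
  then have inj: "inj_on f B" using B by (metis card_image_le eq_card_imp_inj_on le_antisym)
  have "fs.independent (f ` B)"
  proof
    assume "fs.dependent (f ` B)"
    then obtain a where a: "a \<in> f ` B" "a \<in> fs.span (f ` B - {a})" by (auto simp: fs.dependent_def)
    then have "fs.span (f ` B - {a}) = fs.span (f ` B)"
      by (metis fs.span_redundant insert_Diff)
    then have "fs.dim (f ` V) \<le> card (f ` B - {a})"
      using fs.dim_le_card[of "f ` V" "f ` B - {a}"] B s by auto
    also have "\<dots> < card (f ` B)" using a B by (meson card_Diff1_less finite_imageI)
    also have "\<dots> \<le> card B" using B card_image_le by blast
    finally show False using B assms by simp
  qed
  then show ?thesis using fsp.linear_inj_on_span_independent_image[OF assms(2) _ inj] B by simp
qed


section \<open>Modules over the group algebra as stable subspaces of free modules\<close>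

locale finite_group = group G for G :: "('g, 'x) monoid_scheme" (structure) +
  assumes finite_carrier: "finite (carrier G)"
begin

text \<open>
  Left multiplication by \<open>g\<close> on each coordinate of an element \<open>u = (u 0, u 1, \<dots>)\<close> of \<open>A^r\<close>. It
  is defined on all functions so that it is linear on the ambient space.
\<close>

definition act :: "'g \<Rightarrow> (nat \<Rightarrow> 'g \<Rightarrow> 'f::field) \<Rightarrow> (nat \<Rightarrow> 'g \<Rightarrow> 'f)" where
  "act g u = (\<lambda>i x. if x \<in> carrier G then u i (inv g \<otimes> x) else 0)"

text \<open>
  All \<open>A^r\<close> lie in the same type, \<open>A^r\<close> being contained in \<open>A^s\<close> for \<open>r \<le> s\<close>.
\<close>

definition free_mod :: "nat \<Rightarrow> (nat \<Rightarrow> 'g \<Rightarrow> 'f::field) set" where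
  "free_mod r = {u. \<forall>i x. u i x \<noteq> 0 \<longrightarrow> i < r \<and> x \<in> carrier G}"

definition gmod :: "(nat \<Rightarrow> 'g \<Rightarrow> 'f::field) set \<Rightarrow> bool" where
  "gmod V \<longleftrightarrow> fs.subspace V \<and> (\<exists>r. V \<subseteq> free_mod r) \<and> (\<forall>g\<in>carrier G. \<forall>u\<in>V. act g u \<in> V)"

definition ghom :: "(nat \<Rightarrow> 'g \<Rightarrow> 'f::field) set \<Rightarrow> (nat \<Rightarrow> 'g \<Rightarrow> 'f) set \<Rightarrow>
    ((nat \<Rightarrow> 'g \<Rightarrow> 'f) \<Rightarrow> (nat \<Rightarrow> 'g \<Rightarrow> 'f)) \<Rightarrow> bool" where
  "ghom V W f \<longleftrightarrow> flinear f \<and> f ` V \<subseteq> W \<and> (\<forall>g\<in>carrier G. \<forall>u\<in>V. f (act g u) = act g (f u))"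

definition gker :: "(nat \<Rightarrow> 'g \<Rightarrow> 'f::field) set \<Rightarrow>
    ((nat \<Rightarrow> 'g \<Rightarrow> 'f) \<Rightarrow> (nat \<Rightarrow> 'g \<Rightarrow> 'f)) \<Rightarrow> (nat \<Rightarrow> 'g \<Rightarrow> 'f) set" where
  "gker V f = {u \<in> V. f u = 0}"

lemma free_modD: "u \<in> free_mod r \<Longrightarrow> \<not> (i < r \<and> x \<in> carrier G) \<Longrightarrow> u i x = 0"
  by (auto simp: free_mod_def)

lemma free_mod_mono: "r \<le> s \<Longrightarrow> free_mod r \<subseteq> free_mod s"
  by (force simp: free_mod_def)

lemma flinear_act: "flinear (act g)"
  by (rule flinearI) (auto simp: act_def fun_eq_iff pointwise)

lemma act_act: "g \<in> carrier G \<Longrightarrow> h \<in> carrier G \<Longrightarrow> act g (act h u) = act (g \<otimes> h) u"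
  by (auto simp: act_def fun_eq_iff pointwise inv_mult_group m_assoc)

lemma act_one: "u \<in> free_mod r \<Longrightarrow> act \<one> u = u"
  by (auto simp: act_def fun_eq_iff pointwise dest: free_modD)

lemma subspace_free_mod: "fs.subspace (free_mod r)"
  by (rule fs.subspaceI) (auto simp: free_mod_def pointwise, metis add.right_neutral, metis add.right_neutral)

lemma gmod_free_mod: "gmod (free_mod r)"
  unfolding gmod_def using subspace_free_mod by (auto simp: free_mod_def act_def split: if_splits)

lemma gmod_subspace: "gmod V \<Longrightarrow> fs.subspace V"
  and gmod_act: "gmod V \<Longrightarrow> g \<in> carrier G \<Longrightarrow> u \<in> V \<Longrightarrow> act g u \<in> V"
  by (auto simp: gmod_def)

lemma gmod_subset: "gmod V \<Longrightarrow> fs.subspace W \<Longrightarrow> W \<subseteq> V \<Longrightarrow> (\<And>g u. g \<in> carrier G \<Longrightarrow> u \<in> W \<Longrightarrow> act g u \<in> W)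
  \<Longrightarrow> gmod W"
  unfolding gmod_def by blast

lemma ghom_flinear: "ghom V W f \<Longrightarrow> flinear f"
  and ghom_closed: "ghom V W f \<Longrightarrow> u \<in> V \<Longrightarrow> f u \<in> W"
  and ghom_act: "ghom V W f \<Longrightarrow> g \<in> carrier G \<Longrightarrow> u \<in> V \<Longrightarrow> f (act g u) = act g (f u)"
  by (auto simp: ghom_def)

lemma ghom_comp: "ghom V W f \<Longrightarrow> ghom W X g \<Longrightarrow> ghom V X (\<lambda>u. g (f u))"
  using flinear_comp[of g f] by (simp add: ghom_def image_subset_iff)

lemma ghom_subset: "ghom V W f \<Longrightarrow> V' \<subseteq> V \<Longrightarrow> f ` V' \<subseteq> W' \<Longrightarrow> ghom V' W' f"
  unfolding ghom_def by blast

lemma ghom_id: "V \<subseteq> W \<Longrightarrow> ghom V W (\<lambda>u. u)"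
  unfolding ghom_def by (auto intro: flinearI)

lemma gmod_image: "gmod V \<Longrightarrow> gmod W \<Longrightarrow> ghom V W f \<Longrightarrow> gmod (f ` V)"
  by (rule gmod_subset[of W])
     (auto simp: gmod_def ghom_def intro: fsp.linear_subspace_image, metis imageI)

lemma gmod_gker: "gmod V \<Longrightarrow> ghom V W f \<Longrightarrow> gmod (gker V f)"
proof (rule gmod_subset[of V])
  assume V: "gmod V" and f: "ghom V W f"
  show "fs.subspace (gker V f)"
    using gmod_subspace[OF V] flinear_0[OF ghom_flinear[OF f]] flinear_add[OF ghom_flinear[OF f]]
      flinear_scale[OF ghom_flinear[OF f]]
    by (auto simp: gker_def fs.subspace_def)
  show "\<And>g u. g \<in> carrier G \<Longrightarrow> u \<in> gker V f \<Longrightarrow> act g u \<in> gker V f"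
    using gmod_act[OF V] ghom_act[OF f] flinear_0[OF flinear_act]
 by (auto simp: gker_def)
qed (auto simp: gker_def)

lemma gker_subset: "gker V f \<subseteq> V"
  by (auto simp: gker_def)

text \<open>
  The standard basis of \<open>A^r\<close>.
\<close>

definition gen :: "nat \<Rightarrow> nat \<Rightarrow> 'g \<Rightarrow> 'f::field" where
  "gen i = (\<lambda>j x. if j = i \<and> x = \<one> then 1 else 0)"

lemma gen_in_free_mod: "i < r \<Longrightarrow> gen i \<in> free_mod r"
  by (auto simp: gen_def free_mod_def)

lemma act_gen:
  assumes "g \<in> carrier G"
  shows "act g (gen i) = (\<lambda>j x. if j = i \<and> x = g then 1 else 0)"
proof -
  have "inv g \<otimes> x = \<one> \<longleftrightarrow> x = g" if "x \<in> carrier G" for x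
    using assms that by (metis inv_solve_left one_closed r_one)
  then show ?thesis using assms by (auto simp: act_def gen_def fun_eq_iff pointwise)
qed

lemma free_mod_expand:
  assumes "u \<in> free_mod r"
  shows "u = (\<Sum>i<r. \<Sum>g\<in>carrier G. fscale (u i g) (act g (gen i)))"
proof (intro ext)
  fix j x
  have "(\<Sum>i<r. \<Sum>g\<in>carrier G. u i g * (if j = i \<and> x = g then 1 else 0))
      = (\<Sum>i<r. if i = j then (\<Sum>g\<in>carrier G. if g = x then u j g else 0) else 0)"
    by (rule sum.cong[OF refl]) (auto intro!: sum.cong)
  also have "\<dots> = (if j < r \<and> x \<in> carrier G then u j x else 0)"
    using finite_carrier by simp
  also have "\<dots> = u j x" using free_modD[OF assms] by auto
  finally show "u j x = (\<Sum>i<r. \<Sum>g\<in>carrier G. fscale (u i g) (act g (gen i))) j x"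
    by (simp add: sum_apply act_gen pointwise)
qed

lemma fin_dim_free_mod:
  "fin_dim_space (free_mod r :: (nat \<Rightarrow> 'g \<Rightarrow> 'f::field) set)"
  "fs.dim (free_mod r :: (nat \<Rightarrow> 'g \<Rightarrow> 'f::field) set) \<le> r * card (carrier G)"
proof -
  let ?W = "(\<lambda>(i, g). act g (gen i) :: nat \<Rightarrow> 'g \<Rightarrow> 'f) ` ({..<r} \<times> carrier G)"
  have sub: "free_mod r \<subseteq> fs.span ?W"
  proof
    fix u :: "nat \<Rightarrow> 'g \<Rightarrow> 'f" assume "u \<in> free_mod r"
    then have "u = (\<Sum>i<r. \<Sum>g\<in>carrier G. fscale (u i g) (act g (gen i)))"
      by (rule free_mod_expand)
    also have "\<dots> \<in> fs.span ?W"
      by (intro fs.span_sum fs.span_scale fs.span_base) auto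
    finally show "u \<in> fs.span ?W" .
  qed
  show "fin_dim_space (free_mod r :: (nat \<Rightarrow> 'g \<Rightarrow> 'f) set)"
    using finite_carrier subspace_free_mod sub unfolding fin_dim_space_def by (intro conjI exI[of _ ?W]) auto
  have "fs.dim (free_mod r :: (nat \<Rightarrow> 'g \<Rightarrow> 'f) set) \<le> card ?W"
    using sub finite_carrier by (intro fs.dim_le_card) auto
  also have "\<dots> \<le> card ({..<r} \<times> carrier G)"
    using finite_carrier by (intro card_image_le) auto
  finally show "fs.dim (free_mod r :: (nat \<Rightarrow> 'g \<Rightarrow> 'f) set) \<le> r * card (carrier G)"
    by (simp add: card_cartesian_product)
qed

lemma gmod_fin_dim: "gmod V \<Longrightarrow> fin_dim_space V"
  using fin_dim_free_mod(1) fin_dim_space_subset unfolding gmod_def by metis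

definition free_map :: "nat \<Rightarrow> (nat \<Rightarrow> nat \<Rightarrow> 'g \<Rightarrow> 'f::field) \<Rightarrow> (nat \<Rightarrow> 'g \<Rightarrow> 'f) \<Rightarrow> (nat \<Rightarrow> 'g \<Rightarrow> 'f)" where
  "free_map r b u = (\<Sum>i<r. \<Sum>g\<in>carrier G. fscale (u i g) (act g (b i)))"

lemma flinear_free_map: "flinear (free_map r b)"
  by (rule flinearI)
     (simp_all add: free_map_def pointwise fs.scale_left_distrib sum.distrib fs.scale_sum_right)

lemma ghom_free_map:
  assumes "gmod V" "\<And>i. i < r \<Longrightarrow> b i \<in> V"
  shows "ghom (free_mod r) V (free_map r b)"
  unfolding ghom_def
proof (intro conjI ballI)
  show "flinear (free_map r b)" by (rule flinear_free_map)
  show "free_map r b ` free_mod r \<subseteq> V"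
    using assms gmod_subspace[OF assms(1)]
    by (auto simp: free_map_def intro!: fs.subspace_sum fs.subspace_scale gmod_act)
next
  fix g and u :: "nat \<Rightarrow> 'g \<Rightarrow> 'a" assume g: "g \<in> carrier G" and u: "u \<in> free_mod r"
  have "free_map r b (act g u) = (\<Sum>i<r. \<Sum>x\<in>carrier G. fscale (u i (inv g \<otimes> x)) (act x (b i)))"
    by (simp add: free_map_def act_def)
  also have "\<dots> = (\<Sum>i<r. \<Sum>x\<in>carrier G. fscale (u i x) (act g (act x (b i))))"
  proof (rule sum.cong[OF refl])
    fix i
    show "(\<Sum>x\<in>carrier G. fscale (u i (inv g \<otimes> x)) (act x (b i)))
        = (\<Sum>x\<in>carrier G. fscale (u i x) (act g (act x (b i))))"
      by (rule sum.reindex_bij_witness[where i = "\<lambda>x. g \<otimes> x" and j = "\<lambda>x. inv g \<otimes> x"])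
         (use g in \<open>auto simp: m_assoc[symmetric] act_act\<close>)
  qed
  also have "\<dots> = act g (free_map r b u)"
    by (simp add: free_map_def flinear_sum[OF flinear_act] flinear_scale[OF flinear_act])
  finally show "free_map r b (act g u) = act g (free_map r b u)" .
qed

lemma ghom_free_eq_free_map:
  assumes f: "ghom (free_mod r) V f" and u: "u \<in> free_mod r"
  shows "f u = free_map r (\<lambda>i. f (gen i)) u"
proof -
  have "f u = f (\<Sum>i<r. \<Sum>g\<in>carrier G. fscale (u i g) (act g (gen i)))"
    using free_mod_expand[OF u] by simp
  also have "\<dots> = free_map r (\<lambda>i. f (gen i)) u"
    by (simp add: free_map_def flinear_sum[OF ghom_flinear[OF f]] flinear_scale[OF ghom_flinear[OF f]]
        ghom_act[OF f] gen_in_free_mod)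
  finally show ?thesis .
qed

lemma ghom_free_map_comp:
  assumes f: "ghom V W f" and b: "\<And>i. i < r \<Longrightarrow> b i \<in> V"
  shows "f (free_map r b u) = free_map r (\<lambda>i. f (b i)) u"
  by (simp add: free_map_def flinear_sum[OF ghom_flinear[OF f]] flinear_scale[OF ghom_flinear[OF f]]
        ghom_act[OF f] b)

text \<open>
  Free modules are projective: lift the images of the basis vectors and extend by
  \<open>free_map\<close>.
\<close>

lemma free_lift:
  assumes B: "gmod B" and p: "ghom B C p" "C \<subseteq> p ` B" and h: "ghom (free_mod r) C h"
  obtains g where "ghom (free_mod r) B g" "\<And>u. u \<in> free_mod r \<Longrightarrow> p (g u) = h u"
proof -
  have "\<exists>b\<in>B. p b = h (gen i)" if "i < r" for i
    using ghom_closed[OF h gen_in_free_mod[OF that]] p by fastforce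
  then obtain b where b: "\<And>i. i < r \<Longrightarrow> b i \<in> B" "\<And>i. i < r \<Longrightarrow> p (b i) = h (gen i)"
    by metis
  show ?thesis
  proof
    show "ghom (free_mod r) B (free_map r b)" by (rule ghom_free_map[OF B b(1)])
    show "p (free_map r b u) = h u" if "u \<in> free_mod r" for u
    proof -
      have "p (free_map r b u) = free_map r (\<lambda>i. p (b i)) u"
        by (rule ghom_free_map_comp[OF p(1) b(1)])
      also have "\<dots> = h u"
        unfolding ghom_free_eq_free_map[OF h that] by (simp add: free_map_def b(2))
      finally show ?thesis .
    qed
  qed
qed

text \<open>
  A basis over the field generates the module over \<open>A\<close>.
\<close>

lemma gmod_free_cover:
  assumes V: "gmod V"
  obtains r f where "ghom (free_mod r) V f" "f ` free_mod r = V"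
proof -
  obtain B where B: "B \<subseteq> V" "finite B" "fs.span B = V"
    using fin_dim_space_basis[OF gmod_fin_dim[OF V]] by metis
  obtain r and b :: "nat \<Rightarrow> _" where b: "B = b ` {..<r}"
    using finite_imp_nat_seg_image_inj_on[OF B(2)] by (auto simp: lessThan_def)
  have bV: "\<And>i. i < r \<Longrightarrow> b i \<in> V" using B b by auto
  have f: "ghom (free_mod r) V (free_map r b)" by (rule ghom_free_map[OF V bV])
  have "b i \<in> free_map r b ` free_mod r" if "i < r" for i
  proof -
    have "free_map r b (gen i) = (\<Sum>j<r. if j = i then (\<Sum>g\<in>carrier G. if g = \<one> then b i else 0) else 0)"
      unfolding free_map_def
    proof (intro sum.cong[OF refl])
      fix j
      obtain s where "V \<subseteq> free_mod s" using V by (auto simp: gmod_def)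
      then have "act \<one> (b i) = b i" using act_one bV[OF that] by blast
      then show "(\<Sum>g\<in>carrier G. fscale (gen i j g) (act g (b j)))
        = (if j = i then (\<Sum>g\<in>carrier G. if g = \<one> then b i else 0) else 0)"
        by (auto simp: gen_def intro!: sum.cong sum.neutral)
    qed
    also have "\<dots> = b i" using that finite_carrier by simp
    finally show ?thesis using gen_in_free_mod[OF that] by (metis imageI)
  qed
  then have "fs.span B \<subseteq> free_map r b ` free_mod r"
    using b by (intro fs.span_minimal fsp.linear_subspace_image[OF flinear_free_map] subspace_free_mod) auto
  then show ?thesis using that f B by (metis ghom_def order_antisym_conv)
qed

section \<open>Free resolutions of bounded rank\<close>

text \<open>
  \<open>free_res t a V\<close> means that \<open>V\<close> has an exact sequence of \<open>t\<close> free modules ending in \<open>V\<close>, of ranks at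
  most \<open>a 0, a 1, \<dots>\<close>. Truncated resolutions suffice, since each term of a minimal resolution is
  compared with finitely many terms only.
\<close>

primrec free_res :: "nat \<Rightarrow> (nat \<Rightarrow> nat) \<Rightarrow> (nat \<Rightarrow> 'g \<Rightarrow> 'f::field) set \<Rightarrow> bool" where
  "free_res 0 a V \<longleftrightarrow> True"
| "free_res (Suc t) a V \<longleftrightarrow> (\<exists>r f. r \<le> a 0 \<and> ghom (free_mod r) V f \<and> f ` free_mod r = V \<and>
      free_res t (\<lambda>j. a (Suc j)) (gker (free_mod r) f))"

text \<open>
  The direct sum of \<open>A^r\<close> and \<open>A^s\<close> is \<open>A^(r+s)\<close>: the first summand is included as it stands, with
  projection \<open>trunc r\<close>, and the second is included by \<open>shift_up r\<close>, with projection
  \<open>shift_down r\<close>.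
\<close>

definition shift_up :: "nat \<Rightarrow> (nat \<Rightarrow> 'g \<Rightarrow> 'f::field) \<Rightarrow> (nat \<Rightarrow> 'g \<Rightarrow> 'f)" where
  "shift_up r u = (\<lambda>i x. if r \<le> i then u (i - r) x else 0)"

definition shift_down :: "nat \<Rightarrow> (nat \<Rightarrow> 'g \<Rightarrow> 'f::field) \<Rightarrow> (nat \<Rightarrow> 'g \<Rightarrow> 'f)" where
  "shift_down r u = (\<lambda>i x. u (i + r) x)"

definition trunc :: "nat \<Rightarrow> (nat \<Rightarrow> 'g \<Rightarrow> 'f::field) \<Rightarrow> (nat \<Rightarrow> 'g \<Rightarrow> 'f)" where
  "trunc r u = (\<lambda>i x. if i < r then u i x else 0)"

lemma ghom_trunc: "ghom (free_mod (r + s)) (free_mod r) (trunc r)"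
  unfolding ghom_def
proof (intro conjI ballI)
  show "flinear (trunc r)" by (rule flinearI) (auto simp: trunc_def fun_eq_iff pointwise)
qed (auto simp: trunc_def act_def free_mod_def fun_eq_iff pointwise split: if_splits)

lemma ghom_shift_down: "ghom (free_mod (r + s)) (free_mod s) (shift_down r)"
  unfolding ghom_def
proof (intro conjI ballI)
  show "flinear (shift_down r)" by (rule flinearI) (auto simp: shift_down_def fun_eq_iff pointwise)
  show "shift_down r ` free_mod (r + s) \<subseteq> free_mod s"
    by (force simp: shift_down_def free_mod_def)
qed (auto simp: shift_down_def act_def fun_eq_iff pointwise)

lemma ghom_shift_up: "ghom (free_mod s) (free_mod (r + s)) (shift_up r)"
  unfolding ghom_def
proof (intro conjI ballI)
  show "flinear (shift_up r)" by (rule flinearI) (auto simp: shift_up_def fun_eq_iff pointwise)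
  show "shift_up r ` free_mod s \<subseteq> free_mod (r + s)"
    by (force simp: shift_up_def free_mod_def)
qed (auto simp: shift_up_def act_def fun_eq_iff pointwise)

lemma shift_down_up [simp]: "shift_down r (shift_up r u) = u"
  by (auto simp: shift_down_def shift_up_def)

lemma trunc_free_mod: "u \<in> free_mod r \<Longrightarrow> trunc r u = u"
  by (auto simp: trunc_def fun_eq_iff pointwise dest: free_modD)

lemma trunc_shift_up [simp]: "trunc r (shift_up r u) = 0"
  by (auto simp: trunc_def fun_eq_iff pointwise shift_up_def)

lemma shift_down_free_mod: "u \<in> free_mod r \<Longrightarrow> shift_down r u = 0"
  by (auto simp: shift_down_def fun_eq_iff pointwise dest: free_modD)

lemma shift_down_eq_0: "shift_down r u = 0 \<Longrightarrow> trunc r u = u"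
  by (auto simp: trunc_def shift_down_def fun_eq_iff pointwise) (metis le_add_diff_inverse2 not_le)

lemma ghom_add:
  assumes W: "gmod W" and f: "ghom V W f" and g: "ghom V W g"
  shows "ghom V W (\<lambda>u. f u + g u)"
proof -
  have "flinear (\<lambda>u. f u + g u)"
    by (rule flinearI) (simp_all only: flinear_add[OF ghom_flinear[OF f]] flinear_add[OF ghom_flinear[OF g]]
        flinear_scale[OF ghom_flinear[OF f]] flinear_scale[OF ghom_flinear[OF g]] fs.scale_right_distrib add_ac)
  then show ?thesis
    using f g fs.subspace_add[OF gmod_subspace[OF W]]
    by (auto simp: ghom_def flinear_add[OF flinear_act] image_subset_iff)
qed

text \<open>
  The horseshoe lemma for \<open>0 \<rightarrow> A \<rightarrow> B \<rightarrow> C \<rightarrow> 0\<close>. The cover of \<open>C\<close> lifts to \<open>B\<close> and, together with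
  the cover of \<open>A\<close>, covers \<open>B\<close>; the kernel of this cover is an extension of the kernel over \<open>C\<close> by
  the kernel over \<open>A\<close>, so the construction repeats.
\<close>

lemma free_res_horseshoe:
  assumes "gmod A" "gmod B" "gmod C"
    and "ghom A B i" "inj_on i A" "ghom B C p" "p ` B = C" "gker B p = i ` A"
    and "free_res t a A" "free_res t c C"
  shows "free_res t (\<lambda>j. a j + c j) B"
  using assms
proof (induction t arbitrary: a c A B C i p)
  case (Suc t)
  note gA = Suc.prems(1) and gB = Suc.prems(2) and gC = Suc.prems(3)
    and i = Suc.prems(4) and inj = Suc.prems(5) and p = Suc.prems(6) and pB = Suc.prems(7)
    and ker = Suc.prems(8)
  from Suc.prems(9) obtain r f where f: "r \<le> a 0" "ghom (free_mod r) A f" "f ` free_mod r = A"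
    "free_res t (\<lambda>j. a (Suc j)) (gker (free_mod r) f)" by auto
  from Suc.prems(10) obtain s h where h: "s \<le> c 0" "ghom (free_mod s) C h" "h ` free_mod s = C"
    "free_res t (\<lambda>j. c (Suc j)) (gker (free_mod s) h)" by auto
  obtain g where g: "ghom (free_mod s) B g" "\<And>u. u \<in> free_mod s \<Longrightarrow> p (g u) = h u"
    using free_lift[OF gB p _ h(2)] pB by blast
  \<comment> \<open>the cover of \<open>B\<close> assembled from that of \<open>A\<close> and the lift of that of \<open>C\<close>\<close>
  define F where "F = (\<lambda>u. i (f (trunc r u)) + g (shift_down r u))"
  have F: "ghom (free_mod (r + s)) B F"
    unfolding F_def by (intro ghom_add gB ghom_comp[OF ghom_comp[OF ghom_trunc f(2)] i]
        ghom_comp[OF ghom_shift_down g(1)])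
  note lin = flinear_add[OF ghom_flinear] flinear_0[OF ghom_flinear]
  have pi: "p (i x) = 0" if "x \<in> A" for x using ker that by (auto simp: gker_def)
  have F_surj: "F ` free_mod (r + s) = B"
  proof
    show "F ` free_mod (r + s) \<subseteq> B" using F by (auto simp: ghom_def)
    show "B \<subseteq> F ` free_mod (r + s)"
    proof
      fix b assume b: "b \<in> B"
      then obtain y where y: "y \<in> free_mod s" "h y = p b" using h(3) pB by (metis imageE imageI)
      have "b - g y \<in> gker B p"
        using b y g ghom_closed[OF g(1) y(1)] gmod_subspace[OF gB]
        by (auto simp: gker_def flinear_diff[OF ghom_flinear[OF p]] fs.subspace_diff)
      then obtain x where x: "x \<in> free_mod r" "b - g y = i (f x)" using ker f(3) by auto
      have xy: "x + shift_up r y \<in> free_mod (r + s)"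
        using x y ghom_closed[OF ghom_shift_up y(1), of r] free_mod_mono[of r "r + s"]
        by (intro fs.subspace_add subspace_free_mod) auto
      have "F (x + shift_up r y) = i (f x) + g y"
        using x y by (simp add: F_def lin[OF ghom_trunc] lin[OF ghom_shift_down] trunc_free_mod shift_down_free_mod)
      then show "b \<in> F ` free_mod (r + s)" using x xy by (metis diff_add_cancel imageI)
    qed
  qed
  have sdK: "shift_down r u \<in> gker (free_mod s) h" if "u \<in> gker (free_mod (r + s)) F" for u
  proof -
    have u: "u \<in> free_mod (r + s)" "F u = 0" using that by (auto simp: gker_def)
    then have "p (F u) = 0" by (simp only: lin(2)[OF p])
    then have "h (shift_down r u) = 0"
      using u ghom_closed[OF ghom_trunc u(1)] ghom_closed[OF ghom_shift_down u(1)] ghom_closed[OF f(2)]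
      by (simp add: F_def lin[OF p] pi g)
    then show ?thesis using ghom_closed[OF ghom_shift_down u(1)] by (simp add: gker_def)
  qed
  have K1: "gmod (gker (free_mod r) f)" "gmod (gker (free_mod (r + s)) F)" "gmod (gker (free_mod s) h)"
    using gmod_gker[OF gmod_free_mod] f h F by blast+
  have incl: "gker (free_mod r) f \<subseteq> gker (free_mod (r + s)) F"
    using free_mod_mono[of r "r + s"] lin[OF i] lin[OF g(1)]
    by (auto simp: gker_def F_def trunc_free_mod shift_down_free_mod)
  then have K2: "ghom (gker (free_mod r) f) (gker (free_mod (r + s)) F) (\<lambda>u. u)" by (rule ghom_id)
  have K3: "ghom (gker (free_mod (r + s)) F) (gker (free_mod s) h) (shift_down r)"
    by (rule ghom_subset[OF ghom_shift_down gker_subset]) (use sdK in auto)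
  have K4: "shift_down r ` gker (free_mod (r + s)) F = gker (free_mod s) h"
  proof
    show "shift_down r ` gker (free_mod (r + s)) F \<subseteq> gker (free_mod s) h" using sdK by auto
    show "gker (free_mod s) h \<subseteq> shift_down r ` gker (free_mod (r + s)) F"
    proof
      fix y assume y: "y \<in> gker (free_mod s) h"
      then have "y \<in> free_mod s" "h y = 0" by (auto simp: gker_def)
      then have "g y \<in> gker B p" using g ghom_closed[OF g(1)] by (auto simp: gker_def)
      then obtain x where x: "x \<in> free_mod r" "i (f x) = g y" using ker f(3) by auto
      let ?u = "shift_up r y - x"
      have "?u \<in> free_mod (r + s)"
        using x y ghom_closed[OF ghom_shift_up, of y s r] free_mod_mono[of r "r + s"]
        by (intro fs.subspace_diff subspace_free_mod) (auto simp: gker_def)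
      moreover have sd: "shift_down r ?u = y"
        using x flinear_diff[OF ghom_flinear[OF ghom_shift_down], of r "shift_up r y" x]
        by (simp add: shift_down_free_mod)
      moreover have "F ?u = 0"
      proof -
        have "trunc r ?u = 0 - x"
          using x flinear_diff[OF ghom_flinear[OF ghom_trunc], of r "shift_up r y" x]
          by (simp add: trunc_free_mod)
        then have "f (trunc r ?u) = 0 - f x"
          using flinear_diff[OF ghom_flinear[OF f(2)], of 0 x] lin(2)[OF f(2)] by simp
        then have "i (f (trunc r ?u)) = 0 - i (f x)"
          using flinear_diff[OF ghom_flinear[OF i], of 0 "f x"] lin(2)[OF i] by simp
        then show ?thesis using sd x by (simp add: F_def)
      qed
      ultimately show "y \<in> shift_down r ` gker (free_mod (r + s)) F"
        by (metis (mono_tags, lifting) gker_def image_eqI mem_Collect_eq)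
    qed
  qed
  have K5: "gker (gker (free_mod (r + s)) F) (shift_down r) = (\<lambda>u. u) ` gker (free_mod r) f"
  proof -
    have "u \<in> gker (free_mod r) f" if u: "u \<in> free_mod (r + s)" "F u = 0" "shift_down r u = 0" for u
    proof -
      have tu: "trunc r u = u" using u shift_down_eq_0 by blast
      then have ur: "u \<in> free_mod r" using ghom_closed[OF ghom_trunc u(1)] by simp
      have "i (f u) = 0" using u tu lin[OF g(1)] by (simp add: F_def)
      then have "f u = 0"
        using inj ghom_closed[OF f(2) ur] lin[OF i] fs.subspace_0[OF gmod_subspace[OF gA]]
        by (metis inj_onD)
      then show ?thesis using ur by (simp add: gker_def)
    qed
    then show ?thesis using incl shift_down_free_mod by (auto simp: gker_def)
  qed
  have "free_res t (\<lambda>j. a (Suc j) + c (Suc j)) (gker (free_mod (r + s)) F)"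
  by (rule Suc.IH[OF K1 K2 _ K3 K4 K5 f(4) h(4)]) (auto intro: inj_onI)
  then show ?case using F F_surj add_mono[OF f(1) h(1)]
  unfolding free_res.simps by blast
qed simp

text \<open>
  In a short exact sequence \<open>0 \<rightarrow> A \<rightarrow> B \<rightarrow> C \<rightarrow> 0\<close> the first term of a resolution of \<open>B\<close> also covers \<open>C\<close>.
  The new kernel is an extension of \<open>A\<close> by the old one, to which the horseshoe lemma applies.
\<close>

lemma free_res_mapping_cone:
  assumes gA: "gmod A" and gB: "gmod B" and gC: "gmod C"
    and i: "ghom A B i" "inj_on i A" and p: "ghom B C p" "p ` B = C" and ker: "gker B p = i ` A"
    and a: "free_res t a A" and b: "free_res (Suc t) b B"
  shows "free_res (Suc t) (\<lambda>j. case j of 0 \<Rightarrow> b 0 | Suc k \<Rightarrow> b (Suc k) + a k) C"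
proof -
  from b obtain r f where f: "r \<le> b 0" "ghom (free_mod r) B f" "f ` free_mod r = B"
    "free_res t (\<lambda>j. b (Suc j)) (gker (free_mod r) f)" by auto
  define K where "K = gker (free_mod r) (\<lambda>u. p (f u))"
  have pf: "ghom (free_mod r) C (\<lambda>u. p (f u))" by (rule ghom_comp[OF f(2) p(1)])
  have gK: "gmod K" unfolding K_def by (rule gmod_gker[OF gmod_free_mod pf])
  have gI: "gmod (i ` A)" by (rule gmod_image[OF gA gB i(1)])
  \<comment> \<open>the kernel of the composite is an extension of \<open>A\<close> by the kernel of \<open>f\<close>\<close>
  have fK: "f ` K = i ` A"
  proof
    show "f ` K \<subseteq> i ` A" using ker f(3) by (auto simp: K_def gker_def)
    show "i ` A \<subseteq> f ` K"
    proof
      fix y assume "y \<in> i ` A"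
      then have "y \<in> B" "p y = 0" using ker by (auto simp: gker_def)
      then show "y \<in> f ` K" using f(3) by (auto simp: K_def gker_def)
    qed
  qed
  have iA: "free_res t a (i ` A)"
    using a
  proof (cases t)
    case (Suc t')
    with a obtain q h where h: "q \<le> a 0" "ghom (free_mod q) A h" "h ` free_mod q = A"
      "free_res t' (\<lambda>j. a (Suc j)) (gker (free_mod q) h)" by auto
    have ih: "ghom (free_mod q) (i ` A) (\<lambda>u. i (h u))"
      using ghom_comp[OF h(2) i(1)] h(3) by (auto intro: ghom_subset)
    have "gker (free_mod q) (\<lambda>u. i (h u)) = gker (free_mod q) h"
    proof -
      have "i (h u) = 0 \<longleftrightarrow> h u = 0" if "u \<in> free_mod q" for u
        using inj_onD[OF i(2), of "h u" 0] ghom_closed[OF h(2) that] fs.subspace_0[OF gmod_subspace[OF gA]]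
          flinear_0[OF ghom_flinear[OF i(1)]] by auto
      then show ?thesis by (auto simp: gker_def)
    qed
    then have "(\<lambda>u. i (h u)) ` free_mod q = i ` A \<and>
        free_res t' (\<lambda>j. a (Suc j)) (gker (free_mod q) (\<lambda>u. i (h u)))" using h by auto
    then show ?thesis using h(1) ih Suc by (simp, blast)
  qed simp
  have "free_res t (\<lambda>j. b (Suc j) + a j) K"
  proof (rule free_res_horseshoe[where A = "gker (free_mod r) f" and C = "i ` A" and i = "\<lambda>u. u" and p = f])
    show "gmod (gker (free_mod r) f)" by (rule gmod_gker[OF gmod_free_mod f(2)])
    have sub: "gker (free_mod r) f \<subseteq> K"
      using flinear_0[OF ghom_flinear[OF p(1)]] by (auto simp: K_def gker_def)
    then show "ghom (gker (free_mod r) f) K (\<lambda>u. u)" by (rule ghom_id)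
    show "ghom K (i ` A) f" by (rule ghom_subset[OF f(2)]) (use fK in \<open>auto simp: K_def gker_def\<close>)
    show "gker K f = (\<lambda>u. u) ` gker (free_mod r) f" using sub by (auto simp: K_def gker_def)
  qed (use gK gI fK f iA in auto)
  moreover have "(\<lambda>u. p (f u)) ` free_mod r = C" using f(3) p(2) by (simp add: image_image[symmetric])
  ultimately show ?thesis using f(1) pf by (auto simp: K_def)
qed

end


section \<open>Projective covers and minimal resolutions\<close>

context finite_group
begin

text \<open>
  Projective modules, as retracts of free modules of finite rank.
\<close>

definition gproj :: "(nat \<Rightarrow> 'g \<Rightarrow> 'f::field) set \<Rightarrow> bool" where
  "gproj P \<longleftrightarrow> gmod P \<and> (\<exists>r i q. ghom P (free_mod r) i \<and> ghom (free_mod r) P q \<and> (\<forall>u\<in>P. q (i u) = u))"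

lemma gprojI:
  "gmod P \<Longrightarrow> ghom P (free_mod r) i \<Longrightarrow> ghom (free_mod r) P q \<Longrightarrow> (\<And>u. u \<in> P \<Longrightarrow> q (i u) = u) \<Longrightarrow> gproj P"
  unfolding gproj_def by blast

lemma gproj_free_mod: "gproj (free_mod r)"
  by (rule gprojI[OF gmod_free_mod ghom_id ghom_id]) auto

lemma gproj_gmod: "gproj P \<Longrightarrow> gmod P"
  by (simp add: gproj_def)

lemma gproj_lift:
  assumes P: "gproj P" and B: "gmod B" and p: "ghom B C p" "C \<subseteq> p ` B" and h: "ghom P C h"
  obtains g where "ghom P B g" "\<And>u. u \<in> P \<Longrightarrow> p (g u) = h u"
proof -
  from P obtain r i q where i: "ghom P (free_mod r) i" "ghom (free_mod r) P q" "\<forall>u\<in>P. q (i u) = u"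
    by (auto simp: gproj_def)
  obtain g where g: "ghom (free_mod r) B g" "\<And>u. u \<in> free_mod r \<Longrightarrow> p (g u) = h (q u)"
    using free_lift[OF B p ghom_comp[OF i(2) h]] by blast
  show ?thesis
  proof
    show "ghom P B (\<lambda>u. g (i u))" by (rule ghom_comp[OF i(1) g(1)])
    show "p (g (i u)) = h u" if "u \<in> P" for u
      using g(2)[OF ghom_closed[OF i(1) that]] i(3) that by simp
  qed
qed

text \<open>
  By dimension, an injective endomorphism is an automorphism. The inverse is a linear map of the
  ambient space, as \<open>ghom\<close> demands.
\<close>

lemma ghom_endo_inverse:
  assumes V: "gmod V" and f: "ghom V V f" and inj: "inj_on f V"
  obtains g where "ghom V V g" "\<And>u. u \<in> V \<Longrightarrow> g (f u) = u"
proof -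
  have surj: "f ` V = V"
    using flinear_endo_inj_imp_surj[OF gmod_fin_dim[OF V] ghom_flinear[OF f] _ inj] f by (auto simp: ghom_def)
  obtain g where g: "g ` UNIV \<subseteq> V" "flinear g" "\<forall>v\<in>V. g (f v) = v"
    using fsp.linear_exists_left_inverse_on[OF ghom_flinear[OF f] gmod_subspace[OF V] inj] by blast
  have "g (act x u) = act x (g u)" if x: "x \<in> carrier G" "u \<in> V" for x u
  proof -
    obtain v where v: "v \<in> V" "u = f v" using surj x by blast
    have "g (act x u) = g (f (act x v))" using v x ghom_act[OF f] by simp
    also have "\<dots> = act x (g u)" using g v gmod_act[OF V x(1) v(1)] by simp
    finally show ?thesis .
  qed
  then have "ghom V V g" using g by (auto simp: ghom_def)
  then show ?thesis using that g by blast
qed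

text \<open>
  A projective cover: no proper submodule of \<open>P\<close> maps onto \<open>M\<close>. This is another form of the
  condition that the kernel be superfluous.
\<close>

definition gcover :: "(nat \<Rightarrow> 'g \<Rightarrow> 'f::field) set \<Rightarrow> (nat \<Rightarrow> 'g \<Rightarrow> 'f) set \<Rightarrow>
    ((nat \<Rightarrow> 'g \<Rightarrow> 'f) \<Rightarrow> (nat \<Rightarrow> 'g \<Rightarrow> 'f)) \<Rightarrow> bool" where
  "gcover P M f \<longleftrightarrow> gproj P \<and> ghom P M f \<and> f ` P = M \<and> (\<forall>N. gmod N \<and> N \<subseteq> P \<and> f ` N = M \<longrightarrow> N = P)"

lemma ghom_funpow: "ghom V V h \<Longrightarrow> ghom V V (h ^^ s)"
proof (induction s)
  case 0
  show ?case using ghom_id[of V V] by (simp add: id_def)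
next
  case (Suc s)
  show ?case using ghom_comp[OF Suc.IH Suc.prems] Suc.prems by (simp add: comp_def)
qed

text \<open>
  A projective module \<open>P\<close> of least dimension among those that map onto \<open>M\<close> is a cover. If a submodule
  \<open>N\<close> already maps onto \<open>M\<close>, then the map from \<open>P\<close> lifts to an endomorphism \<open>h\<close> of \<open>P\<close> with image in \<open>N\<close>.
  By Fitting's lemma the stable image of the powers of \<open>h\<close> is a direct summand of \<open>P\<close>; it still maps
  onto \<open>M\<close>, so it is all of \<open>P\<close>, and \<open>N = P\<close>.
\<close>

lemma gcover_exists:
  assumes M: "gmod M"
  obtains P f where "gcover P M f"
proof -
  define Q where "Q = (\<lambda>d. \<exists>P f. gproj P \<and> ghom P M f \<and> f ` P = M \<and> fs.dim P = d)"
  have "\<exists>d. Q d"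
    using gmod_free_cover[OF M] gproj_free_mod unfolding Q_def by metis
  then have "Q (LEAST d. Q d)" by (rule LeastI_ex)
  then obtain P f where P: "gproj P" "ghom P M f" "f ` P = M" and d: "fs.dim P = (LEAST d. Q d)"
    unfolding Q_def by blast
  have least: "fs.dim P \<le> fs.dim P'" if "gproj P'" "ghom P' M f'" "f' ` P' = M" for P' f'
    unfolding d by (rule Least_le) (use that in \<open>auto simp: Q_def\<close>)
  have gP: "gmod P" using P gproj_gmod by blast
  have min_P: "N = P" if N: "gmod N" "N \<subseteq> P" "f ` N = M" for N
  proof -
    have fN: "ghom N M f" using ghom_subset[OF P(2)] N by auto
    obtain h where h: "ghom P N h" "\<And>u. u \<in> P \<Longrightarrow> f (h u) = f u"
      using gproj_lift[OF P(1) N(1) fN _ P(2)] N by blast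
    have hP: "ghom P P h" using h(1) N(2) unfolding ghom_def by blast
    \<comment> \<open>The images of the powers of \<open>h\<close> stabilise, and \<open>h\<close> is bijective on the stable image.\<close>
    define s where "s = (ARG_MIN (\<lambda>s. fs.dim ((h ^^ s) ` P)) s. True)"
    define I where "I = (h ^^ s) ` P"
    have min: "fs.dim I \<le> fs.dim ((h ^^ t) ` P)" for t
      unfolding I_def s_def by (rule arg_min_nat_le) simp
    have gI: "gmod I" unfolding I_def by (rule gmod_image[OF gP gP ghom_funpow[OF hP]])
    have IP: "I \<subseteq> P" unfolding I_def using ghom_funpow[OF hP] by (auto simp: ghom_def)
    have hI: "h ` I \<subseteq> I"
    proof -
      have "h ((h ^^ s) u) = (h ^^ s) (h u)" for u by (metis funpow_swap1)
      then show ?thesis using ghom_closed[OF hP] unfolding I_def by auto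
    qed
    have "h ` I = (h ^^ Suc s) ` P" by (auto simp: I_def)
    then have dI: "fs.dim I \<le> fs.dim (h ` I)" using min[of "Suc s"] by simp
    have hI_eq: "h ` I = I"
      by (rule fs_subspace_eqI[OF gmod_fin_dim[OF gI] _ hI dI])
         (rule fsp.linear_subspace_image[OF ghom_flinear[OF hP] gmod_subspace[OF gI]])
    have pw: "(h ^^ t) ` I = I" for t
    proof (induction t)
      case (Suc t)
      have "(h ^^ Suc t) ` I = h ` (h ^^ t) ` I" by auto
      then show ?case using Suc hI_eq by simp
    qed simp
    have "inj_on h I" by (rule flinear_surj_imp_inj[OF gmod_fin_dim[OF gI] ghom_flinear[OF hP] dI])
    then have inj: "inj_on (h ^^ t) I" for t
    proof (induction t)
      case (Suc t)
      then show ?case using comp_inj_on[of "h ^^ t" I h] Suc pw by (simp add: comp_def)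
    qed simp
    have hs: "ghom I I (h ^^ s)"
      using ghom_subset[OF ghom_funpow[OF hP] IP] pw by blast
    obtain k where k: "ghom I I k" "\<And>u. u \<in> I \<Longrightarrow> k ((h ^^ s) u) = u"
      using ghom_endo_inverse[OF gI hs inj] by blast
    from P(1) obtain r i q where i: "ghom P (free_mod r) i" "ghom (free_mod r) P q" "\<forall>u\<in>P. q (i u) = u"
      by (auto simp: gproj_def)
    have q: "ghom (free_mod r) I (\<lambda>u. k ((h ^^ s) (q u)))"
      by (rule ghom_comp[OF ghom_comp[OF i(2)] k(1)])
         (rule ghom_subset[OF ghom_funpow[OF hP]], auto simp: I_def)
    have "ghom I (free_mod r) i" using ghom_subset[OF i(1) IP] ghom_closed[OF i(1)] IP by blast
    then have "gproj I"
      by (rule gprojI[OF gI _ q]) (use i(3) k(2) IP in auto)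
    moreover have "f ` I = M"
    proof -
      have "f ((h ^^ t) u) = f u" if "u \<in> P" for u t
        using that by (induction t) (auto simp: h(2) ghom_closed[OF ghom_funpow[OF hP]])
      then have "f ` I = f ` P" unfolding I_def by (auto simp: image_image)
      then show ?thesis using P by simp
    qed
    moreover have "ghom I M f" using ghom_subset[OF P(2) IP] calculation by auto
    ultimately have "fs.dim P \<le> fs.dim I" using least by blast
    then have "I = P" by (rule fs_subspace_eqI[OF gmod_fin_dim[OF gP] gmod_subspace[OF gI] IP])
    then have "P = h ` P" using hI_eq by simp
    also have "\<dots> \<subseteq> N" using h(1) by (simp add: ghom_def)
    finally show "N = P" using N by blast
  qed
  show ?thesis
    by (rule that[of P f]) (simp add: gcover_def P, metis min_P)
qed

text \<open>
  One step of the comparison. Let \<open>M\<close> be a retract of \<open>X\<close> up to an automorphism, and let \<open>Q\<close> be the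
  first term of a free resolution of \<open>X\<close>. The maps between \<open>M\<close> and \<open>X\<close> lift to maps \<open>P \<rightarrow> Q \<rightarrow> P\<close>; their
  composite still maps \<open>P\<close> onto \<open>M\<close>, so it is an automorphism because \<open>P\<close> is a cover. Hence \<open>P\<close>
  embeds in \<open>Q\<close>, and the kernels again form a retract up to an automorphism. Asking only that
  \<open>r \<circ> i\<close> be injective, instead of the identity, makes the hypothesis reproduce itself.
\<close>

lemma gcover_retract:
  assumes M: "gmod M" and X: "gmod X" and cov: "gcover P M f"
    and i: "ghom M X i" and r: "ghom X M r" and inj: "inj_on (\<lambda>u. r (i u)) M"
    and res: "free_res (Suc t) a X"
  shows "fs.dim P \<le> a 0 * card (carrier G)"
    and "\<exists>X' i' r'. gmod X' \<and> ghom (gker P f) X' i' \<and> ghom X' (gker P f) r' \<and>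
           inj_on (\<lambda>u. r' (i' u)) (gker P f) \<and> free_res t (\<lambda>j. a (Suc j)) X'"
proof -
  have P: "gproj P" "ghom P M f" "f ` P = M" and min: "\<And>N. gmod N \<Longrightarrow> N \<subseteq> P \<Longrightarrow> f ` N = M \<Longrightarrow> N = P"
    using cov by (auto simp: gcover_def)
  have gP: "gmod P" using P gproj_gmod by blast
  from res obtain q h where h: "q \<le> a 0" "ghom (free_mod q) X h" "h ` free_mod q = X"
    "free_res t (\<lambda>j. a (Suc j)) (gker (free_mod q) h)" by auto
  obtain i' where i': "ghom P (free_mod q) i'" "\<And>u. u \<in> P \<Longrightarrow> h (i' u) = i (f u)"
    using gproj_lift[OF P(1) gmod_free_mod h(2) _ ghom_comp[OF P(2) i]] h(3) by blast
  obtain r' where r': "ghom (free_mod q) P r'" "\<And>u. u \<in> free_mod q \<Longrightarrow> f (r' u) = r (h u)"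
    using free_lift[OF gP P(2) _ ghom_comp[OF h(2) r]] P(3) by blast
  let ?e = "\<lambda>u. r' (i' u)"
  have e: "ghom P P ?e" by (rule ghom_comp[OF i'(1) r'(1)])
  have fe: "f (?e u) = r (i (f u))" if "u \<in> P" for u
    using r'(2) i'(2) ghom_closed[OF i'(1)] that by simp
  have ri: "(\<lambda>u. r (i u)) ` M = M"
    using flinear_endo_inj_imp_surj[OF gmod_fin_dim[OF M] ghom_flinear[OF ghom_comp[OF i r]] _ inj]
      ghom_comp[OF i r] by (auto simp: ghom_def)
  have "f ` ?e ` P = (\<lambda>u. r (i u)) ` f ` P" using fe by (auto simp: image_image)
  also have "\<dots> = M" using ri P by simp
  finally have "?e ` P = P"
    using min gmod_image[OF gP gP e] ghom_closed[OF e] by blast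
  then have inj_e: "inj_on ?e P"
    using flinear_surj_imp_inj[OF gmod_fin_dim[OF gP] ghom_flinear[OF e]] by simp
  then have inj_i': "inj_on i' P" using inj_on_imageI2[of r' i' P] by (simp add: comp_def)
  have "fs.dim P = fs.dim (i' ` P)"
    using flinear_dim_image_inj[OF gmod_fin_dim[OF gP] ghom_flinear[OF i'(1)] inj_i'] by simp
  also have "\<dots> \<le> fs.dim (free_mod q :: (nat \<Rightarrow> 'g \<Rightarrow> 'a) set)"
    using i'(1) by (intro fs_dim_mono fin_dim_free_mod) (auto simp: ghom_def)
  also have "\<dots> \<le> q * card (carrier G)" by (rule fin_dim_free_mod)
  also have "\<dots> \<le> a 0 * card (carrier G)" using h by simp
  finally show "fs.dim P \<le> a 0 * card (carrier G)" .
  have "ghom (gker P f) (gker (free_mod q) h) i'"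
    by (rule ghom_subset[OF i'(1) gker_subset])
       (use i' ghom_closed[OF i'(1)] flinear_0[OF ghom_flinear[OF i]] in \<open>auto simp: gker_def\<close>)
  moreover have "ghom (gker (free_mod q) h) (gker P f) r'"
    by (rule ghom_subset[OF r'(1) gker_subset])
       (use r' ghom_closed[OF r'(1)] flinear_0[OF ghom_flinear[OF r]] in \<open>auto simp: gker_def\<close>)
  moreover have "inj_on ?e (gker P f)" by (rule inj_on_subset[OF inj_e gker_subset])
  ultimately show "\<exists>X' i' r'. gmod X' \<and> ghom (gker P f) X' i' \<and> ghom X' (gker P f) r' \<and>
           inj_on (\<lambda>u. r' (i' u)) (gker P f) \<and> free_res t (\<lambda>j. a (Suc j)) X'"
    using h(4) gmod_gker[OF gmod_free_mod h(2)] by blast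
qed

definition min_res :: "(nat \<Rightarrow> 'g \<Rightarrow> 'f::field) set \<Rightarrow> (nat \<Rightarrow> (nat \<Rightarrow> 'g \<Rightarrow> 'f) set) \<Rightarrow>
    (nat \<Rightarrow> (nat \<Rightarrow> 'g \<Rightarrow> 'f) \<Rightarrow> (nat \<Rightarrow> 'g \<Rightarrow> 'f)) \<Rightarrow> bool" where
  "min_res M P f \<longleftrightarrow> gcover (P 0) M (f 0) \<and> (\<forall>j. gcover (P (Suc j)) (gker (P j) (f j)) (f (Suc j)))"

lemma gcover_gmod: "gcover P M f \<Longrightarrow> gmod P"
  by (simp add: gcover_def gproj_gmod)

lemma gmod_gker_gcover: "gcover P M f \<Longrightarrow> gmod (gker P f)"
  by (rule gmod_gker[of P M f]) (simp_all add: gcover_def gproj_gmod)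

lemma min_res_exists:
  assumes M: "gmod M"
  obtains P f where "min_res M P f"
proof -
    obtain P0 f0 where 0: "gcover P0 M f0" using gcover_exists[OF M] .
    have "\<exists>s. \<forall>j::nat. (gmod (gker (fst (s j)) (snd (s j))) \<and> (j = 0 \<longrightarrow> s j = (P0, f0))) \<and>
       gcover (fst (s (Suc j))) (gker (fst (s j)) (snd (s j))) (snd (s (Suc j)))"
    proof (rule dependent_nat_choice)
      show "\<exists>x. gmod (gker (fst x) (snd x)) \<and> (0 = (0::nat) \<longrightarrow> x = (P0, f0))"
        using gmod_gker_gcover[OF 0] by auto
    next
      fix x and n :: nat
      assume "gmod (gker (fst x) (snd x)) \<and> (n = 0 \<longrightarrow> x = (P0, f0))"
      then obtain P f where "gcover P (gker (fst x) (snd x)) f" using gcover_exists by blast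
      then show "\<exists>y. (gmod (gker (fst y) (snd y)) \<and> (Suc n = 0 \<longrightarrow> y = (P0, f0))) \<and>
          gcover (fst y) (gker (fst x) (snd x)) (snd y)"
        using gmod_gker_gcover by (intro exI[of _ "(P, f)"]) auto
    qed
    then obtain s :: "nat \<Rightarrow> _" where s: "s 0 = (P0, f0)"
      "\<And>j. gcover (fst (s (Suc j))) (gker (fst (s j)) (snd (s j))) (snd (s (Suc j)))" by blast
    have "min_res M (\<lambda>j. fst (s j)) (\<lambda>j. snd (s j))"
      using 0 s by (simp add: min_res_def)
    then show ?thesis by (rule that)
qed

lemma min_res_dim_le_of_retract:
  assumes "gmod M" "gmod X" "min_res M P f" "ghom M X i" "ghom X M r" "inj_on (\<lambda>u. r (i u)) M"
    and "free_res (Suc j) a X"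
  shows "fs.dim (P j) \<le> a j * card (carrier G)"
  using assms
proof (induction j arbitrary: M X P f i r a)
  case 0
  then show ?case using gcover_retract(1)[of M X "P 0" "f 0"] unfolding min_res_def by blast
next
  case (Suc j)
  have c: "gcover (P 0) M (f 0)" and c': "gcover (P (Suc k)) (gker (P k) (f k)) (f (Suc k))" for k
    using Suc.prems by (auto simp: min_res_def)
  obtain X' i' r' where X': "gmod X'" "ghom (gker (P 0) (f 0)) X' i'" "ghom X' (gker (P 0) (f 0)) r'"
    "inj_on (\<lambda>u. r' (i' u)) (gker (P 0) (f 0))" "free_res (Suc j) (\<lambda>j. a (Suc j)) X'"
    using gcover_retract(2)[OF Suc.prems(1,2) c Suc.prems(4,5,6,7)] by blast
  have "min_res (gker (P 0) (f 0)) (\<lambda>k. P (Suc k)) (\<lambda>k. f (Suc k))"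
    using c' by (auto simp: min_res_def)
  from Suc.IH[OF gmod_gker_gcover[OF c] X'(1) this X'(2-5)] show ?case .
qed

end


section \<open>Coinduced modules\<close>

context finite_group
begin

definition translate :: "'g \<Rightarrow> ('g \<Rightarrow> 'f::field) \<Rightarrow> ('g \<Rightarrow> 'f)" where
  "translate g m = (\<lambda>x. if x \<in> carrier G then m (inv g \<otimes> x) else 0)"

text \<open>
  As \<open>translate g m\<close> is the product \<open>g m\<close> in the group algebra, a left ideal is a set of elements of
  \<open>A\<close> that is closed under linear combinations and translations.
\<close>

definition left_ideal :: "('g \<Rightarrow> 'f::field) set \<Rightarrow> bool" where
  "left_ideal M \<longleftrightarrow> (\<forall>m\<in>M. \<forall>x. x \<notin> carrier G \<longrightarrow> m x = 0) \<and> 0 \<in> M \<and> (\<forall>m\<in>M. \<forall>m'\<in>M. m + m' \<in> M) \<and>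
     (\<forall>c. \<forall>m\<in>M. (\<lambda>x. c * m x) \<in> M) \<and> (\<forall>g\<in>carrier G. \<forall>m\<in>M. translate g m \<in> M)"

lemma translate_translate: "g \<in> carrier G \<Longrightarrow> h \<in> carrier G \<Longrightarrow> translate g (translate h m) = translate (g \<otimes> h) m"
  by (auto simp: translate_def fun_eq_iff inv_mult_group m_assoc)

lemma translate_one: "(\<And>x. x \<notin> carrier G \<Longrightarrow> m x = 0) \<Longrightarrow> translate \<one> m = m"
  by (auto simp: translate_def fun_eq_iff)

lemma translate_0 [simp]: "translate g 0 = 0"
  by (simp add: translate_def zero_fun_def)

lemma translate_add: "translate g (m + m') = translate g m + translate g m'"
  by (auto simp: translate_def pointwise)

lemma translate_scale: "translate g (\<lambda>y. c * m y) = (\<lambda>y. c * translate g m y)"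
  by (auto simp: translate_def fun_eq_iff)

lemma left_ideal_supp: "left_ideal M \<Longrightarrow> m \<in> M \<Longrightarrow> x \<notin> carrier G \<Longrightarrow> m x = 0"
  and left_ideal_0: "left_ideal M \<Longrightarrow> 0 \<in> M"
  and left_ideal_add: "left_ideal M \<Longrightarrow> m \<in> M \<Longrightarrow> m' \<in> M \<Longrightarrow> m + m' \<in> M"
  and left_ideal_scale: "left_ideal M \<Longrightarrow> m \<in> M \<Longrightarrow> (\<lambda>x. c * m x) \<in> M"
  and left_ideal_translate: "left_ideal M \<Longrightarrow> g \<in> carrier G \<Longrightarrow> m \<in> M \<Longrightarrow> translate g m \<in> M"
  unfolding left_ideal_def by blast+

lemma left_ideal_sum: "left_ideal M \<Longrightarrow> (\<And>a. a \<in> A \<Longrightarrow> f a \<in> M) \<Longrightarrow> sum f A \<in> M"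
  by (induction A rule: infinite_finite_induct) (auto simp: left_ideal_0 left_ideal_add)

text \<open>
  A function \<open>\<psi> : G \<rightarrow> A\<close> is encoded as an element \<open>u\<close> of \<open>A^N\<close>, where \<open>N\<close> is the order of \<open>G\<close>: the
  coefficient of \<open>y\<close> in \<open>\<psi> x\<close> is the coefficient of \<open>x\<close> in the coordinate of \<open>u\<close> numbered by \<open>y\<close>. In
  this way the action of \<open>G\<close> on \<open>A^N\<close> becomes \<open>(g \<psi>) x = \<psi> (g\<inverse> x)\<close>.
\<close>

definition enum_elt :: "nat \<Rightarrow> 'g" where
  "enum_elt = (SOME e. bij_betw e {..<card (carrier G)} (carrier G))"

definition enum_index :: "'g \<Rightarrow> nat" where
  "enum_index = inv_into {..<card (carrier G)} enum_elt"

lemma bij_enum_elt: "bij_betw enum_elt {..<card (carrier G)} (carrier G)"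
  using someI_ex[OF ex_bij_betw_nat_finite[OF finite_carrier]] by (simp add: enum_elt_def atLeast0LessThan)

lemma enum_elt_index: "x \<in> carrier G \<Longrightarrow> enum_elt (enum_index x) = x"
  and enum_index_less: "x \<in> carrier G \<Longrightarrow> enum_index x < card (carrier G)"
  and enum_index_elt: "i < card (carrier G) \<Longrightarrow> enum_index (enum_elt i) = i"
  and enum_elt_closed: "i < card (carrier G) \<Longrightarrow> enum_elt i \<in> carrier G"
proof -
  show "enum_elt (enum_index x) = x" if "x \<in> carrier G"
    unfolding enum_index_def using that bij_enum_elt by (simp add: bij_betw_inv_into_right)
  show "enum_index x < card (carrier G)" if "x \<in> carrier G"
    unfolding enum_index_def using that bij_betwE[OF bij_betw_inv_into[OF bij_enum_elt]] by auto
  show "enum_index (enum_elt i) = i" if "i < card (carrier G)"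
    unfolding enum_index_def using that bij_enum_elt by (simp add: bij_betw_inv_into_left)
  show "enum_elt i \<in> carrier G" if "i < card (carrier G)"
    using that bij_betwE[OF bij_enum_elt] by auto
qed

definition val :: "(nat \<Rightarrow> 'g \<Rightarrow> 'f::field) \<Rightarrow> 'g \<Rightarrow> ('g \<Rightarrow> 'f)" where
  "val u x = (\<lambda>y. if y \<in> carrier G then u (enum_index y) x else 0)"

definition of_val :: "('g \<Rightarrow> 'g \<Rightarrow> 'f::field) \<Rightarrow> (nat \<Rightarrow> 'g \<Rightarrow> 'f)" where
  "of_val \<psi> = (\<lambda>i x. if i < card (carrier G) \<and> x \<in> carrier G then \<psi> x (enum_elt i) else 0)"

abbreviation gfun :: "(nat \<Rightarrow> 'g \<Rightarrow> 'f::field) set" where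
  "gfun \<equiv> free_mod (card (carrier G))"

lemma of_val_in: "of_val \<psi> \<in> gfun"
  by (auto simp: of_val_def free_mod_def)

lemma val_supp: "y \<notin> carrier G \<Longrightarrow> val u x y = 0"
  by (simp add: val_def)

lemma val_of_val: "x \<in> carrier G \<Longrightarrow> (\<And>y. y \<notin> carrier G \<Longrightarrow> \<psi> x y = 0) \<Longrightarrow> val (of_val \<psi>) x = \<psi> x"
  by (auto simp: val_def of_val_def fun_eq_iff enum_elt_index enum_index_less)

lemma gfun_eqI:
  assumes "u \<in> gfun" "v \<in> gfun" "\<And>x. x \<in> carrier G \<Longrightarrow> val u x = val v x"
  shows "u = v"
proof (intro ext)
  fix i x
  show "u i x = v i x"
  proof (cases "i < card (carrier G) \<and> x \<in> carrier G")
    case True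
    then show ?thesis using fun_cong[OF assms(3), of x "enum_elt i"] by (simp add: val_def enum_elt_closed enum_index_elt)
  next
    case False
    then show ?thesis using free_modD[OF assms(1) False] free_modD[OF assms(2) False] by simp
  qed
qed

lemma val_add: "val (u + v) x = val u x + val v x"
  by (auto simp: val_def pointwise fun_eq_iff)

lemma val_scale: "val (fscale c u) x = (\<lambda>y. c * val u x y)"
  by (auto simp: val_def pointwise fun_eq_iff)

lemma val_0 [simp]: "val 0 x = 0"
  by (auto simp: val_def pointwise fun_eq_iff)

lemma val_sum: "val (sum f A) x = (\<Sum>a\<in>A. val (f a) x)"
  by (induction A rule: infinite_finite_induct) (auto simp: val_add)

lemma val_act: "x \<in> carrier G \<Longrightarrow> val (act g u) x = val u (inv g \<otimes> x)"
  by (auto simp: val_def act_def)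

text \<open>
  The module coinduced from the restriction of \<open>M\<close> to \<open>H\<close>, equivalently \<open>F[G/H] \<otimes> M\<close> with
  the diagonal action of \<open>G\<close>.
\<close>

definition coind :: "('g \<Rightarrow> 'f::field) set \<Rightarrow> 'g set \<Rightarrow> (nat \<Rightarrow> 'g \<Rightarrow> 'f) set" where
  "coind M H = {u \<in> gfun. \<forall>x\<in>carrier G. val u x \<in> M \<and> (\<forall>h\<in>H. val u (x \<otimes> h) = translate (inv h) (val u x))}"

lemma gmod_coind:
  fixes M :: "('g \<Rightarrow> 'f::field) set"
  assumes M: "left_ideal M" and H: "H \<subseteq> carrier G"
  shows "gmod (coind M H)"
proof (rule gmod_subset[OF gmod_free_mod])
  show "fs.subspace (coind M H)"
    using gmod_subspace[OF gmod_free_mod, of "card (carrier G)"]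
    by (auto simp: fs.subspace_def coind_def val_add val_scale translate_add translate_scale left_ideal_0[OF M]
        left_ideal_add[OF M] left_ideal_scale[OF M])
  show "act g u \<in> coind M H" if "g \<in> carrier G" "u \<in> coind M H" for g u
    using that gmod_act[OF gmod_free_mod that(1), of u "card (carrier G)"] H
    by (auto simp: coind_def val_act m_assoc[symmetric] subset_eq)
qed (auto simp: coind_def)

subsection \<open>Extending the subgroup by a cyclic quotient\<close>

text \<open>
  Exactness of the periodic sequence with maps \<open>\<tau> - 1\<close> and \<open>N = 1 + \<tau> + \<dots> + \<tau>^(p-1)\<close> for an
  operator with \<open>\<tau>^p = 1\<close>. The conjugates of \<open>\<epsilon>\<close> by the powers of \<open>\<tau>\<close>
  add up to the identity; in the application \<open>\<epsilon>\<close> projects onto a summand from which \<open>V\<close>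
  is induced. It provides the
  preimages: \<open>v = N (\<epsilon> v)\<close> if \<open>\<tau> v = v\<close>, and if \<open>N v = 0\<close>, then the vectors
  \<open>w i = \<epsilon> (\<tau>^(p-i) v)\<close> add up to zero, so that \<open>v = \<Sum> (\<tau>^i - 1) (w i)\<close> is divisible by \<open>\<tau> - 1\<close>.
\<close>

lemma cyclic_exact:
  fixes V :: "(nat \<Rightarrow> 'g \<Rightarrow> 'f::field) set" and \<tau> \<epsilon> :: "(nat \<Rightarrow> 'g \<Rightarrow> 'f) \<Rightarrow> (nat \<Rightarrow> 'g \<Rightarrow> 'f)"
  assumes V: "fs.subspace V" and t: "flinear \<tau>" "\<tau> ` V \<subseteq> V" and e: "flinear \<epsilon>" "\<epsilon> ` V \<subseteq> V"
    and per: "\<And>v. v \<in> V \<Longrightarrow> (\<tau> ^^ p) v = v"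
    and id: "\<And>v. v \<in> V \<Longrightarrow> (\<Sum>i<p. (\<tau> ^^ i) (\<epsilon> ((\<tau> ^^ (p - i)) v))) = v"
  defines "N \<equiv> (\<lambda>v. \<Sum>i<p. (\<tau> ^^ i) v)"
  shows "N ` V = {v \<in> V. \<tau> v = v}"
    and "{v \<in> V. N v = 0} = (\<lambda>v. \<tau> v - v) ` V"
proof -
  have lin: "flinear (\<tau> ^^ i)" for i
  proof (induction i)
    case 0 show ?case using fs.linear_id by (simp add: id_def)
  next
    case (Suc i) then show ?case using flinear_comp[OF t(1) Suc] by (simp add: comp_def)
  qed
  have cl: "(\<tau> ^^ i) v \<in> V" if "v \<in> V" for i v
    using that t(2) by (induction i) auto
  have shift: "(\<Sum>i<p. (\<tau> ^^ Suc i) v) = N v" if "v \<in> V" for v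
  proof -
    have "(\<Sum>i<p. (\<tau> ^^ Suc i) v) + v = (\<Sum>i<Suc p. (\<tau> ^^ i) v)"
      using sum.lessThan_Suc_shift[of "\<lambda>i. (\<tau> ^^ i) v" p]
      by (simp add: add.commute del: sum.lessThan_Suc)
    also have "\<dots> = N v + v" using per[OF that] by (simp add: N_def)
    finally show ?thesis by simp
  qed
  have tN: "\<tau> (N v) = N v" if "v \<in> V" for v
    using shift[OF that] by (simp add: N_def flinear_sum[OF t(1)])
  have NV: "N v \<in> V" if "v \<in> V" for v
    unfolding N_def using cl[OF that] by (intro fs.subspace_sum[OF V]) auto
  show "N ` V = {v \<in> V. \<tau> v = v}"
  proof
    show "N ` V \<subseteq> {v \<in> V. \<tau> v = v}" using tN NV by auto
    show "{v \<in> V. \<tau> v = v} \<subseteq> N ` V"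
    proof
      fix v assume "v \<in> {v \<in> V. \<tau> v = v}"
      then have v: "v \<in> V" "\<tau> v = v" by auto
      have "(\<tau> ^^ i) v = v" for i using v by (induction i) auto
      then have "v = N (\<epsilon> v)" using id[OF v(1)] by (simp add: N_def)
      then show "v \<in> N ` V" using e(2) v(1) by blast
    qed
  qed
  have linN: "N (u - v) = N u - N v" for u v
    by (simp add: N_def flinear_diff[OF lin] sum_subtractf)
  have geom: "(\<tau> ^^ i) w - w = \<tau> (\<Sum>k<i. (\<tau> ^^ k) w) - (\<Sum>k<i. (\<tau> ^^ k) w)" for i w
    using sum_lessThan_telescope[of "\<lambda>k. (\<tau> ^^ k) w" i]
    by (simp add: flinear_sum[OF t(1)] sum_subtractf)
  show "{v \<in> V. N v = 0} = (\<lambda>v. \<tau> v - v) ` V"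
  proof
    have "N (\<tau> v) = N v" if "v \<in> V" for v
      using shift[OF that] by (simp add: N_def funpow_swap1)
    then show "(\<lambda>v. \<tau> v - v) ` V \<subseteq> {v \<in> V. N v = 0}"
      using t(2) linN fs.subspace_diff[OF V] by auto
    show "{v \<in> V. N v = 0} \<subseteq> (\<lambda>v. \<tau> v - v) ` V"
    proof
      fix v assume "v \<in> {v \<in> V. N v = 0}"
      then have v: "v \<in> V" "N v = 0" by auto
      define w where "w = (\<lambda>i. \<epsilon> ((\<tau> ^^ (p - i)) v))"
      \<comment> \<open>\<open>\<tau>^i - 1 = (\<tau> - 1) (1 + \<dots> + \<tau>^(i-1))\<close>\<close>
      define W where "W = (\<Sum>i<p. \<Sum>k<i. (\<tau> ^^ k) (w i))"
      have "(\<Sum>i<p. (\<tau> ^^ (p - i)) v) = (\<Sum>i<p. (\<tau> ^^ Suc i) v)"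
        by (rule sum.reindex_bij_witness[where i = "\<lambda>i. p - Suc i" and j = "\<lambda>i. p - Suc i"])
           (auto simp: Suc_diff_Suc)
      then have sum0: "(\<Sum>i<p. w i) = 0"
        unfolding w_def flinear_sum[OF e(1), symmetric]
        using shift[OF v(1)] v(2) flinear_0[OF e(1)] by simp
      have "v = (\<Sum>i<p. (\<tau> ^^ i) (w i)) - (\<Sum>i<p. w i)" using id[OF v(1)] sum0 by (simp add: w_def)
      also have "\<dots> = \<tau> W - W"
        by (simp add: sum_subtractf[symmetric] geom W_def flinear_sum[OF t(1)])
      finally have "v = \<tau> W - W" .
      moreover have "W \<in> V" unfolding W_def w_def
        using cl[OF v(1)] e(2) by (intro fs.subspace_sum[OF V] cl) (auto simp: image_subset_iff)
      ultimately show "v \<in> (\<lambda>v. \<tau> v - v) ` V" by blast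
    qed
  qed
qed

text \<open>
  For \<open>g\<close> in the normaliser of \<open>H\<close>, the automorphism of \<open>coind M H\<close> given by
  \<open>(\<tau> \<psi>) x = g (\<psi> (x g))\<close>. Its fixed points are the functions that are equivariant under \<open>g\<close> too.
\<close>

definition twist :: "'g \<Rightarrow> (nat \<Rightarrow> 'g \<Rightarrow> 'f::field) \<Rightarrow> (nat \<Rightarrow> 'g \<Rightarrow> 'f)" where
  "twist g u = of_val (\<lambda>x. translate g (val u (x \<otimes> g)))"

lemma val_twist: "x \<in> carrier G \<Longrightarrow> val (twist g u) x = translate g (val u (x \<otimes> g))"
  unfolding twist_def by (subst val_of_val) (auto simp: translate_def)

lemma twist_in: "twist g u \<in> gfun"
  by (simp add: twist_def of_val_in)

lemma flinear_twist: "flinear (twist g)"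
  by (rule flinearI)
     (auto intro!: gfun_eqI twist_in fs.subspace_add[OF subspace_free_mod] fs.subspace_scale[OF subspace_free_mod]
       simp: val_twist val_add val_scale translate_add translate_scale)

lemma val_twist_pow:
  assumes "g \<in> carrier G" "u \<in> gfun" "x \<in> carrier G"
  shows "val ((twist g ^^ i) u) x = translate (g [^] i) (val u (x \<otimes> g [^] i))"
  using assms(3)
proof (induction i arbitrary: x)
  case 0
  then show ?case by (simp add: translate_one val_supp)
next
  case (Suc i)
  have c: "g \<otimes> g [^] i = g [^] i \<otimes> g" using assms(1) by (metis nat_pow_Suc nat_pow_Suc2)
  have "val ((twist g ^^ Suc i) u) x = translate g (val ((twist g ^^ i) u) (x \<otimes> g))"
    using Suc.prems by (simp add: val_twist)
  also have "\<dots> = translate g (translate (g [^] i) (val u ((x \<otimes> g) \<otimes> g [^] i)))"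
    using Suc.IH[of "x \<otimes> g"] Suc.prems assms by simp
  also have "\<dots> = translate (g [^] Suc i) (val u (x \<otimes> g [^] Suc i))"
    using assms Suc.prems c by (simp add: translate_translate m_assoc)
  finally show ?case .
qed

lemma twist_act: "y \<in> carrier G \<Longrightarrow> g \<in> carrier G \<Longrightarrow> twist g (act y u) = act y (twist g u)"
  by (rule gfun_eqI[OF twist_in gmod_act[OF gmod_free_mod _ twist_in]])
     (auto simp: val_twist val_act m_assoc)

text \<open>
  The set \<open>S = T H\<close>, where \<open>T\<close> is a transversal of the left cosets of \<open>K\<close>. Its translates by the
  powers of \<open>g\<close> partition \<open>G\<close>, which makes cutting off a function outside \<open>S\<close> a projection as needed
  in \<open>cyclic_exact\<close>.
\<close>

lemma coset_slice:
  assumes K: "subgroup K G" and H: "subgroup H G" "H \<subseteq> K" and g: "g \<in> K"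
    and uniq: "\<And>k. k \<in> K \<Longrightarrow> \<exists>!i. i < p \<and> k \<otimes> g [^] (i::nat) \<in> H"
  obtains S where "\<And>x. x \<in> carrier G \<Longrightarrow> \<exists>!i. i < p \<and> x \<otimes> g [^] (i::nat) \<in> S"
    "\<And>x h. x \<in> carrier G \<Longrightarrow> h \<in> H \<Longrightarrow> x \<otimes> h \<in> S \<longleftrightarrow> x \<in> S"
proof -
  interpret K: subgroup K G by fact
  interpret H: subgroup H G by fact
  define y where "y = (\<lambda>x. SOME z. z \<in> x <# K)"
  have y: "y x \<in> x <# K" if "x \<in> carrier G" for x
    unfolding y_def by (rule someI[of _ "x \<otimes> \<one>"]) (auto simp: l_coset_def that)
  have yk: "inv (y x) \<otimes> x \<in> K" "y x \<in> carrier G" if x: "x \<in> carrier G" for x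
  proof -
    obtain k where k: "k \<in> K" "y x = x \<otimes> k" using y[OF x] by (auto simp: l_coset_def)
    then have "inv (y x) \<otimes> x = inv k" using x by (simp add: inv_mult_group m_assoc)
    then show "inv (y x) \<otimes> x \<in> K" using k by simp
    show "y x \<in> carrier G" using k x by simp
  qed
  have y_inv: "y (x \<otimes> k) = y x" if x: "x \<in> carrier G" "k \<in> K" for x k
  proof -
    have "(x \<otimes> k) <# K = x <# K"
      using lcos_m_assoc[OF K.subset, of x k] coset_join3[OF _ K x(2)] x by simp
    then show ?thesis by (simp add: y_def)
  qed
  show ?thesis
  proof
    let ?S = "{x \<in> carrier G. inv (y x) \<otimes> x \<in> H}"
    fix x assume x: "x \<in> carrier G"
    have gi: "g [^] (i::nat) \<in> K" for i using g by (induction i) auto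
    have "x \<otimes> g [^] i \<in> ?S \<longleftrightarrow> (inv (y x) \<otimes> x) \<otimes> g [^] i \<in> H" for i :: nat
      using x gi[of i] yk[OF x] y_inv[OF x gi] by (simp add: m_assoc)
    then show "\<exists>!i. i < p \<and> x \<otimes> g [^] i \<in> ?S" using uniq[OF yk(1)[OF x]] by simp
    show "x \<otimes> h \<in> ?S \<longleftrightarrow> x \<in> ?S" if h: "h \<in> H" for h
    proof -
      have "inv (y x) \<otimes> (x \<otimes> h) \<in> H \<longleftrightarrow> inv (y x) \<otimes> x \<in> H"
      proof -
        have "inv (y x) \<otimes> (x \<otimes> h) = (inv (y x) \<otimes> x) \<otimes> h" using x h yk by (simp add: m_assoc)
        moreover have "((inv (y x) \<otimes> x) \<otimes> h) \<otimes> inv h = inv (y x) \<otimes> x" using x h yk by (simp add: m_assoc)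
        ultimately show ?thesis using h by (metis H.m_closed H.m_inv_closed)
      qed
      moreover have "y (x \<otimes> h) = y x" using y_inv[OF x] h H(2) by blast
      ultimately show ?thesis using x h by simp
    qed
  qed
qed

lemma sum_unique: "finite A \<Longrightarrow> \<exists>!i. i \<in> A \<and> Q i \<Longrightarrow> (\<Sum>i\<in>A. if Q i then c else 0) = c"
  for c :: "'b :: comm_monoid_add"
proof -
  assume A: "finite A" and ex: "\<exists>!i. i \<in> A \<and> Q i"
  from ex obtain i where i: "i \<in> A" "\<forall>j\<in>A. Q j \<longleftrightarrow> j = i" by (metis (full_types))
  have "(\<Sum>i\<in>A. if Q i then c else 0) = (\<Sum>j\<in>A. if j = i then c else 0)"
    by (rule sum.cong[OF refl]) (simp add: i(2))
  then show "(\<Sum>i\<in>A. if Q i then c else 0) = c" using A i(1) by simp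
qed

text \<open>
  With \<open>X = coind M H\<close>, \<open>Y = coind M K\<close> and \<open>\<tau>\<close> the twist by \<open>g\<close>, the module \<open>Y\<close> is the kernel of
  \<open>\<tau> - 1\<close> on \<open>X\<close> and the image of the norm. So with \<open>L\<close> the image of \<open>\<tau> - 1\<close> there are exact
  sequences \<open>0 \<rightarrow> Y \<rightarrow> X \<rightarrow> L \<rightarrow> 0\<close> and \<open>0 \<rightarrow> L \<rightarrow> X \<rightarrow> Y \<rightarrow> 0\<close>. The sequence \<open>c\<close> of partial sums of \<open>b\<close>
  satisfies \<open>c (j + 1) = b (j + 1) + c j\<close>, which is the recursion for the ranks in a mapping cone, so
  both \<open>Y\<close> and \<open>L\<close> have resolutions with ranks \<open>c\<close>, by simultaneous induction on the length.
\<close>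

lemma coind_cyclic_extension:
  fixes M :: "('g \<Rightarrow> 'f::field) set"
  assumes M: "left_ideal M" and K: "subgroup K G" and H: "subgroup H G" "H \<subseteq> K" and g: "g \<in> K"
    and norm: "\<And>h. h \<in> H \<Longrightarrow> inv g \<otimes> h \<otimes> g \<in> H"
    and gp: "g [^] p \<in> H"
    and uniq: "\<And>k. k \<in> K \<Longrightarrow> \<exists>!i. i < p \<and> k \<otimes> g [^] (i::nat) \<in> H"
    and res: "\<And>t. free_res t b (coind M H)"
  shows "free_res t (\<lambda>j. \<Sum>k\<le>j. b k) (coind M K)"
proof -
  interpret K: subgroup K G by fact
  interpret H: subgroup H G by fact
  have gc [simp]: "g \<in> carrier G" using g by simp
  let ?X = "coind M H" and ?Y = "coind M K" and ?t = "twist g :: (nat \<Rightarrow> 'g \<Rightarrow> 'f) \<Rightarrow> _"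
  have gX: "gmod ?X" and gY: "gmod ?Y" by (auto intro: gmod_coind[OF M])
  have tX: "?t u \<in> ?X" if u: "u \<in> ?X" for u
  proof -
    have "translate g (val u (x \<otimes> h \<otimes> g)) = translate (inv h) (translate g (val u (x \<otimes> g)))"
      if x: "x \<in> carrier G" and h: "h \<in> H" for x h
    proof -
      let ?h = "inv g \<otimes> h \<otimes> g"
      have "x \<otimes> h \<otimes> g = (x \<otimes> g) \<otimes> ?h"
        using x h by (simp add: m_assoc) (simp add: m_assoc[symmetric])
      then have "val u (x \<otimes> h \<otimes> g) = translate (inv ?h) (val u (x \<otimes> g))"
        using u norm[OF h] x by (simp add: coind_def)
      moreover have "g \<otimes> inv ?h = inv h \<otimes> g"
        using h by (simp add: inv_mult_group m_assoc) (simp add: m_assoc[symmetric])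
      ultimately show ?thesis using h by (simp add: translate_translate)
    qed
    then show ?thesis using u left_ideal_translate[OF M gc] by (simp add: coind_def twist_in val_twist)
  qed
  have Xg: "u \<in> gfun" if "u \<in> ?X" for u using that by (simp add: coind_def)
  have per: "(?t ^^ p) u = u" if u: "u \<in> ?X" for u
  proof (rule gfun_eqI)
    have "(?t ^^ i) u \<in> ?X" for i using u tX by (induction i) auto
    then show "(?t ^^ p) u \<in> gfun" by (rule Xg)
    fix x assume x: "x \<in> carrier G"
    have "val ((?t ^^ p) u) x = translate (g [^] p) (translate (inv (g [^] p)) (val u x))"
      using val_twist_pow[OF gc Xg[OF u] x] u x gp by (simp add: coind_def)
    then show "val ((?t ^^ p) u) x = val u x"
      using gp by (simp add: translate_translate translate_one val_supp)
  qed (rule Xg[OF u])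
  obtain S where S: "\<And>x. x \<in> carrier G \<Longrightarrow> \<exists>!i. i < p \<and> x \<otimes> g [^] (i::nat) \<in> S"
    "\<And>x h. x \<in> carrier G \<Longrightarrow> h \<in> H \<Longrightarrow> x \<otimes> h \<in> S \<longleftrightarrow> x \<in> S"
    using coset_slice[OF K H g uniq] by blast
  define \<epsilon> :: "(nat \<Rightarrow> 'g \<Rightarrow> 'f) \<Rightarrow> _" where "\<epsilon> = (\<lambda>u. of_val (\<lambda>x. if x \<in> S then val u x else 0))"
  have val_e: "val (\<epsilon> u) x = (if x \<in> S then val u x else 0)" if "x \<in> carrier G" for u x
    unfolding \<epsilon>_def using that by (subst val_of_val) (auto simp: val_supp pointwise)
  have e_in: "\<epsilon> u \<in> gfun" for u by (simp add: \<epsilon>_def of_val_in)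
  have e_lin: "flinear \<epsilon>"
    by (rule flinearI)
       (auto intro!: gfun_eqI e_in fs.subspace_add[OF subspace_free_mod] fs.subspace_scale[OF subspace_free_mod]
         simp: val_e val_add val_scale, simp add: zero_fun_def)
  have eX: "\<epsilon> u \<in> ?X" if "u \<in> ?X" for u
    using that S(2) by (auto simp: coind_def e_in val_e left_ideal_0[OF M])
  have id: "(\<Sum>i<p. (?t ^^ i) (\<epsilon> ((?t ^^ (p - i)) u))) = u" if u: "u \<in> ?X" for u
  proof (rule gfun_eqI)
    have tpX: "(?t ^^ i) v \<in> ?X" if "v \<in> ?X" for i v using that tX by (induction i) auto
    then show "(\<Sum>i<p. (?t ^^ i) (\<epsilon> ((?t ^^ (p - i)) u))) \<in> gfun"
      using eX u by (intro fs.subspace_sum[OF subspace_free_mod] Xg) auto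
    fix x assume x: "x \<in> carrier G"
    have tm: "val ((?t ^^ i) (\<epsilon> ((?t ^^ (p - i)) u))) x = (if x \<otimes> g [^] i \<in> S then val u x else 0)"
      if i: "i < p" for i
    proof -
      have gg: "g [^] i \<otimes> g [^] (p - i) = g [^] p" using i by (simp add: nat_pow_mult)
      have "val ((?t ^^ i) (\<epsilon> ((?t ^^ (p - i)) u))) x
          = translate (g [^] i) (val (\<epsilon> ((?t ^^ (p - i)) u)) (x \<otimes> g [^] i))"
        by (rule val_twist_pow[OF gc e_in x])
      also have "\<dots> = (if x \<otimes> g [^] i \<in> S then
          translate (g [^] i) (translate (g [^] (p - i)) (val u (x \<otimes> g [^] i \<otimes> g [^] (p - i)))) else 0)"
        using x val_twist_pow[OF gc Xg[OF u], of "x \<otimes> g [^] i" "p - i"] by (simp add: val_e)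
      also have "translate (g [^] i) (translate (g [^] (p - i)) (val u (x \<otimes> g [^] i \<otimes> g [^] (p - i))))
          = translate (g [^] p) (val u (x \<otimes> g [^] p))"
        using x gg by (simp add: translate_translate m_assoc)
      also have "\<dots> = val u x"
        using per[OF u] val_twist_pow[OF gc Xg[OF u] x, of p] by simp
      finally show ?thesis .
    qed
    show "val (\<Sum>i<p. (?t ^^ i) (\<epsilon> ((?t ^^ (p - i)) u))) x = val u x"
      using sum_unique[of "{..<p}" "\<lambda>i. x \<otimes> g [^] i \<in> S" "val u x"] S(1)[OF x] tm
      by (simp add: val_sum)
  qed (rule Xg[OF u])
  define N where "N = (\<lambda>v. \<Sum>i<p. (?t ^^ i) v)"
  have tXs: "?t ` ?X \<subseteq> ?X" and eXs: "\<epsilon> ` ?X \<subseteq> ?X" using tX eX by (auto simp: image_subset_iff)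
  note ex = cyclic_exact[OF gmod_subspace[OF gX] flinear_twist tXs e_lin eXs per id]
  have fixp: "{v \<in> ?X. ?t v = v} = ?Y"
  proof
    show "?Y \<subseteq> {v \<in> ?X. ?t v = v}"
    proof
      fix v assume v: "v \<in> ?Y"
      then have vX: "v \<in> ?X" using H(2) by (auto simp: coind_def)
      have "?t v = v"
      proof (rule gfun_eqI[OF twist_in Xg[OF vX]])
        fix x assume x: "x \<in> carrier G"
        show "val (?t v) x = val v x"
          using v g x by (simp add: val_twist coind_def translate_translate translate_one val_supp)
      qed
      then show "v \<in> {v \<in> ?X. ?t v = v}" using vX by simp
    qed
    show "{v \<in> ?X. ?t v = v} \<subseteq> ?Y"
    proof
      fix v assume "v \<in> {v \<in> ?X. ?t v = v}"
      then have v: "v \<in> ?X" "?t v = v" by auto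
      have fp: "(?t ^^ i) v = v" for i using v(2) by (induction i) auto
      have "val v (x \<otimes> k) = translate (inv k) (val v x)" if x: "x \<in> carrier G" and k: "k \<in> K" for x k
      proof -
        obtain i where i: "k \<otimes> g [^] (i::nat) \<in> H" using uniq[OF k] by blast
        have kc: "k \<in> carrier G" using k by simp
        have "val v (x \<otimes> k) = translate (g [^] i) (val v (x \<otimes> k \<otimes> g [^] i))"
          using val_twist_pow[OF gc Xg[OF v(1)], of "x \<otimes> k" i] fp x kc by simp
        also have "val v (x \<otimes> k \<otimes> g [^] i) = translate (inv (k \<otimes> g [^] i)) (val v x)"
          using v(1) x i kc by (simp add: coind_def m_assoc)
        also have "translate (g [^] i) \<dots> = translate (inv k) (val v x)"
          using kc by (simp add: translate_translate inv_mult_group m_assoc[symmetric])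
        finally show ?thesis .
      qed
      then show "v \<in> ?Y" using v(1) by (simp add: coind_def)
    qed
  qed
  define L where "L = (\<lambda>v. ?t v - v) ` ?X"
  have d_hom: "ghom ?X ?X (\<lambda>v. ?t v - v)"
  proof -
    have "flinear (\<lambda>v. ?t v - v)"
      by (rule flinearI)
         (simp_all add: flinear_add[OF flinear_twist] flinear_scale[OF flinear_twist] fs.scale_right_diff_distrib)
    then show ?thesis using tX fs.subspace_diff[OF gmod_subspace[OF gX]]
      by (auto simp: ghom_def twist_act flinear_diff[OF flinear_act])
  qed
  have NX: "N ` ?X = ?Y" using ex(1) fixp by (simp add: N_def)
  have kerN: "gker ?X N = L" using ex(2) by (simp add: gker_def N_def L_def)
  have N_hom: "ghom ?X ?Y N"
  proof -
    have pw: "ghom ?X ?X (?t ^^ i)" for i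
      by (rule ghom_funpow) (use tX in \<open>auto simp: ghom_def flinear_twist twist_act\<close>)
    have "flinear N" unfolding N_def
      by (rule flinearI) (simp_all add: flinear_add[OF ghom_flinear[OF pw]] flinear_scale[OF ghom_flinear[OF pw]]
          sum.distrib fs.scale_sum_right)
    moreover have "N ` ?X \<subseteq> ?Y" using NX by simp
    moreover have "N (act y u) = act y (N u)" if "y \<in> carrier G" "u \<in> ?X" for y u
      unfolding N_def using ghom_act[OF pw that] by (simp add: flinear_sum[OF flinear_act])
    ultimately show ?thesis by (simp add: ghom_def)
  qed
  have gL: "gmod L" unfolding L_def by (rule gmod_image[OF gX gX d_hom])
  have LX: "L \<subseteq> ?X" using d_hom by (auto simp: L_def ghom_def)
  have YX: "?Y \<subseteq> ?X" using fixp by blast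
  define c where "c = (\<lambda>j. \<Sum>k\<le>j. b k)"
  have c_rec: "(\<lambda>j. case j of 0 \<Rightarrow> b 0 | Suc k \<Rightarrow> b (Suc k) + c k) = c"
    by (auto simp: c_def fun_eq_iff split: nat.split)
  have "free_res t c ?Y \<and> free_res t c L"
  proof (induction t)
    case (Suc t)
    let ?c = "\<lambda>j. case j of 0 \<Rightarrow> b 0 | Suc k \<Rightarrow> b (Suc k) + c k"
    have "free_res (Suc t) ?c L"
    proof (rule free_res_mapping_cone[OF gY gX gL ghom_id[OF YX] _ _ _ _ _ res])
      show "ghom ?X L (\<lambda>v. ?t v - v)"
        by (rule ghom_subset[OF d_hom order_refl]) (simp add: L_def)
      show "gker ?X (\<lambda>v. ?t v - v) = (\<lambda>u. u) ` ?Y" using fixp by (simp add: gker_def)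
      show "free_res t c ?Y" using Suc by blast
    qed (simp_all add: L_def)
    moreover have "free_res (Suc t) ?c ?Y"
    proof (rule free_res_mapping_cone[OF gL gX gY ghom_id[OF LX] _ N_hom NX _ _ res])
      show "gker ?X N = (\<lambda>u. u) ` L" using kerN by simp
      show "free_res t c L" using Suc by blast
    qed simp
    ultimately have "free_res (Suc t) c L \<and> free_res (Suc t) c ?Y" by (simp only: c_rec)
    then show ?case by blast
  qed simp
  then show ?thesis by (simp add: c_def)
qed

subsection \<open>Coinduction from a subgroup acting freely\<close>

lemma free_res_zero: "free_res t a {0 :: nat \<Rightarrow> 'g \<Rightarrow> 'f::field}"
proof (induction t arbitrary: a)
  case (Suc t)
  let ?F = "free_mod 0 :: (nat \<Rightarrow> 'g \<Rightarrow> 'f) set"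
  have z: "?F = {0}" by (auto simp: free_mod_def pointwise fun_eq_iff)
  have "ghom ?F {0} (\<lambda>u. u)" by (rule ghom_id) (simp add: z)
  moreover have "gker ?F (\<lambda>u. u) = {0}" by (auto simp: gker_def z)
  then have "free_res t (\<lambda>j. a (Suc j)) (gker ?F (\<lambda>u. u))" using Suc.IH by simp
  moreover have "(\<lambda>u. u) ` ?F = {0}" by (simp add: z)
  ultimately show ?case unfolding free_res.simps
    by (intro exI[of _ "0::nat"] exI[of _ "\<lambda>u. u"] conjI) simp_all
qed simp

text \<open>
  The hypotheses say that \<open>H\<close> acts freely on \<open>\<Sigma>\<close> by left multiplication and that restriction to
  \<open>\<Sigma>\<close> identifies \<open>M\<close> with all functions on \<open>\<Sigma>\<close>, so that \<open>M\<close> is free over \<open>H\<close>. Then a function in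
  \<open>coind M H\<close> is determined by the coefficients of its values at representatives \<open>c\<close> of the
  \<open>H\<close>-orbits on \<open>\<Sigma>\<close>, because the coefficient of \<open>h c\<close> in \<open>\<psi> x\<close> is that of \<open>c\<close> in \<open>\<psi> (x h)\<close>, and
  these coefficients are arbitrary functions of \<open>x\<close>. Thus reading them off is an isomorphism
  onto a free module, with one coordinate for each orbit.
\<close>

lemma free_res_coind_free:
  fixes M :: "('g \<Rightarrow> 'f::field) set"
  assumes M: "left_ideal M" and H: "subgroup H G"
    and \<Sigma>: "\<Sigma> \<subseteq> carrier G" "\<And>h s. h \<in> H \<Longrightarrow> s \<in> \<Sigma> \<Longrightarrow> h \<otimes> s \<in> \<Sigma>"
    and inj: "\<And>m. m \<in> M \<Longrightarrow> (\<And>s. s \<in> \<Sigma> \<Longrightarrow> m s = 0) \<Longrightarrow> m = 0"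
    and surj: "\<And>\<phi>. \<exists>m\<in>M. \<forall>s\<in>\<Sigma>. m s = \<phi> s"
  obtains r where "\<And>t. free_res t (\<lambda>j. if j = 0 then r else 0) (coind M H)"
proof -
  interpret H: subgroup H G by fact
  let ?X = "coind M H"
  have gX: "gmod ?X" by (rule gmod_coind[OF M H.subset])
  define c where "c = (\<lambda>s. SOME z. z \<in> H #> s)"
  have c: "s \<otimes> inv (c s) \<in> H" "c s \<in> \<Sigma>" if s: "s \<in> \<Sigma>" for s
  proof -
    have "s \<in> H #> s" using rcos_self[OF _ H] s \<Sigma>(1) by blast
    then have "c s \<in> H #> s" unfolding c_def by (rule someI)
    then obtain h where h: "h \<in> H" "c s = h \<otimes> s" by (auto simp: r_coset_def)
    have sc: "s \<in> carrier G" using s \<Sigma>(1) by blast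
    have "s \<otimes> inv (h \<otimes> s) = inv h" using h sc by (simp add: inv_mult_group m_assoc[symmetric])
    then show "s \<otimes> inv (c s) \<in> H" using h by simp
    show "c s \<in> \<Sigma>" using h s \<Sigma>(2) by simp
  qed
  have c_inv: "c (h \<otimes> s) = c s" if "h \<in> H" "s \<in> \<Sigma>" for h s
  proof -
    have "H #> (h \<otimes> s) = H #> s"
      using that \<Sigma>(1) H.subset coset_mult_assoc[of H h s] coset_join2[OF _ H] by auto
    then show ?thesis by (simp add: c_def)
  qed
  obtain r cn where cn: "bij_betw cn {..<r::nat} (c ` \<Sigma>)"
    using ex_bij_betw_nat_finite[of "c ` \<Sigma>"] finite_subset[OF \<Sigma>(1) finite_carrier]
    by (metis atLeast0LessThan finite_imageI)
  define R :: "(nat \<Rightarrow> 'g \<Rightarrow> 'f) \<Rightarrow> (nat \<Rightarrow> 'g \<Rightarrow> 'f)"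
    where "R = (\<lambda>u i x. if i < r \<and> x \<in> carrier G then u (enum_index (cn i)) x else 0)"
  have cnS: "cn i \<in> \<Sigma>" "cn i \<in> carrier G" if "i < r" for i
  proof -
    obtain s where "s \<in> \<Sigma>" "cn i = c s" using bij_betwE[OF cn] \<open>i < r\<close> by auto
    then show "cn i \<in> \<Sigma>" using c(2) by simp
    then show "cn i \<in> carrier G" using \<Sigma>(1) by blast
  qed
  have R_val: "R u i x = val u x (cn i)" if "i < r" "x \<in> carrier G" for u i x
    using that cnS by (simp add: R_def val_def)
  have R_hom: "ghom ?X (free_mod r) R"
    unfolding ghom_def
  proof (intro conjI ballI)
    show "flinear R" by (rule flinearI) (auto simp: R_def fun_eq_iff pointwise)
    show "R ` ?X \<subseteq> free_mod r" by (auto simp: R_def free_mod_def split: if_splits)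
  qed (auto simp: R_def act_def fun_eq_iff)
  have shift: "val u x (h \<otimes> s) = val u (x \<otimes> h) s"
    if "u \<in> ?X" "x \<in> carrier G" "h \<in> H" "s \<in> carrier G" for u x h s
    using that by (simp add: coind_def translate_def)
  have R_inj: "u = 0" if u: "u \<in> ?X" and R0: "R u = 0" for u
  proof (rule gfun_eqI)
    show "u \<in> gfun" using u by (simp add: coind_def)
    show "0 \<in> gfun" by (rule fs.subspace_0[OF subspace_free_mod])
    fix x assume x: "x \<in> carrier G"
    have "val u x s = 0" if s: "s \<in> \<Sigma>" for s
    proof -
      let ?h = "s \<otimes> inv (c s)"
      have sc: "s \<in> carrier G" "c s \<in> carrier G" using s c(2)[OF s] \<Sigma>(1) by auto
      obtain i where i: "i < r" "cn i = c s" using s bij_betw_imp_surj_on[OF cn] by (metis imageE imageI lessThan_iff)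
      have "val u x s = val u x (?h \<otimes> c s)" using sc by (simp add: m_assoc)
      also have "\<dots> = val u (x \<otimes> ?h) (c s)" by (rule shift[OF u x c(1)[OF s] sc(2)])
      also have "\<dots> = R u i (x \<otimes> ?h)" using i x sc by (simp add: R_val)
      also have "\<dots> = 0" using R0 by (simp add: pointwise)
      finally show ?thesis .
    qed
    then show "val u x = val 0 x" using inj[of "val u x"] u x by (auto simp: coind_def)
  qed
  have R_surj: "R ` ?X = free_mod r"
  proof
    show "R ` ?X \<subseteq> free_mod r" using R_hom by (simp add: ghom_def)
    show "free_mod r \<subseteq> R ` ?X"
    proof
      fix a :: "nat \<Rightarrow> 'g \<Rightarrow> 'f" assume a: "a \<in> free_mod r"
      define j where "j = inv_into {..<r} cn"
      have j: "j (cn i) = i" if "i < r" for i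
        unfolding j_def using cn that by (simp add: bij_betw_inv_into_left)
      have "\<exists>m\<in>M. \<forall>s\<in>\<Sigma>. m s = a (j (c s)) (x \<otimes> (s \<otimes> inv (c s)))" for x by (rule surj)
      then obtain m where m: "\<And>x. m x \<in> M" "\<And>x s. s \<in> \<Sigma> \<Longrightarrow> m x s = a (j (c s)) (x \<otimes> (s \<otimes> inv (c s)))"
        by metis
      define u where "u = of_val m"
      have vu: "val u x = m x" if "x \<in> carrier G" for x
        unfolding u_def using that left_ideal_supp[OF M m(1)] by (intro val_of_val)
      have "m (x \<otimes> h) = translate (inv h) (m x)" if x: "x \<in> carrier G" and h: "h \<in> H" for x h
      proof -
        have "m (x \<otimes> h) + (\<lambda>y. (- 1) * translate (inv h) (m x) y) = 0"
        proof (rule inj)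
          show "m (x \<otimes> h) + (\<lambda>y. (- 1) * translate (inv h) (m x) y) \<in> M"
            using h by (intro left_ideal_add[OF M] left_ideal_scale[OF M] left_ideal_translate[OF M] m(1)) auto
          fix s assume s: "s \<in> \<Sigma>"
          have sc: "s \<in> carrier G" "c s \<in> carrier G" using s c(2)[OF s] \<Sigma>(1) by auto
          have "translate (inv h) (m x) s = m x (h \<otimes> s)" using h sc by (simp add: translate_def)
          also have "\<dots> = a (j (c s)) (x \<otimes> (h \<otimes> s \<otimes> inv (c s)))"
            using m(2)[OF \<Sigma>(2)[OF h s]] c_inv[OF h s] by simp
          also have "\<dots> = m (x \<otimes> h) s" using m(2)[OF s] x h sc by (simp add: m_assoc)
          finally show "(m (x \<otimes> h) + (\<lambda>y. (- 1) * translate (inv h) (m x) y)) s = 0" by (simp add: pointwise)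
        qed
        then show ?thesis by (simp add: fun_eq_iff pointwise)
      qed
      then have uX: "u \<in> ?X" using m(1) vu by (simp add: coind_def of_val_in u_def[symmetric]) (simp add: u_def of_val_in)
      have "R u = a"
      proof (intro ext)
        fix i x
        show "R u i x = a i x"
        proof (cases "i < r \<and> x \<in> carrier G")
          case True
          then have i: "i < r" and x: "x \<in> carrier G" by auto
          \<comment> \<open>representatives represent themselves\<close>
          have cc: "c (cn i) = cn i"
          proof -
            obtain s where s: "s \<in> \<Sigma>" "cn i = c s" using bij_betwE[OF cn] i by auto
            have "c s = inv (s \<otimes> inv (c s)) \<otimes> s"
              using s(1) c(2)[OF s(1)] \<Sigma>(1) by (auto simp: inv_mult_group m_assoc subset_eq)
            then have "c (c s) = c s" using c_inv[OF H.m_inv_closed[OF c(1)[OF s(1)]] s(1)] by simp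
            then show ?thesis using s by simp
          qed
          show ?thesis using R_val[OF i x, of u] vu[OF x] m(2)[OF cnS(1)[OF i], of x] cc j[OF i] x cnS[OF i] by simp
        next
          case False
          then show ?thesis using free_modD[OF a False] by (auto simp: R_def)
        qed
      qed
      then show "a \<in> R ` ?X" using uX by blast
    qed
  qed
  have inj_R: "inj_on R ?X"
  proof (rule inj_onI)
    fix u v assume uv: "u \<in> ?X" "v \<in> ?X" "R u = R v"
    then have "R (u - v) = 0" by (simp add: flinear_diff[OF ghom_flinear[OF R_hom]])
    then have "u - v = 0" using R_inj fs.subspace_diff[OF gmod_subspace[OF gX]] uv by blast
    then show "u = v" by simp
  qed
  obtain f where f: "flinear f" "\<forall>u\<in>?X. f (R u) = u"
    using fsp.linear_exists_left_inverse_on[OF ghom_flinear[OF R_hom] gmod_subspace[OF gX] inj_R] by blast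
  have "f ` free_mod r = (\<lambda>u. f (R u)) ` ?X" using R_surj by (metis image_image)
  also have "\<dots> = ?X" using f(2) by simp
  finally have f_surj: "f ` free_mod r = ?X" .
  have f_hom: "ghom (free_mod r) ?X f"
    unfolding ghom_def
  proof (intro conjI ballI f(1))
    show "f ` free_mod r \<subseteq> ?X" using f_surj by simp
    fix g and a :: "nat \<Rightarrow> 'g \<Rightarrow> 'f" assume g: "g \<in> carrier G" and "a \<in> free_mod r"
    then obtain u where u: "u \<in> ?X" "a = R u" using R_surj by blast
    have "f (act g a) = f (R (act g u))" using u g ghom_act[OF R_hom] by simp
    also have "\<dots> = act g (f a)" using f(2) u gmod_act[OF gX g u(1)] by simp
    finally show "f (act g a) = act g (f a)" .
  qed
  have "gker (free_mod r) f \<subseteq> {0}"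
  proof
    fix a assume "a \<in> gker (free_mod r) f"
    then have a: "a \<in> R ` ?X" "f a = 0" using R_surj by (auto simp: gker_def)
    then obtain u where u: "u \<in> ?X" "a = R u" "f (R u) = 0" by blast
    then have "u = 0" using f(2) by metis
    then show "a \<in> {0}" using u flinear_0[OF ghom_flinear[OF R_hom]] by simp
  qed
  then have "gker (free_mod r) f = {0}"
    using fs.subspace_0[OF subspace_free_mod] flinear_0[OF f(1)] unfolding gker_def by blast
  then have "free_res t (\<lambda>j. if Suc j = 0 then r else 0) (gker (free_mod r) f)" for t
    using free_res_zero by simp
  then have "free_res (Suc t) (\<lambda>j. if j = 0 then r else 0) ?X" for t
    unfolding free_res.simps using f_hom f_surj by (intro exI[of _ r] exI[of _ f] conjI) simp_all
  then have "free_res t (\<lambda>j. if j = 0 then r else 0) ?X" for t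
    by (cases t) simp_all
  then show ?thesis by (rule that)
qed

subsection \<open>Retraction from a subgroup of invertible index\<close>

text \<open>
  The embedding of \<open>A\<close> as \<open>A^1\<close>.
\<close>

definition emb :: "('g \<Rightarrow> 'f::field) \<Rightarrow> (nat \<Rightarrow> 'g \<Rightarrow> 'f)" where
  "emb m = (\<lambda>i x. if i = 0 then m x else 0)"

lemma act_emb: "act g (emb m) = emb (translate g m)"
  by (auto simp: act_def emb_def translate_def fun_eq_iff)

lemma emb_add: "emb (m + m') = emb m + emb m'"
  and emb_scale: "emb (\<lambda>x. c * m x) = fscale c (emb m)"
  and emb_apply: "emb m 0 = m"
  by (auto simp: emb_def pointwise fun_eq_iff)

lemma gmod_emb:
  assumes M: "left_ideal M"
  shows "gmod (emb ` M)"
proof (rule gmod_subset[OF gmod_free_mod[of 1]])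
  show "fs.subspace (emb ` M)"
    unfolding fs.subspace_def
  proof (intro conjI ballI allI)
    have "emb 0 = 0" by (auto simp: emb_def fun_eq_iff pointwise)
    then show "0 \<in> emb ` M" using left_ideal_0[OF M] by (metis imageI)
  qed (auto simp: emb_add[symmetric] emb_scale[symmetric] left_ideal_add[OF M] left_ideal_scale[OF M])
  show "emb ` M \<subseteq> free_mod 1" using left_ideal_supp[OF M] by (fastforce simp: emb_def free_mod_def split: if_splits)
qed (auto simp: act_emb left_ideal_translate[OF M])

text \<open>
  The maps are \<open>m \<mapsto> (x \<mapsto> x\<inverse> m)\<close> and \<open>\<psi> \<mapsto> \<Sum> x (\<psi> x)\<close>, the sum running over representatives \<open>x\<close> of
  \<open>G/P\<close>; the term \<open>x (\<psi> x)\<close> depends on the coset \<open>x P\<close> only. The composite is multiplication by the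
  index of \<open>P\<close>. The left coset \<open>x P\<close> is represented by the inverse of a representative of the right
  coset \<open>P x\<inverse>\<close>.
\<close>

lemma coind_retract:
  fixes M :: "('g \<Rightarrow> 'f::field) set"
  assumes M: "left_ideal M" and P: "subgroup P G" and idx: "of_nat (card (rcosets P)) \<noteq> (0::'f)"
  shows "\<exists>i r. ghom (emb ` M) (coind M P) i \<and> ghom (coind M P) (emb ` M) r \<and>
    inj_on (\<lambda>u. r (i u)) (emb ` M)"
proof -
  interpret P: subgroup P G by fact
  define i :: "(nat \<Rightarrow> 'g \<Rightarrow> 'f) \<Rightarrow> _" where "i = (\<lambda>u. of_val (\<lambda>x. translate (inv x) (u 0)))"
  define rep where "rep = (\<lambda>C. SOME x. x \<in> carrier G \<and> C = P #> x)"
  define r :: "(nat \<Rightarrow> 'g \<Rightarrow> 'f) \<Rightarrow> _"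
    where "r = (\<lambda>u. emb (\<Sum>C\<in>rcosets P. translate (inv (rep C)) (val u (inv (rep C)))))"
  have rep: "rep C \<in> carrier G" "C = P #> rep C" if "C \<in> rcosets P" for C
    using someI_ex[of "\<lambda>x. x \<in> carrier G \<and> C = P #> x"] that by (auto simp: rep_def RCOSETS_def)
  have vi: "val (i u) x = translate (inv x) (u 0)" if "x \<in> carrier G" for u x
    unfolding i_def using that by (subst val_of_val) (auto simp: translate_def)
  have i_in: "i u \<in> gfun" for u by (simp add: i_def of_val_in)
  have i_hom: "ghom (emb ` M) (coind M P) i"
    unfolding ghom_def
  proof (intro conjI ballI)
    have "(u + v) 0 = u 0 + v 0" "fscale c u 0 = (\<lambda>x. c * u 0 x)" for u v :: "nat \<Rightarrow> 'g \<Rightarrow> 'f" and c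
      by (auto simp: pointwise)
    then show "flinear i"
      by (intro flinearI gfun_eqI i_in fs.subspace_add[OF subspace_free_mod] fs.subspace_scale[OF subspace_free_mod])
         (auto simp: vi val_add val_scale translate_add translate_scale)
    show "i ` emb ` M \<subseteq> coind M P"
      using left_ideal_translate[OF M] by (auto simp: coind_def i_in vi emb_apply translate_translate inv_mult_group)
    fix g u assume g: "g \<in> carrier G" and u: "u \<in> emb ` M"
    then obtain m where m: "u = emb m" "m \<in> M" by auto
    show "i (act g u) = act g (i u)"
      by (rule gfun_eqI[OF i_in gmod_act[OF gmod_free_mod g i_in]])
         (use g in \<open>simp add: vi val_act m act_emb emb_apply translate_translate inv_mult_group\<close>)
  qed
  have indep: "translate (inv (rep (P #> x))) (val u (inv (rep (P #> x)))) = translate (inv x) (val u (inv x))"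
    if u: "u \<in> coind M P" and x: "x \<in> carrier G" for u x
  proof -
    let ?y = "rep (P #> x)"
    have C: "P #> x \<in> rcosets P" using x by (auto simp: RCOSETS_def)
    have y: "?y \<in> carrier G" using rep(1)[OF C] .
    have "?y \<in> P #> x" using rep(2)[OF C] rcos_self[OF y P] by simp
    then obtain h where h: "h \<in> P" "?y = h \<otimes> x" by (auto simp: r_coset_def)
    have "val u (inv ?y) = val u (inv x \<otimes> inv h)" using h x by (simp add: inv_mult_group)
    also have "\<dots> = translate h (val u (inv x))" using u x h by (simp add: coind_def)
    finally have "translate (inv ?y) (val u (inv ?y)) = translate (inv ?y \<otimes> h) (val u (inv x))"
      using y h by (simp add: translate_translate)
    also have "inv ?y \<otimes> h = inv x" using h x by (simp add: inv_mult_group m_assoc)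
    finally show ?thesis .
  qed
  have translate_sum: "translate g (sum f A) = (\<Sum>a\<in>A. translate g (f a))" for g A and f :: "'g set \<Rightarrow> 'g \<Rightarrow> 'f"
    by (induction A rule: infinite_finite_induct) (auto simp: translate_add)
  have r_hom: "ghom (coind M P) (emb ` M) r"
    unfolding ghom_def
  proof (intro conjI ballI)
    have scale_sum: "(\<Sum>a\<in>A. (\<lambda>y. c * f a y)) = (\<lambda>y. c * sum f A y)" for A c and f :: "'g set \<Rightarrow> 'g \<Rightarrow> 'f"
      by (rule ext) (simp add: sum_apply sum_distrib_left)
    show "flinear r"
      by (rule flinearI)
         (simp_all add: r_def val_add val_scale translate_add translate_scale sum.distrib scale_sum emb_add emb_scale)
    show "r ` coind M P \<subseteq> emb ` M"
      using rep by (auto simp: r_def coind_def intro!: imageI left_ideal_sum[OF M] left_ideal_translate[OF M])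
    fix g u assume g: "g \<in> carrier G" and u: "u \<in> coind M P"
    have "(\<Sum>C\<in>rcosets P. translate (inv (rep C)) (val (act g u) (inv (rep C))))
        = (\<Sum>C\<in>rcosets P. translate g (translate (inv (rep C)) (val u (inv (rep C)))))"
    proof (rule sum.reindex_bij_witness[where i = "\<lambda>C. C #> inv g" and j = "\<lambda>C. C #> g"])
      have cos: "(P #> x) #> y = P #> (x \<otimes> y)" if "x \<in> carrier G" "y \<in> carrier G" for x y
        using coset_mult_assoc[OF P.subset that] .
      fix C assume C: "C \<in> rcosets P"
      note rc = rep[OF C]
      have "C #> g = P #> (rep C \<otimes> g)" using cos[OF rc(1) g] rc(2) by simp
      moreover have "(P #> (rep C \<otimes> g)) #> inv g = C"
        using cos[of "rep C \<otimes> g" "inv g"] rc g by (simp add: m_assoc)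
      moreover have C2: "C #> inv g = P #> (rep C \<otimes> inv g)" using cos[OF rc(1), of "inv g"] rc(2) g by simp
      moreover have "(P #> (rep C \<otimes> inv g)) #> g = C"
        using cos[of "rep C \<otimes> inv g" g] rc g by (simp add: m_assoc)
      ultimately show "C #> g #> inv g = C" "C #> inv g #> g = C" by simp_all
      show "C #> g \<in> rcosets P" "C #> inv g \<in> rcosets P"
        using \<open>C #> g = _\<close> C2 rc g by (auto simp: RCOSETS_def)
      have "translate (inv (rep (C #> g))) (val u (inv (rep (C #> g))))
          = translate (inv (rep C \<otimes> g)) (val u (inv (rep C \<otimes> g)))"
        using indep[OF u, of "rep C \<otimes> g"] \<open>C #> g = _\<close> rc g by simp
      then show "translate g (translate (inv (rep (C #> g))) (val u (inv (rep (C #> g)))))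
          = translate (inv (rep C)) (val (act g u) (inv (rep C)))"
        using rc g by (simp add: translate_translate inv_mult_group val_act m_assoc[symmetric])
    qed
    then show "r (act g u) = act g (r u)" by (simp add: r_def act_emb translate_sum)
  qed
  have ri: "r (i u) = fscale (of_nat (card (rcosets P))) u" if u: "u \<in> emb ` M" for u
  proof -
    obtain m where m: "u = emb m" "m \<in> M" using u by auto
    have "translate (inv (rep C)) (val (i u) (inv (rep C))) = m" if C: "C \<in> rcosets P" for C
      using rep(1)[OF C] left_ideal_supp[OF M m(2)] by (simp add: vi m emb_apply translate_translate translate_one)
    then have "r (i u) = emb (\<Sum>C\<in>rcosets P. m)" by (simp add: r_def)
    also have "(\<Sum>C\<in>rcosets P. m) = (\<lambda>x. of_nat (card (rcosets P)) * m x)"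
      by (rule ext) (simp add: sum_apply)
    finally show ?thesis by (simp add: m emb_scale)
  qed
  have "inj_on (\<lambda>u. r (i u)) (emb ` M)"
  proof (rule inj_onI)
    fix u v assume "u \<in> emb ` M" "v \<in> emb ` M" "r (i u) = r (i v)"
    then show "u = v" using ri idx fs.scale_cancel_left by metis
  qed
  then show ?thesis using i_hom r_hom by (intro exI[of _ i] exI[of _ r] conjI)
qed

end


section \<open>Finite p-groups\<close>

lemma group_actionI:
  assumes K: "group K"
    and closed: "\<And>g x. g \<in> carrier K \<Longrightarrow> x \<in> E \<Longrightarrow> act g x \<in> E"
    and one: "\<And>x. x \<in> E \<Longrightarrow> act \<one>\<^bsub>K\<^esub> x = x"
    and mult: "\<And>g h x. g \<in> carrier K \<Longrightarrow> h \<in> carrier K \<Longrightarrow> x \<in> E \<Longrightarrow> act (g \<otimes>\<^bsub>K\<^esub> h) x = act g (act h x)"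
  shows "group_action K E (\<lambda>g. restrict (act g) E)"
proof -
  interpret K: group K by fact
  have bij: "restrict (act g) E \<in> Bij E" if g: "g \<in> carrier K" for g
  proof -
    have "bij_betw (act g) E E"
      by (rule bij_betw_byWitness[where f' = "act (inv\<^bsub>K\<^esub> g)"])
         (use g closed one mult[symmetric] in auto)
    then show ?thesis unfolding Bij_def by (auto cong: bij_betw_cong)
  qed
  have "restrict (act (g \<otimes>\<^bsub>K\<^esub> h)) E = restrict (act g) E \<otimes>\<^bsub>BijGroup E\<^esub> restrict (act h) E"
    if "g \<in> carrier K" "h \<in> carrier K" for g h
    using that bij by (auto simp: BijGroup_def compose_def mult closed intro!: restrict_ext)
  then have "(\<lambda>g. restrict (act g) E) \<in> hom K (BijGroup E)"
    using bij by (auto simp: hom_def BijGroup_def)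
  then show ?thesis
    by (intro group_action.intro group_hom.intro group_hom_axioms.intro K group_BijGroup)
qed

context group_action
begin

lemma dvd_card_of_orbits:
  assumes "finite E" "\<And>x. x \<in> E \<Longrightarrow> d dvd card (orbit G \<phi> x)"
  shows "d dvd card E"
proof -
  have "d dvd card (\<Union>(orbits G E \<phi>))"
  proof (rule dvd_partition)
    show "finite (\<Union>(orbits G E \<phi>))" using assms(1) by (simp add: orbits_coverture)
    show "\<forall>c\<in>orbits G E \<phi>. d dvd card c" using assms(2) by (auto simp: orbits_def)
    show "\<forall>c1\<in>orbits G E \<phi>. \<forall>c2\<in>orbits G E \<phi>. c1 \<noteq> c2 \<longrightarrow> c1 \<inter> c2 = {}"
      using disjoint_union by blast
  qed
  then show ?thesis by (simp add: orbits_coverture)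
qed

lemma card_orbit_prime_power:
  assumes "prime p" "Coset.order G = p ^ a" "x \<in> E"
  obtains k where "card (orbit G \<phi> x) = p ^ k" "p ^ k * card (stabilizer G \<phi> x) = p ^ a"
proof -
  have "card (orbit G \<phi> x) dvd p ^ a"
    using orbit_stabilizer_theorem[OF assms(3)] assms(2) by (metis dvd_triv_left)
  then show ?thesis
    using that orbit_stabilizer_theorem[OF assms(3)] assms(1,2) divides_primepow_nat by metis
qed

lemma exists_second_fixed_point:
  assumes p: "prime p" "Coset.order G = p ^ a" and E: "finite E" "p dvd card E"
    and x0: "x0 \<in> E" "\<And>g. g \<in> carrier G \<Longrightarrow> \<phi> g x0 = x0"
  shows "\<exists>x\<in>E. x \<noteq> x0 \<and> (\<forall>g\<in>carrier G. \<phi> g x = x)"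
proof (rule ccontr)
  assume neg: "\<not> ?thesis"
  interpret group G using group_hom by (simp add: group_hom_def)
  have orb_x0: "orbit G \<phi> x0 = {x0}"
  proof
    show "orbit G \<phi> x0 \<subseteq> {x0}" using x0(2) by (auto simp: orbit_def)
    show "{x0} \<subseteq> orbit G \<phi> x0" using orbit_refl[OF x0(1)] by simp
  qed
  have big: "p dvd card (orbit G \<phi> x)" if x: "x \<in> E" "x \<noteq> x0" for x
  proof -
    obtain k where k: "card (orbit G \<phi> x) = p ^ k" by (rule card_orbit_prime_power[OF p x(1)])
    have "k \<noteq> 0"
    proof
      assume "k = 0"
      then obtain y where y: "orbit G \<phi> x = {y}" using k card_1_singletonE by (metis power_0)
      then have "y = x" using orbit_refl[OF x(1)] by simp
      then have "\<phi> g x = x" if "g \<in> carrier G" for g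
      proof -
        have "\<phi> g x \<in> orbit G \<phi> x" using that by (auto simp: orbit_def)
        then show ?thesis using y \<open>y = x\<close> by simp
      qed
      then show False using neg x by blast
    qed
    then show ?thesis using k by simp
  qed
  have un: "E - {x0} = \<Union>(orbits G E \<phi> - {{x0}})"
  proof -
    have "{x0} \<in> orbits G E \<phi>" using orb_x0 x0(1) by (auto simp: orbits_def)
    then have "\<forall>c\<in>orbits G E \<phi> - {{x0}}. x0 \<notin> c" using disjoint_union by fastforce
    then show ?thesis using orbits_coverture by blast
  qed
  have "p dvd card (\<Union>(orbits G E \<phi> - {{x0}}))"
  proof (rule dvd_partition)
    show "finite (\<Union>(orbits G E \<phi> - {{x0}}))" using E un by (metis finite_Diff)
    show "\<forall>c\<in>orbits G E \<phi> - {{x0}}. p dvd card c" using big orb_x0 by (auto simp: orbits_def)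
    show "\<forall>c1\<in>orbits G E \<phi> - {{x0}}. \<forall>c2\<in>orbits G E \<phi> - {{x0}}. c1 \<noteq> c2 \<longrightarrow> c1 \<inter> c2 = {}"
      using disjoint_union by blast
  qed
  then have "p dvd card E - 1" using un E x0(1) by (metis card_Diff_singleton)
  moreover have "card E > 0" using E x0 card_gt_0_iff by blast
  ultimately have "p dvd 1" using E(2) by (metis One_nat_def Suc_leI dvd_diffD1)
  then show False using p(1) by simp
qed

end

context group
begin

text \<open>
  Normalisers grow in \<open>p\<close>-groups: \<open>H\<close> acts on the set of its right cosets in \<open>P\<close>, whose number is
  divisible by \<open>p\<close>, and fixes the coset \<open>H\<close>; since orbits have \<open>p\<close>-power length, it fixes another.
\<close>

lemma normalizer_element:
  assumes p: "prime p" and P: "subgroup P G" "card P = p ^ a" and H: "subgroup H G" "H \<subseteq> P" "H \<noteq> P"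
  shows "\<exists>g\<in>P. g \<notin> H \<and> (\<forall>h\<in>H. g \<otimes> h \<otimes> inv g \<in> H)"
proof -
  interpret P: subgroup P G by fact
  interpret H: subgroup H G by fact
  have finP: "finite P" using P p by (metis card.infinite power_not_zero not_prime_0)
  let ?P = "G\<lparr>carrier := P\<rparr>" and ?H = "G\<lparr>carrier := H\<rparr>"
  have gP: "group ?P" and gH: "group ?H" using P.subgroup_is_group H.subgroup_is_group is_group by auto
  have HP: "subgroup H ?P" using H P subgroup_incl by blast
  define E where "E = (\<lambda>x. H #> x) ` P"
  have EE: "E = rcosets\<^bsub>?P\<^esub> H" by (auto simp: E_def RCOSETS_def r_coset_def)
  have lag: "card E * card H = p ^ a"
    using group.lagrange[OF gP HP] P(2) by (simp add: EE Coset.order_def)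
  have cardH: "card H < p ^ a" using psubset_card_mono[OF finP] H P(2) by auto
  have "card E dvd p ^ a" using lag by (metis dvd_triv_left)
  then obtain k where k: "card E = p ^ k" using divides_primepow_nat[OF p] by blast
  have "k \<noteq> 0"
  proof
    assume "k = 0"
    then show False using lag k cardH by simp
  qed
  then have pE: "p dvd card E" using k by simp
  have "card H dvd p ^ a" using lag by (metis dvd_triv_right)
  then obtain b where b: "card H = p ^ b" using divides_primepow_nat[OF p] by blast
  have cos: "(H #> x) #> y = H #> (x \<otimes> y)" if "x \<in> carrier G" "y \<in> carrier G" for x y
    using coset_mult_assoc[OF H.subset that] .
  \<comment> \<open>The subgroup acts on its right cosets by right translation; a fixed coset other than the
    trivial one consists of elements of the normalizer.\<close>
  interpret act: group_action ?H E "\<lambda>h. restrict (\<lambda>C. C #> inv h) E"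
  proof (rule group_actionI[OF gH])
    show "C #> inv g \<in> E" if "g \<in> carrier ?H" "C \<in> E" for g C
      using that H(2) by (auto simp: E_def cos intro!: imageI)
    show "C #> inv \<one>\<^bsub>?H\<^esub> = C" if "C \<in> E" for C
      using that by (auto simp: E_def cos)
    show "C #> inv (g \<otimes>\<^bsub>?H\<^esub> h) = (C #> inv h) #> inv g"
      if "g \<in> carrier ?H" "h \<in> carrier ?H" "C \<in> E" for g h C
      using that by (auto simp: E_def cos inv_mult_group m_assoc)
  qed
  have H_E: "H \<in> E" using coset_mult_one[OF H.subset] P.one_closed by (force simp: E_def)
  have fixH: "restrict (\<lambda>C. C #> inv h) E H = H" if "h \<in> carrier ?H" for h
    using that H_E coset_join2[OF _ H(1)] by simp
  obtain C where C: "C \<in> E" "C \<noteq> H" "\<And>h. h \<in> carrier ?H \<Longrightarrow> restrict (\<lambda>C. C #> inv h) E C = C"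
  proof -
    have "Coset.order ?H = p ^ b" "finite E" using b finP by (simp_all add: Coset.order_def E_def)
    from act.exists_second_fixed_point[OF p this pE H_E fixH] show ?thesis using that by blast
  qed
  obtain x where x: "x \<in> P" "C = H #> x" using C(1) by (auto simp: E_def)
  have "x \<otimes> h \<otimes> inv x \<in> H" if h: "h \<in> H" for h
  proof -
    have "H #> (x \<otimes> h) = H #> x"
      using C(3)[of "inv h"] C(1) h x by (simp add: cos)
    then have "x \<otimes> h \<in> H #> x" using rcos_self[OF _ H(1), of "x \<otimes> h"] h x by simp
    then obtain h' where "h' \<in> H" "x \<otimes> h = h' \<otimes> x" by (auto simp: r_coset_def)
    then show ?thesis using h x by (simp add: m_assoc)
  qed
  moreover have "x \<notin> H" using C(2) x coset_join2[OF _ H(1)] by auto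
  ultimately show ?thesis using x(1) by blast
qed

text \<open>
  Take an element that normalises \<open>H\<close> and lies outside \<open>H\<close>, and replace it by the last of its iterated
  \<open>p\<close>-th powers that is still outside \<open>H\<close>. Together with \<open>H\<close> this element generates a group \<open>K\<close> in
  which \<open>H\<close> is normal of index \<open>p\<close>.
\<close>

lemma p_group_cyclic_step:
  assumes p: "prime p" and P: "subgroup P G" "card P = p ^ a" and H: "subgroup H G" "H \<subseteq> P" "H \<noteq> P"
  obtains g K where "subgroup K G" "H \<subseteq> K" "K \<subseteq> P" "g \<in> K" "card K = card H * p"
    "\<And>h. h \<in> H \<Longrightarrow> inv g \<otimes> h \<otimes> g \<in> H" "g [^] p \<in> H"
    "\<And>k. k \<in> K \<Longrightarrow> \<exists>!i. i < p \<and> k \<otimes> g [^] (i::nat) \<in> H"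
proof -
  interpret P: subgroup P G by fact
  interpret H: subgroup H G by fact
  have finP: "finite P" using P p by (metis card.infinite power_not_zero not_prime_0)
  have p0: "p > 0" using p prime_gt_0_nat by blast
  obtain x where x: "x \<in> P" "x \<notin> H" "\<And>h. h \<in> H \<Longrightarrow> x \<otimes> h \<otimes> inv x \<in> H"
    using normalizer_element[OF p P H] by auto
  define g where "g = (\<lambda>s. x [^] (p ^ s :: nat))"
  have xa: "g a = \<one>"
  proof -
    have "x [^]\<^bsub>G\<lparr>carrier := P\<rparr>\<^esub> Coset.order (G\<lparr>carrier := P\<rparr>) = \<one>"
      using group.pow_order_eq_1[OF P.subgroup_is_group[OF is_group], of x] x(1) by simp
    then show ?thesis using P(2) by (simp add: g_def Coset.order_def nat_pow_consistent[symmetric])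
  qed
  define s where "s = (LEAST s. g s \<in> H)"
  have gs: "g s \<in> H" unfolding s_def by (rule LeastI[of _ a]) (simp add: xa)
  have "s \<noteq> 0"
  proof
    assume "s = 0"
    then have "x [^] (1::nat) \<in> H" using gs by (simp add: g_def)
    then show False using x(1,2) by simp
  qed
  then obtain s' where s': "s = Suc s'" by (cases s) auto
  \<comment> \<open>the last power in the sequence \<open>x, x^p, x^(p^2), \<dots>\<close> outside \<open>H\<close>\<close>
  define y where "y = g s'"
  have y: "y \<in> P" "y \<notin> H" "y [^] p \<in> H"
  proof -
    have "x [^] (n::nat) \<in> P" for n using x(1) by (induction n) simp_all
    then show "y \<in> P" by (simp add: y_def g_def)
    show "y \<notin> H" using not_less_Least[of s' "\<lambda>s. g s \<in> H"] s' by (auto simp: y_def s_def)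
    show "y [^] p \<in> H" using gs x(1) by (simp add: y_def g_def s' nat_pow_pow mult.commute)
  qed
  have xc: "x \<in> carrier G" and yc: "y \<in> carrier G" using x(1) y(1) by auto
  have conj_x: "x [^] n \<otimes> h \<otimes> inv (x [^] n) \<in> H" if "h \<in> H" for n :: nat and h
    using that
  proof (induction n arbitrary: h)
    case (Suc n)
    have "x [^] Suc n \<otimes> h \<otimes> inv (x [^] Suc n) = x [^] n \<otimes> (x \<otimes> h \<otimes> inv x) \<otimes> inv (x [^] n)"
      using Suc.prems xc by (simp add: inv_mult_group m_assoc)
    then show ?case using Suc x(3) by simp
  qed simp
  have conj_y: "y [^] n \<otimes> h \<otimes> inv (y [^] n) \<in> H" if "h \<in> H" for n :: nat and h
    using conj_x[OF that, of "p ^ s' * n"] xc by (simp add: y_def g_def nat_pow_pow)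
  have y_order: "\<exists>n>0. y [^] (n::nat) = \<one>"
    using xa xc p0 by (intro exI[of _ "p ^ a"]) (simp add: y_def g_def nat_pow_pow mult.commute[of "p ^ s'"], simp add: nat_pow_pow[symmetric])
  \<comment> \<open>\<open>y\<close> has finite order, so its inverse is a power of it\<close>
  then obtain q where q: "q > 0" "y [^] (q::nat) = \<one>" by blast
  have inv_y: "inv (y [^] n) = y [^] ((q - 1) * n)" for n :: nat
  proof (rule inv_equality)
    have "y [^] ((q - 1) * n) \<otimes> y [^] n = (y [^] q) [^] n"
      using q(1) yc by (simp add: nat_pow_mult nat_pow_pow algebra_simps)
    then show "y [^] ((q - 1) * n) \<otimes> y [^] n = \<one>" using q by simp
  qed (use yc in auto)
  define K where "K = {h \<otimes> y [^] (n::nat) | h n. h \<in> H}"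
  have K: "subgroup K G"
  proof (rule subgroupI)
    show "K \<subseteq> carrier G" using yc by (auto simp: K_def)
    show "K \<noteq> {}" using H.one_closed unfolding K_def by blast
  next
    fix k assume "k \<in> K"
    then obtain h n where k: "k = h \<otimes> y [^] (n::nat)" "h \<in> H" by (auto simp: K_def)
    let ?m = "(q - 1) * n"
    have "inv k = y [^] ?m \<otimes> inv h"
      using k yc by (simp add: inv_mult_group inv_y)
    also have "\<dots> = (y [^] ?m \<otimes> inv h \<otimes> inv (y [^] ?m)) \<otimes> y [^] ?m"
      using k yc by (simp add: m_assoc)
    finally have "inv k = (y [^] ?m \<otimes> inv h \<otimes> inv (y [^] ?m)) \<otimes> y [^] ?m" .
    then show "inv k \<in> K" using conj_y[of "inv h" ?m] k(2) unfolding K_def by blast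
  next
    fix k k' assume "k \<in> K" "k' \<in> K"
    then obtain h n h' n' where k: "k = h \<otimes> y [^] (n::nat)" "h \<in> H" "k' = h' \<otimes> y [^] (n'::nat)" "h' \<in> H"
      by (auto simp: K_def)
    have "k \<otimes> k' = (h \<otimes> (y [^] n \<otimes> h' \<otimes> inv (y [^] n))) \<otimes> y [^] (n + n')"
      using k yc by (simp add: nat_pow_mult[symmetric] m_assoc) (simp add: m_assoc[symmetric])
    then show "k \<otimes> k' \<in> K" using conj_y[OF k(4), of n] k(2) unfolding K_def by blast
  qed
  have yH: "y [^] (n::nat) \<in> H \<longleftrightarrow> p dvd n" for n
  proof
    assume "p dvd n"
    then obtain c where "n = p * c" by blast
    then have "y [^] n = (y [^] p) [^] c" using yc by (simp add: nat_pow_pow)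
    moreover have "(y [^] p) [^] c \<in> H" using y(3) by (induction c) simp_all
    ultimately show "y [^] n \<in> H" by simp
  next
    assume n: "y [^] n \<in> H"
    show "p dvd n"
    proof (rule ccontr)
      assume "\<not> p dvd n"
      then have "coprime n p" using p prime_imp_coprime coprime_commute by blast
      then have "gcd n p = 1" by simp
      moreover have "n \<noteq> 0" using \<open>\<not> p dvd n\<close> by (metis dvd_0_right)
      ultimately obtain u v where uv: "n * u = p * v + 1" using bezout_nat by metis
      have pw: "z [^] (c::nat) \<in> H" if "z \<in> H" for z c using that by (induction c) simp_all
      have "y [^] (n * u) = y [^] (p * v) \<otimes> y" unfolding uv using yc by simp
      then have "y = inv (y [^] (p * v)) \<otimes> y [^] (n * u)" using yc by (simp add: m_assoc[symmetric])
      moreover have "y [^] (p * v) \<in> H" "y [^] (n * u) \<in> H"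
        using pw[OF y(3), of v] pw[OF n, of u] yc by (simp_all add: nat_pow_pow)
      ultimately have "y \<in> H" by (metis H.m_closed H.m_inv_closed)
      then show False using y by simp
    qed
  qed
  have uniq: "\<exists>!i. i < p \<and> k \<otimes> y [^] (i::nat) \<in> H" if kK: "k \<in> K" for k
  proof -
    obtain h n where k: "k = h \<otimes> y [^] (n::nat)" "h \<in> H" using kK by (auto simp: K_def)
    have iff: "k \<otimes> y [^] i \<in> H \<longleftrightarrow> p dvd n + i" for i :: nat
    proof -
      have "k \<otimes> y [^] i = h \<otimes> y [^] (n + i)" using k yc by (simp add: m_assoc nat_pow_mult)
      moreover have "h \<otimes> y [^] (n + i) \<in> H \<longleftrightarrow> y [^] (n + i) \<in> H"
      proof
        assume "h \<otimes> y [^] (n + i) \<in> H"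
        then have "inv h \<otimes> (h \<otimes> y [^] (n + i)) \<in> H" using k(2) by simp
        then show "y [^] (n + i) \<in> H" using k(2) yc by (simp add: m_assoc[symmetric])
      qed (use k(2) in simp)
      ultimately show ?thesis using yH by simp
    qed
    have same: "i = j" if "p dvd n + i" "p dvd n + j" "j < p" "i \<le> j" for i j
    proof -
      have "p dvd (n + j) - (n + i)" by (rule dvd_diff_nat[OF that(2,1)])
      then have "j - i = 0" using that(3) by (metis add_diff_cancel_left dvd_imp_le less_imp_diff_less not_gr_zero not_le)
      then show ?thesis using that(4) by simp
    qed
    show ?thesis
    proof (rule ex1I)
      \<comment> \<open>the residue of \<open>- n\<close> modulo \<open>p\<close>\<close>
      let ?i = "(p - n mod p) mod p"
      have "(n + ?i) mod p = 0"
      proof -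
        have "(n + ?i) mod p = (n mod p + (p - n mod p)) mod p" by presburger
        also have "\<dots> = 0" using p0 by (simp add: less_imp_le)
        finally show ?thesis .
      qed
      then show "?i < p \<and> k \<otimes> y [^] ?i \<in> H" using p0 by (simp add: iff mod_eq_0_iff_dvd)
      fix i assume i: "i < p \<and> k \<otimes> y [^] i \<in> H"
      then have "p dvd n + i" "p dvd n + ?i" using iff \<open>(n + ?i) mod p = 0\<close> by auto
      then show "i = ?i"
        using same[of i ?i] same[of ?i i] i p0 by (metis le_cases mod_less_divisor)
    qed
  qed
  have yK: "y [^] (n::nat) \<in> K" for n
    unfolding K_def using H.one_closed yc by (auto intro!: exI[of _ \<one>] exI[of _ n])
  have HK: "H \<subseteq> K"
  proof
    fix h assume "h \<in> H"
    then have "h = h \<otimes> y [^] (0::nat)" by simp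
    then show "h \<in> K" using \<open>h \<in> H\<close> unfolding K_def by blast
  qed
  have "bij_betw (\<lambda>(h, i). h \<otimes> inv (y [^] i)) (H \<times> {..<p}) K"
  proof (rule bij_betw_imageI)
    show "inj_on (\<lambda>(h, i). h \<otimes> inv (y [^] i)) (H \<times> {..<p})"
    proof (rule inj_onI, clarsimp)
      fix h i h' i' assume hi: "h \<in> H" "i < p" "h' \<in> H" "i' < p" "h \<otimes> inv (y [^] i) = h' \<otimes> inv (y [^] i')"
      let ?k = "h \<otimes> inv (y [^] i)"
      have kK: "?k \<in> K" using hi(1) HK K yK by (meson subgroup.m_closed subgroup.m_inv_closed subsetD)
      have 1: "?k \<otimes> y [^] i = h" using hi(1) yc by (simp add: m_assoc)
      have 2: "?k \<otimes> y [^] i' = h'" unfolding hi(5) using hi(3) yc by (simp add: m_assoc)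
      have "i = i'" using uniq[OF kK] 1 2 hi by metis
      then show "h = h' \<and> i = i'" using 1 2 by simp
    qed
    show "(\<lambda>(h, i). h \<otimes> inv (y [^] i)) ` (H \<times> {..<p}) = K"
    proof
      show "(\<lambda>(h, i). h \<otimes> inv (y [^] i)) ` (H \<times> {..<p}) \<subseteq> K"
        using HK K yK by (auto intro!: subgroup.m_closed[OF K] subgroup.m_inv_closed[OF K])
      show "K \<subseteq> (\<lambda>(h, i). h \<otimes> inv (y [^] i)) ` (H \<times> {..<p})"
      proof
        fix k assume k: "k \<in> K"
        obtain i where i: "i < p" "k \<otimes> y [^] i \<in> H" using uniq[OF k] by blast
        have kc: "k \<in> carrier G" using k subgroup.subset[OF K] by blast
        have "k = (k \<otimes> y [^] i) \<otimes> inv (y [^] i)" using kc yc by (simp add: m_assoc)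
        then show "k \<in> (\<lambda>(h, i). h \<otimes> inv (y [^] i)) ` (H \<times> {..<p})"
          using i by (intro image_eqI[of _ _ "(k \<otimes> y [^] i, i)"]) auto
      qed
    qed
  qed
  then have cardK: "card K = card H * p" by (metis bij_betw_same_card card_cartesian_product card_lessThan)
  have yP: "y [^] (n::nat) \<in> P" for n using y(1) by (induction n) simp_all
  have KP: "K \<subseteq> P" using H(2) yP by (auto simp: K_def)
  have norm: "inv y \<otimes> h \<otimes> y \<in> H" if "h \<in> H" for h
    using conj_y[OF that, of "q - 1"] inv_y[of 1] yc by (metis inv_inv mult.right_neutral nat_pow_eone)
  show ?thesis
    using that[OF K HK KP _ cardK norm y(3) uniq] yK[of 1] yc by simp
qed

end

section \<open>Complexity over a p-group containing a subgroup that acts freely\<close>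

definition partial_sums :: "(nat \<Rightarrow> nat) \<Rightarrow> nat \<Rightarrow> nat" where
  "partial_sums b = (\<lambda>j. \<Sum>i\<le>j. b i)"

text \<open>
  Summation raises the degree of polynomial growth by one, and the first of the summations turns
  \<open>r, 0, 0, \<dots>\<close> into a constant sequence.
\<close>

lemma partial_sums_iter_bound:
  "(partial_sums ^^ Suc k) (\<lambda>j. if j = 0 then r else 0) j \<le> r * (j + 1) ^ k"
proof (induction k arbitrary: j)
  case 0
  show ?case by (simp add: partial_sums_def sum.If_cases)
next
  case (Suc k)
  have "(partial_sums ^^ Suc (Suc k)) (\<lambda>j. if j = 0 then r else 0) j
      = (\<Sum>i\<le>j. (partial_sums ^^ Suc k) (\<lambda>j. if j = 0 then r else 0) i)" by (simp add: partial_sums_def)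
  also have "\<dots> \<le> (\<Sum>i\<le>j. r * (j + 1) ^ k)"
  proof (rule sum_mono)
    fix i assume "i \<in> {..j}"
    then have "r * (i + 1) ^ k \<le> r * (j + 1) ^ k" by (intro mult_left_mono power_mono) auto
    then show "(partial_sums ^^ Suc k) (\<lambda>j. if j = 0 then r else 0) i \<le> r * (j + 1) ^ k" using Suc[of i] by linarith
  qed
  also have "\<dots> = r * (j + 1) ^ Suc k" by (simp add: algebra_simps)
  finally show ?case .
qed

context finite_group
begin

text \<open>
  By induction on the index: every step of a chain of subgroups from \<open>H\<close> to \<open>P\<close>, each normal of index
  \<open>p\<close> in the next, costs one summation.
\<close>

lemma free_res_coind_p_group:
  fixes M :: "('g \<Rightarrow> 'f::field) set"
  assumes M: "left_ideal M" and p: "prime p" and P: "subgroup P G" "card P = p ^ a"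
    and H: "subgroup H G" "H \<subseteq> P" "card P = card H * p ^ k"
    and res: "\<And>t. free_res t b (coind M H)"
  shows "free_res t ((partial_sums ^^ k) b) (coind M P)"
  using H res
proof (induction k arbitrary: H b t)
  case 0
  then have "H = P"
    using finite_subset[OF subgroup.subset[OF P(1)] finite_carrier] by (intro card_subset_eq) auto
  then show ?case using 0 by simp
next
  case (Suc k)
  have p1: "p > 1" using p prime_gt_1_nat by blast
  have "card H \<noteq> 0" using Suc.prems(3) P(2) p1 by (metis mult_0 not_one_less_zero power_eq_0_iff)
  have "H \<noteq> P"
  proof
    assume "H = P"
    then have "p ^ Suc k = 1" using Suc.prems(3) \<open>card H \<noteq> 0\<close> by simp
    then show False using p1 by (metis nat.simps(3) nat_power_eq_Suc_0_iff One_nat_def less_numeral_extra(4))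
  qed
  obtain g K where K: "subgroup K G" "H \<subseteq> K" "K \<subseteq> P" "g \<in> K" "card K = card H * p"
    "\<And>h. h \<in> H \<Longrightarrow> inv g \<otimes> h \<otimes> g \<in> H" "g [^] p \<in> H"
    "\<And>k. k \<in> K \<Longrightarrow> \<exists>!i. i < p \<and> k \<otimes> g [^] (i::nat) \<in> H"
    using p_group_cyclic_step[OF p P Suc.prems(1,2) \<open>H \<noteq> P\<close>] by metis
  have "free_res t (partial_sums b) (coind M K)" for t
    unfolding partial_sums_def by (rule coind_cyclic_extension[OF M K(1) Suc.prems(1) K(2,4,6,7,8) Suc.prems(4)])
  moreover have "card P = card K * p ^ k" using Suc.prems(3) K(5) by simp
  ultimately have "free_res t ((partial_sums ^^ k) (partial_sums b)) (coind M P)"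
    using Suc.IH[OF K(1,3)] by blast
  then show ?case by (simp add: funpow_swap1)
qed

end


section \<open>Left-normed brackets\<close>

text \<open>
  The linear span of a set of functions, on words as well as on permutations.
\<close>

inductive_set lspan :: "('a \<Rightarrow> 'f::field) set \<Rightarrow> ('a \<Rightarrow> 'f) set" for S where
  lspan_zero: "0 \<in> lspan S"
| lspan_base: "s \<in> S \<Longrightarrow> s \<in> lspan S"
| lspan_add: "x \<in> lspan S \<Longrightarrow> y \<in> lspan S \<Longrightarrow> x + y \<in> lspan S"
| lspan_scale: "x \<in> lspan S \<Longrightarrow> (\<lambda>a. c * x a) \<in> lspan S"

lemma lspan_minus: "x \<in> lspan S \<Longrightarrow> - x \<in> lspan S"
  using lspan_scale[of x S "- 1"] by (simp add: fun_Compl_def)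

lemma lspan_diff: "x \<in> lspan S \<Longrightarrow> y \<in> lspan S \<Longrightarrow> x - y \<in> lspan S"
  using lspan_add[OF _ lspan_minus] by fastforce

lemma lspan_image:
  assumes T0: "T 0 = 0" and Tadd: "\<And>f g. T (f + g) = T f + T g" and Tsc: "\<And>c f. T (\<lambda>a. c * f a) = (\<lambda>b. c * T f b)"
    and S: "\<And>s. s \<in> S \<Longrightarrow> T s \<in> lspan S'" and x: "x \<in> lspan S"
  shows "T x \<in> lspan S'"
  using x by induction (simp_all add: T0 Tadd Tsc S lspan_zero lspan_add lspan_scale)

lemma lspan_mono: "S \<subseteq> lspan S' \<Longrightarrow> x \<in> lspan S \<Longrightarrow> x \<in> lspan S'"
  by (rule lspan_image[where T = "\<lambda>x. x" and S = S]) auto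

text \<open>
  Non-commutative polynomials in letters numbered by \<open>nat\<close> are represented by the function that
  assigns to a word its coefficient. Only products in which one factor is a letter are
  needed: \<open>rmul y f\<close> is \<open>f y\<close>, \<open>lmul y f\<close> is \<open>y f\<close>, and \<open>ad y f\<close> is the bracket \<open>[f, y]\<close>.
\<close>

definition rmul :: "nat \<Rightarrow> (nat list \<Rightarrow> 'f::field) \<Rightarrow> (nat list \<Rightarrow> 'f)" where
  "rmul y f = (\<lambda>w. if w \<noteq> [] \<and> last w = y then f (butlast w) else 0)"

definition lmul :: "nat \<Rightarrow> (nat list \<Rightarrow> 'f::field) \<Rightarrow> (nat list \<Rightarrow> 'f)" where
  "lmul y f = (\<lambda>w. if w \<noteq> [] \<and> hd w = y then f (tl w) else 0)"

definition ad :: "nat \<Rightarrow> (nat list \<Rightarrow> 'f::field) \<Rightarrow> (nat list \<Rightarrow> 'f)" where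
  "ad y f = rmul y f - lmul y f"

definition single :: "nat list \<Rightarrow> (nat list \<Rightarrow> 'f::field)" where
  "single w = (\<lambda>v. if v = w then 1 else 0)"

text \<open>
  \<open>iter_ad f [y, z, \<dots>]\<close> is \<open>[[[f, y], z], \<dots>]\<close>; the left-normed bracket of a word begins with its
  first letter.
\<close>

definition iter_ad :: "(nat list \<Rightarrow> 'f::field) \<Rightarrow> nat list \<Rightarrow> (nat list \<Rightarrow> 'f)" where
  "iter_ad f ys = foldl (\<lambda>f y. ad y f) f ys"

definition left_normed :: "nat list \<Rightarrow> (nat list \<Rightarrow> 'f::field)" where
  "left_normed w = iter_ad (single [hd w]) (tl w)"

lemma rmul_diff: "rmul y (f - g) = rmul y f - rmul y g"
  and lmul_diff: "lmul y (f - g) = lmul y f - lmul y g"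
  by (auto simp: rmul_def lmul_def fun_eq_iff pointwise)

lemma rmul_lmul: "lmul x (rmul y f) = rmul y (lmul x f)"
proof
  fix w
  show "lmul x (rmul y f) w = rmul y (lmul x f) w"
  proof (cases w)
    case (Cons a v)
    then show ?thesis by (cases v rule: rev_cases) (auto simp: lmul_def rmul_def)
  qed (simp add: lmul_def rmul_def)
qed

lemma ad_add: "ad y (f + g) = ad y f + ad y g"
  by (auto simp: ad_def rmul_def lmul_def fun_eq_iff pointwise)

lemma ad_scale: "ad y (\<lambda>w. c * f w) = (\<lambda>w. c * ad y f w)"
  by (auto simp: ad_def rmul_def lmul_def fun_eq_iff pointwise algebra_simps)

lemma ad_0: "ad y 0 = 0"
  by (auto simp: ad_def rmul_def lmul_def fun_eq_iff pointwise)

lemma iter_ad_snoc [simp]: "iter_ad f (ys @ [y]) = ad y (iter_ad f ys)"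
  by (simp add: iter_ad_def)

lemma iter_ad_append: "iter_ad f (ys @ zs) = iter_ad (iter_ad f ys) zs"
  by (simp add: iter_ad_def)

lemma iter_ad_Nil [simp]: "iter_ad f [] = f"
  by (simp add: iter_ad_def)

text \<open>
  Let \<open>b\<close> be the left-normed bracket of \<open>y # ys\<close>. The following operators are obtained by replacing
  each letter of \<open>b\<close> by the operator \<open>ad\<close>, \<open>rmul\<close> or \<open>lmul\<close> of this letter and taking commutators of
  operators. The order of the commutators is such that \<open>rmul_br\<close> and \<open>lmul_br\<close> are
  multiplication by \<open>b\<close> from the right and from the left.
\<close>

definition ad_br :: "nat \<Rightarrow> nat list \<Rightarrow> (nat list \<Rightarrow> 'f::field) \<Rightarrow> (nat list \<Rightarrow> 'f)" where
  "ad_br y ys = foldl (\<lambda>T z f. ad z (T f) - T (ad z f)) (ad y) ys"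

definition rmul_br :: "nat \<Rightarrow> nat list \<Rightarrow> (nat list \<Rightarrow> 'f::field) \<Rightarrow> (nat list \<Rightarrow> 'f)" where
  "rmul_br y ys = foldl (\<lambda>T z f. rmul z (T f) - T (rmul z f)) (rmul y) ys"

definition lmul_br :: "nat \<Rightarrow> nat list \<Rightarrow> (nat list \<Rightarrow> 'f::field) \<Rightarrow> (nat list \<Rightarrow> 'f)" where
  "lmul_br y ys = foldl (\<lambda>T z f. T (lmul z f) - lmul z (T f)) (lmul y) ys"

lemma bracket_ops_Nil [simp]: "ad_br y [] = ad y" "rmul_br y [] = rmul y" "lmul_br y [] = lmul y"
  by (simp_all add: ad_br_def rmul_br_def lmul_br_def)

lemma bracket_ops_snoc:
  "ad_br y (ys @ [z]) f = ad z (ad_br y ys f) - ad_br y ys (ad z f)"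
  "rmul_br y (ys @ [z]) f = rmul z (rmul_br y ys f) - rmul_br y ys (rmul z f)"
  "lmul_br y (ys @ [z]) f = lmul_br y ys (lmul z f) - lmul z (lmul_br y ys f)"
  by (simp_all add: ad_br_def rmul_br_def lmul_br_def)

lemma rmul_br_diff: "rmul_br y ys (f - g) = rmul_br y ys f - rmul_br y ys g"
  by (induction ys arbitrary: f g rule: rev_induct) (simp_all add: bracket_ops_snoc rmul_diff)

lemma lmul_br_diff: "lmul_br y ys (f - g) = lmul_br y ys f - lmul_br y ys g"
  by (induction ys arbitrary: f g rule: rev_induct) (simp_all add: bracket_ops_snoc lmul_diff)

lemma rmul_br_lmul: "rmul_br y ys (lmul z f) = lmul z (rmul_br y ys f)"
  by (induction ys arbitrary: f rule: rev_induct) (simp_all add: bracket_ops_snoc lmul_diff rmul_lmul[symmetric])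

lemma lmul_br_rmul: "lmul_br y ys (rmul z f) = rmul z (lmul_br y ys f)"
  by (induction ys arbitrary: f rule: rev_induct) (simp_all add: bracket_ops_snoc rmul_diff rmul_lmul)

text \<open>
  Bracketing with \<open>b\<close> is the iterated commutator of the operators \<open>ad\<close> of its letters. This is the
  Jacobi identity; it holds because left and right multiplications commute.
\<close>

lemma ad_br_eq: "ad_br y ys f = rmul_br y ys f - lmul_br y ys f"
proof (induction ys arbitrary: f rule: rev_induct)
  case Nil
  show ?case by (simp add: ad_def)
next
  case (snoc z ys)
  show ?case
    unfolding bracket_ops_snoc snoc.IH
    by (simp add: ad_def rmul_br_diff lmul_br_diff rmul_diff lmul_diff rmul_br_lmul lmul_br_rmul)
qed

lemma rmul_single_Nil: "rmul y (single []) = single [y]" "lmul y (single []) = single [y]"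
proof -
  show "rmul y (single []) = single [y]"
  proof
    fix w show "rmul y (single []) w = single [y] w"
      by (cases w rule: rev_cases) (auto simp: rmul_def single_def)
  qed
  show "lmul y (single []) = single [y]"
  proof
    fix w show "lmul y (single []) w = single [y] w"
      by (cases w) (auto simp: lmul_def single_def)
  qed
qed

lemma rmul_br_single_Nil: "rmul_br y ys (single []) = (left_normed (y # ys) :: nat list \<Rightarrow> 'f::field)"
  and lmul_br_single_Nil: "lmul_br y ys (single []) = (left_normed (y # ys) :: nat list \<Rightarrow> 'f::field)"
proof -
  show "rmul_br y ys (single []) = (left_normed (y # ys) :: nat list \<Rightarrow> 'f)"
  proof (induction ys rule: rev_induct)
    case (snoc z ys)
    have "rmul_br y ys (rmul z (single [])) = lmul z (rmul_br y ys (single []) :: nat list \<Rightarrow> 'f)"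
      unfolding rmul_single_Nil(1) rmul_single_Nil(2)[symmetric] by (rule rmul_br_lmul)
    then show ?case using snoc by (simp add: bracket_ops_snoc left_normed_def ad_def)
  qed (simp add: left_normed_def rmul_single_Nil)
  show "lmul_br y ys (single []) = (left_normed (y # ys) :: nat list \<Rightarrow> 'f)"
  proof (induction ys rule: rev_induct)
    case (snoc z ys)
    have "lmul_br y ys (lmul z (single [])) = rmul z (lmul_br y ys (single []) :: nat list \<Rightarrow> 'f)"
      unfolding rmul_single_Nil(2) rmul_single_Nil(1)[symmetric] by (rule lmul_br_rmul)
    then show ?case using snoc by (simp add: bracket_ops_snoc left_normed_def ad_def)
  qed (simp add: left_normed_def rmul_single_Nil)
qed

text \<open>
  \<open>[b, x] = - [x, b]\<close>, where \<open>b\<close> is the left-normed bracket of \<open>y # ys\<close>.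
\<close>

lemma left_normed_antisym: "left_normed (y # ys @ [x]) = - (ad_br y ys (single [x]) :: nat list \<Rightarrow> 'f::field)"
proof -
  have "rmul_br y ys (single [x]) = (lmul x (left_normed (y # ys)) :: nat list \<Rightarrow> 'f)"
    unfolding rmul_single_Nil(2)[symmetric] rmul_br_lmul rmul_br_single_Nil ..
  moreover have "lmul_br y ys (single [x]) = (rmul x (left_normed (y # ys)) :: nat list \<Rightarrow> 'f)"
    unfolding rmul_single_Nil(1)[symmetric] lmul_br_rmul lmul_br_single_Nil ..
  ultimately have "ad_br y ys (single [x]) = lmul x (left_normed (y # ys)) - (rmul x (left_normed (y # ys)) :: nat list \<Rightarrow> 'f)"
    by (simp add: ad_br_eq)
  also have "\<dots> = - left_normed (y # ys @ [x])" by (simp add: left_normed_def ad_def)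
  finally show ?thesis by simp
qed

text \<open>
  Expanding the commutators of \<open>ad_br\<close> produces the operators \<open>ad\<close> of the letters in various orders.
\<close>

lemma ad_br_in_lspan:
  "ad_br y ys (iter_ad f us) \<in> lspan {iter_ad f (us @ w) | w. mset w = mset (y # ys)}"
proof (induction ys arbitrary: us rule: rev_induct)
  case Nil
  have "ad y (iter_ad f us) = iter_ad f (us @ [y])" by simp
  then show ?case by (auto intro!: lspan_base exI[of _ "[y]"])
next
  case (snoc z ys)
  let ?S = "{iter_ad f (us @ w) | w. mset w = mset (y # ys @ [z])}"
  have "ad z (ad_br y ys (iter_ad f us)) \<in> lspan ?S"
  proof (rule lspan_image[where T = "ad z", OF ad_0 ad_add ad_scale _ snoc.IH])
    fix s assume "s \<in> {iter_ad f (us @ w) | w. mset w = mset (y # ys)}"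
    then obtain w where w: "s = iter_ad f (us @ w)" "mset w = mset (y # ys)" by blast
    then have "ad z s = iter_ad f (us @ (w @ [z]))" using iter_ad_snoc[of f "us @ w" z] by simp
    then show "ad z s \<in> lspan ?S" using w(2) by (intro lspan_base CollectI exI[of _ "w @ [z]"]) simp
  qed
  moreover have "ad_br y ys (ad z (iter_ad f us)) \<in> lspan ?S"
  proof (rule lspan_mono[OF _ snoc.IH[of "us @ [z]", unfolded iter_ad_snoc]])
    show "{iter_ad f ((us @ [z]) @ w) | w. mset w = mset (y # ys)} \<subseteq> lspan ?S"
    proof
      fix s assume "s \<in> {iter_ad f ((us @ [z]) @ w) | w. mset w = mset (y # ys)}"
      then obtain w where w: "s = iter_ad f (us @ (z # w))" "mset w = mset (y # ys)" by auto
      then show "s \<in> lspan ?S" by (intro lspan_base CollectI exI[of _ "z # w"]) simp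
    qed
  qed
  ultimately show ?case unfolding bracket_ops_snoc(1) by (simp add: lspan_diff)
qed

text \<open>
  If \<open>z\<close> is not the first letter, then \<open>ws = ys @ z # zs\<close> with \<open>ys\<close> nonempty, and the bracket up to
  \<open>z\<close> is \<open>[b, z] = - [z, b]\<close> with \<open>b\<close> the bracket of \<open>ys\<close>. It is a combination of left-normed
  brackets that begin with \<open>z\<close>, and bracketing with the letters of \<open>zs\<close> preserves this.
\<close>

lemma left_normed_in_lspan:
  assumes "z \<in> set ws"
  shows "(left_normed ws :: nat list \<Rightarrow> 'f::field) \<in> lspan {left_normed (z # v) | v. mset (z # v) = mset ws}"
proof -
  obtain ys zs where ws: "ws = ys @ z # zs" using assms by (meson split_list)
  show ?thesis
  proof (cases ys)
    case Nil
    then show ?thesis using ws by (intro lspan_base) auto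
  next
    case (Cons y ys')
    let ?S = "{left_normed (z # v) :: nat list \<Rightarrow> 'f | v. mset (z # v) = mset ws}"
    have "(left_normed (y # ys' @ [z]) :: nat list \<Rightarrow> 'f) \<in> lspan {iter_ad (single [z]) w | w. mset w = mset (y # ys')}"
      using lspan_minus[OF ad_br_in_lspan[of y ys' "single [z]" "[]"]] by (simp add: left_normed_antisym)
    moreover have "iter_ad x us \<in> lspan {iter_ad (single [z]) (w @ us) | w. mset w = mset (y # ys')}"
      if "x \<in> lspan {iter_ad (single [z]) w | w. mset w = mset (y # ys')}" for x :: "nat list \<Rightarrow> 'f" and us
    proof (induction us rule: rev_induct)
      case Nil
      show ?case using that by simp
    next
      case (snoc u us)
      have "ad u (iter_ad x us) \<in> lspan {iter_ad (single [z]) (w @ us @ [u]) | w. mset w = mset (y # ys')}"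
      proof (rule lspan_image[where T = "ad u", OF ad_0 ad_add ad_scale _ snoc.IH])
        fix s :: "nat list \<Rightarrow> 'f" assume "s \<in> {iter_ad (single [z]) (w @ us) | w. mset w = mset (y # ys')}"
        then obtain w where w: "s = iter_ad (single [z]) (w @ us)" "mset w = mset (y # ys')" by blast
        then have "ad u s = iter_ad (single [z]) (w @ us @ [u])"
          using iter_ad_snoc[of "single [z] :: nat list \<Rightarrow> 'f" "w @ us" u] by simp
        then show "ad u s \<in> lspan {iter_ad (single [z]) (w @ us @ [u]) | w. mset w = mset (y # ys')}"
          using w(2) by (intro lspan_base CollectI exI[of _ w]) simp
      qed
      then show ?case by simp
    qed
    ultimately have "(iter_ad (left_normed (y # ys' @ [z])) zs :: nat list \<Rightarrow> 'f) \<in> lspan {iter_ad (single [z]) (w @ zs) | w. mset w = mset (y # ys')}"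
      by blast
    moreover have "iter_ad (left_normed (y # ys' @ [z])) zs = (left_normed ws :: nat list \<Rightarrow> 'f)"
    proof -
      have "left_normed ws = (iter_ad (single [y]) ((ys' @ [z]) @ zs) :: nat list \<Rightarrow> 'f)"
        using ws Cons by (simp add: left_normed_def)
      also have "\<dots> = iter_ad (left_normed (y # ys' @ [z])) zs"
        unfolding iter_ad_append[of _ "ys' @ [z]" zs] by (simp add: left_normed_def)
      finally show ?thesis ..
    qed
    ultimately have "(left_normed ws :: nat list \<Rightarrow> 'f) \<in> lspan {iter_ad (single [z]) (w @ zs) | w. mset w = mset (y # ys')}" by simp
    moreover have "{iter_ad (single [z]) (w @ zs) | w. mset w = mset (y # ys')} \<subseteq> lspan ?S"
    proof
      fix s :: "nat list \<Rightarrow> 'f" assume "s \<in> {iter_ad (single [z]) (w @ zs) | w. mset w = mset (y # ys')}"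
      then obtain w where w: "s = iter_ad (single [z]) (w @ zs)" "mset w = mset (y # ys')" by blast
      then show "s \<in> lspan ?S"
        using ws Cons by (intro lspan_base CollectI exI[of _ "w @ zs"]) (simp add: left_normed_def)
    qed
    ultimately show ?thesis by (meson lspan_mono)
  qed
qed

text \<open>
  Each further bracket \<open>[f, y] = f y - y f\<close> keeps \<open>z\<close> in front in the term \<open>f y\<close> only.
\<close>

lemma left_normed_leading_coeff:
  assumes "z \<notin> set us"
  shows "left_normed (z # us) (z # v) = (if v = us then 1 else (0 :: 'f::field))"
  using assms
proof (induction us arbitrary: v rule: rev_induct)
  case Nil
  show ?case by (simp add: left_normed_def single_def)
next
  case (snoc y us)
  have "left_normed (z # us @ [y]) (z # v) = rmul y (left_normed (z # us)) (z # v) - (lmul y (left_normed (z # us)) (z # v) :: 'f)"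
    by (simp add: left_normed_def ad_def pointwise)
  also have "lmul y (left_normed (z # us)) (z # v) = (0 :: 'f)" using snoc.prems by (auto simp: lmul_def)
  also have "rmul y (left_normed (z # us)) (z # v) = (if v = us @ [y] then 1 else (0 :: 'f))"
  proof (cases v rule: rev_cases)
    case Nil
    then show ?thesis using snoc.prems by (simp add: rmul_def)
  next
    case (snoc v' y')
    then show ?thesis using snoc.IH[of v'] snoc.prems by (auto simp: rmul_def butlast_append)
  qed
  finally show ?case by simp
qed

section \<open>The Lie module and its restriction to point stabilisers\<close>

lemma finite_group_sym: "finite_group (sym_group n)"
  by (intro finite_group.intro finite_group_axioms.intro sym_group_is_group finite_sym_group)

text \<open>
  The word \<open>\<sigma> 1, \<sigma> 2, \<dots>, \<sigma> n\<close>. It identifies the group algebra with the multilinear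
  polynomials.
\<close>

definition word :: "nat \<Rightarrow> (nat \<Rightarrow> nat) \<Rightarrow> nat list" where
  "word n \<sigma> = map \<sigma> [1..<Suc n]"

lemma group_algebra_mult_translate:
  assumes "finite_group G"
  shows "(a \<otimes>\<^bsub>group_algebra G\<^esub> b) = (\<lambda>x. \<Sum>h\<in>carrier G. a h * finite_group.translate G h b x)"
  by (auto simp: group_algebra_def finite_group.translate_def[OF assms] fun_eq_iff)

lemma group_elem_mult_translate:
  assumes G: "finite_group G" and h: "h \<in> carrier G"
  shows "group_elem h \<otimes>\<^bsub>group_algebra G\<^esub> b = finite_group.translate G h b"
proof
  interpret finite_group G by fact
  fix x
  have "(\<Sum>k\<in>carrier G. group_elem h k * translate k b x) = (\<Sum>k\<in>carrier G. if k = h then translate h b x else 0)"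
    by (rule sum.cong[OF refl]) (simp add: group_elem_def)
  then show "(group_elem h \<otimes>\<^bsub>group_algebra G\<^esub> b) x = translate h b x"
    using h finite_carrier by (simp add: group_algebra_mult_translate[OF G])
qed

text \<open>
  Right multiplication by a permutation permutes the positions of the letters of a word.
\<close>

lemma mult_one_minus_group_elem:
  fixes a :: "(nat \<Rightarrow> nat) \<Rightarrow> 'f::field" and n :: nat
  defines "A \<equiv> group_algebra (sym_group n)"
  assumes a: "a \<in> carrier A" and d: "d permutes {1..n}" and \<tau>: "\<tau> permutes {1..n}"
  shows "(a \<otimes>\<^bsub>A\<^esub> (\<one>\<^bsub>A\<^esub> \<ominus>\<^bsub>A\<^esub> group_elem d)) \<tau> = a \<tau> - a (\<tau> \<circ> inv' d)"
proof -
  interpret A: ring A unfolding A_def by (rule group_algebra_ring[OF sym_group_is_group finite_sym_group])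
  have gd: "group_elem d \<in> carrier A"
    unfolding A_def by (rule group_elem_closed) (use d in \<open>simp add: sym_group_carrier\<close>)
  have ev: "(x \<oplus>\<^bsub>A\<^esub> y) \<tau> = x \<tau> + y \<tau>" for x y by (simp add: A_def group_algebra_def)
  have neg: "(\<ominus>\<^bsub>A\<^esub> x) \<tau> = - x \<tau>" if "x \<in> carrier A" for x
  proof -
    have "(x \<oplus>\<^bsub>A\<^esub> \<ominus>\<^bsub>A\<^esub> x) \<tau> = 0" using A.r_neg[OF that] by (simp add: A_def group_algebra_def)
    then show ?thesis using ev by (metis add.commute add_eq_0_iff)
  qed
  have "a \<otimes>\<^bsub>A\<^esub> (\<one>\<^bsub>A\<^esub> \<ominus>\<^bsub>A\<^esub> group_elem d) = a \<ominus>\<^bsub>A\<^esub> a \<otimes>\<^bsub>A\<^esub> group_elem d"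
    using a gd by (simp add: A.minus_eq A.r_distr A.r_minus)
  then have "(a \<otimes>\<^bsub>A\<^esub> (\<one>\<^bsub>A\<^esub> \<ominus>\<^bsub>A\<^esub> group_elem d)) \<tau> = a \<tau> - (a \<otimes>\<^bsub>A\<^esub> group_elem d) \<tau>"
    using a gd ev neg by (simp add: A.minus_eq)
  also have "(a \<otimes>\<^bsub>A\<^esub> group_elem d) \<tau> = a (\<tau> \<circ> inv' d)"
  proof -
    have "(a \<otimes>\<^bsub>A\<^esub> group_elem d) \<tau>
        = (\<Sum>h\<in>carrier (sym_group n). a h * group_elem d (inv' h \<circ> \<tau>))"
      using \<tau> by (simp add: A_def group_algebra_def sym_group_carrier sym_group_mult)
    also have "\<dots> = (\<Sum>h\<in>carrier (sym_group n). if h = \<tau> \<circ> inv' d then a (\<tau> \<circ> inv' d) else 0)"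
    proof (rule sum.cong[OF refl])
      fix h assume "h \<in> carrier (sym_group n)"
      then have h: "h permutes {1..n}" by (simp add: sym_group_carrier)
      have "inv' h \<circ> \<tau> = d \<longleftrightarrow> h = \<tau> \<circ> inv' d"
      proof
        assume "inv' h \<circ> \<tau> = d"
        then have "h \<circ> d = \<tau>" using permutes_inv_o(1)[OF h] by (metis comp_assoc id_comp)
        then show "h = \<tau> \<circ> inv' d" using permutes_inv_o(1)[OF d] by (metis comp_assoc comp_id)
      next
        assume "h = \<tau> \<circ> inv' d"
        then have "h \<circ> d = \<tau>" using permutes_inv_o(2)[OF d] by (metis comp_assoc comp_id)
        then show "inv' h \<circ> \<tau> = d" using permutes_inv_o(2)[OF h] by (metis comp_assoc id_comp)
      qed
      then show "a h * group_elem d (inv' h \<circ> \<tau>) = (if h = \<tau> \<circ> inv' d then a (\<tau> \<circ> inv' d) else 0)"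
        by (auto simp: group_elem_def)
    qed
    also have "\<dots> = a (\<tau> \<circ> inv' d)"
      using finite_sym_group permutes_compose[OF permutes_inv[OF d] \<tau>] by (simp add: sym_group_carrier)
    finally show ?thesis .
  qed
  finally show ?thesis .
qed

lemma foldl_eq_mult_foldr:
  assumes "ring A" "a \<in> carrier A" "\<And>i. i \<in> set xs \<Longrightarrow> y i \<in> carrier A"
  shows "foldl (\<lambda>a i. a \<otimes>\<^bsub>A\<^esub> y i) a xs = a \<otimes>\<^bsub>A\<^esub> foldr (\<lambda>i b. y i \<otimes>\<^bsub>A\<^esub> b) xs \<one>\<^bsub>A\<^esub>"
proof -
  interpret ring A by fact
  have cl: "foldr (\<lambda>i b. y i \<otimes>\<^bsub>A\<^esub> b) xs \<one>\<^bsub>A\<^esub> \<in> carrier A" if "\<And>i. i \<in> set xs \<Longrightarrow> y i \<in> carrier A" for xs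
    using that by (induction xs) auto
  show ?thesis using assms(2,3)
  proof (induction xs arbitrary: a)
    case (Cons i xs)
    then show ?case using cl[of xs] by (simp add: m_assoc)
  qed simp
qed

lemma inv_descending_cycle:
  assumes "1 \<le> i"
  shows "inv' (descending_cycle i) k = (if k = i then 1 else if 1 \<le> k \<and> k < i then k + 1 else k)"
proof -
  have d: "descending_cycle i permutes {1..i}"
    using descending_cycle_in_sym_group[OF assms order_refl] by (simp add: sym_group_carrier)
  let ?j = "if k = i then 1 else if 1 \<le> k \<and> k < i then k + 1 else k"
  have "descending_cycle i ?j = k"
    using assms by (auto simp: descending_cycle_apply)
  then show ?thesis using permutes_inv_eq[OF d] by simp
qed

text \<open>
  The element \<open>\<sigma> \<omega>\<close> is the left-normed bracket of the word of \<open>\<sigma>\<close>. Right multiplication by the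
  descending cycle of length \<open>j + 1\<close> moves the letter in position \<open>j + 1\<close> to the front, so the factor
  \<open>1 - d\<close> with this cycle \<open>d\<close> brackets the polynomial built from the first \<open>j\<close> letters with that
  letter, while the letters behind it stay in place.
\<close>

lemma translate_lie_omega:
  assumes \<sigma>: "\<sigma> permutes {1..n}" and n: "n \<ge> 1"
  shows "finite_group.translate (sym_group n) \<sigma> (lie_omega n :: (nat \<Rightarrow> nat) \<Rightarrow> 'f::field)
    = (\<lambda>\<tau>. if \<tau> permutes {1..n} then left_normed (word n \<sigma>) (word n \<tau>) else 0)"
proof -
  let ?A = "group_algebra (sym_group n) :: ((nat \<Rightarrow> nat) \<Rightarrow> 'f) ring"
  let ?y = "\<lambda>i. \<one>\<^bsub>?A\<^esub> \<ominus>\<^bsub>?A\<^esub> group_elem (descending_cycle i)"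
  interpret A: ring ?A by (rule group_algebra_ring[OF sym_group_is_group finite_sym_group])
  have \<sigma>c: "\<sigma> \<in> carrier (sym_group n)" using \<sigma> by (simp add: sym_group_carrier)
  have gc: "group_elem \<sigma> \<in> carrier ?A" by (rule group_elem_closed[OF \<sigma>c])
  have yc: "?y i \<in> carrier ?A" if "1 \<le> i" "i \<le> n" for i
    using group_elem_closed[OF descending_cycle_in_sym_group[OF that]] by (intro A.minus_closed A.one_closed)
  define F where "F = (\<lambda>j. foldl (\<lambda>a i. a \<otimes>\<^bsub>?A\<^esub> ?y i) (group_elem \<sigma>) [2..<Suc j])"
  have F_Suc: "F (Suc j) = F j \<otimes>\<^bsub>?A\<^esub> ?y (Suc j)" if "1 \<le> j" for j
    using that by (simp add: F_def)
  have Fc: "F j \<in> carrier ?A" if "1 \<le> j" "j \<le> n" for j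
    using that
  proof (induction j rule: nat_induct_at_least)
    case base
    show ?case using gc by (simp add: F_def)
  next
    case (Suc j)
    then show ?case using F_Suc[of j] yc[of "Suc j"] by simp
  qed
  have main: "F j \<tau> = (if \<forall>i. j < i \<and> i \<le> n \<longrightarrow> \<tau> i = \<sigma> i then left_normed (word j \<sigma>) (word j \<tau>) else 0)"
    if j: "1 \<le> j" "j \<le> n" and \<tau>: "\<tau> permutes {1..n}" for j \<tau>
    using j \<tau>
  proof (induction j arbitrary: \<tau> rule: nat_induct_at_least)
    case base
    have "\<tau> = \<sigma> \<longleftrightarrow> (\<forall>i. 1 < i \<and> i \<le> n \<longrightarrow> \<tau> i = \<sigma> i) \<and> \<tau> 1 = \<sigma> 1"
    proof
      assume h: "(\<forall>i. 1 < i \<and> i \<le> n \<longrightarrow> \<tau> i = \<sigma> i) \<and> \<tau> 1 = \<sigma> 1"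
      show "\<tau> = \<sigma>"
      proof
        fix i
        show "\<tau> i = \<sigma> i"
        proof (cases "i \<in> {1..n}")
          case True
          then show ?thesis using h by (cases "i = 1") auto
        next
          case False
          then show ?thesis using permutes_not_in[OF \<sigma>] permutes_not_in[OF base.prems(2)] by simp
        qed
      qed
    qed simp
    then show ?case by (auto simp: F_def group_elem_def word_def left_normed_def single_def)
  next
    case (Suc j)
    let ?d = "descending_cycle (Suc j)"
    let ?\<tau>' = "\<tau> \<circ> inv' ?d"
    have d: "?d permutes {1..n}"
      using descending_cycle_in_sym_group[of "Suc j" n] Suc.prems by (simp add: sym_group_carrier)
    have \<tau>': "?\<tau>' permutes {1..n}" by (rule permutes_compose[OF permutes_inv[OF d] Suc.prems(2)])
    have inv_d: "inv' ?d i = (if i = Suc j then 1 else if 1 \<le> i \<and> i < Suc j then i + 1 else i)" for i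
      by (rule inv_descending_cycle) simp
    have w\<tau>': "word j ?\<tau>' = map \<tau> [2..<j + 2]"
      unfolding word_def by (rule nth_equalityI) (auto simp: inv_d simp del: upt_Suc)
    have tail': "(\<forall>i. j < i \<and> i \<le> n \<longrightarrow> ?\<tau>' i = \<sigma> i) \<longleftrightarrow>
        \<tau> 1 = \<sigma> (Suc j) \<and> (\<forall>i. Suc j < i \<and> i \<le> n \<longrightarrow> \<tau> i = \<sigma> i)"
      using Suc.prems by (auto simp: inv_d)
    have tail: "(\<forall>i. j < i \<and> i \<le> n \<longrightarrow> \<tau> i = \<sigma> i) \<longleftrightarrow>
        \<tau> (Suc j) = \<sigma> (Suc j) \<and> (\<forall>i. Suc j < i \<and> i \<le> n \<longrightarrow> \<tau> i = \<sigma> i)"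
      using Suc.prems by auto (metis Suc_lessI)
    have w\<sigma>: "word (Suc j) \<sigma> = word j \<sigma> @ [\<sigma> (Suc j)]" by (simp add: word_def)
    have w\<tau>: "word (Suc j) \<tau> = word j \<tau> @ [\<tau> (Suc j)]" "word (Suc j) \<tau> = \<tau> 1 # map \<tau> [2..<j + 2]"
      by (simp add: word_def) (simp add: word_def upt_conv_Cons numeral_2_eq_2 del: upt_Suc)
    have wne: "word j \<sigma> = hd (word j \<sigma>) # tl (word j \<sigma>)" using Suc.hyps by (simp add: word_def)
    have "left_normed (word (Suc j) \<sigma>) = ad (\<sigma> (Suc j)) (left_normed (word j \<sigma>) :: nat list \<Rightarrow> 'f)"
      unfolding w\<sigma> by (subst (1 2) wne) (simp add: left_normed_def)
    then have br_eq: "left_normed (word (Suc j) \<sigma>) (word (Suc j) \<tau>) =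
        (if \<tau> (Suc j) = \<sigma> (Suc j) then left_normed (word j \<sigma>) (word j \<tau>) else 0) -
        (if \<tau> 1 = \<sigma> (Suc j) then left_normed (word j \<sigma>) (map \<tau> [2..<j + 2]) else (0::'f))"
    proof -
      have "rmul (\<sigma> (Suc j)) (left_normed (word j \<sigma>)) (word (Suc j) \<tau>) =
          (if \<tau> (Suc j) = \<sigma> (Suc j) then left_normed (word j \<sigma>) (word j \<tau>) else (0::'f))"
        unfolding w\<tau>(1) by (simp add: rmul_def)
      moreover have "lmul (\<sigma> (Suc j)) (left_normed (word j \<sigma>)) (word (Suc j) \<tau>) =
          (if \<tau> 1 = \<sigma> (Suc j) then left_normed (word j \<sigma>) (map \<tau> [2..<j + 2]) else (0::'f))"
        unfolding w\<tau>(2) by (simp add: lmul_def)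
      ultimately show ?thesis
        using \<open>left_normed (word (Suc j) \<sigma>) = _\<close> by (simp add: ad_def pointwise)
    qed
    have "F (Suc j) \<tau> = F j \<tau> - F j ?\<tau>'"
      unfolding F_Suc[OF Suc.hyps]
      by (rule mult_one_minus_group_elem[OF Fc[OF Suc.hyps] d Suc.prems(2)]) (use Suc.prems in simp)
    also have "\<dots> = (if \<forall>i. Suc j < i \<and> i \<le> n \<longrightarrow> \<tau> i = \<sigma> i then left_normed (word (Suc j) \<sigma>) (word (Suc j) \<tau>) else 0)"
      unfolding Suc.IH[OF Suc_leD[OF Suc.prems(1)] Suc.prems(2)] Suc.IH[OF Suc_leD[OF Suc.prems(1)] \<tau>']
        tail tail' w\<tau>' br_eq by (auto simp del: upt_Suc)
    finally show ?case .
  qed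
  have "finite_group.translate (sym_group n) \<sigma> (lie_omega n) = group_elem \<sigma> \<otimes>\<^bsub>?A\<^esub> lie_omega n"
    by (rule group_elem_mult_translate[OF finite_group_sym \<sigma>c, symmetric])
  also have "\<dots> = F n"
    unfolding F_def lie_omega_def Let_def
    by (rule foldl_eq_mult_foldr[symmetric, OF A.ring_axioms gc]) (use yc in auto)
  finally have eq: "finite_group.translate (sym_group n) \<sigma> (lie_omega n) = F n" .
  show ?thesis
  proof
    fix \<tau>
    show "finite_group.translate (sym_group n) \<sigma> (lie_omega n) \<tau>
        = (if \<tau> permutes {1..n} then left_normed (word n \<sigma>) (word n \<tau>) else (0::'f))"
    proof (cases "\<tau> permutes {1..n}")
      case True
      then show ?thesis using main[OF n order_refl True] eq by auto
    next
      case False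
      then show ?thesis by (simp add: finite_group.translate_def[OF finite_group_sym] sym_group_carrier)
    qed
  qed
qed


lemma word_permutation:
  assumes \<sigma>: "\<sigma> permutes {1..n}"
  shows "set (word n \<sigma>) = {1..n}" "distinct (word n \<sigma>)"
proof -
  have e: "set [1..<Suc n] = {1..n}" by auto
  show "set (word n \<sigma>) = {1..n}"
    unfolding word_def set_map e by (rule permutes_image[OF \<sigma>])
  show "distinct (word n \<sigma>)"
    unfolding word_def distinct_map using permutes_inj_on[OF \<sigma>] by (simp del: upt_Suc)
qed

lemma word_inject:
  assumes "\<sigma> permutes {1..n}" "\<tau> permutes {1..n}" "word n \<sigma> = word n \<tau>"
  shows "\<sigma> = \<tau>"
proof
  fix i
  show "\<sigma> i = \<tau> i"
  proof (cases "i \<in> {1..n}")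
    case True
    then have "i \<in> set [1..<Suc n]" by auto
    then show ?thesis using assms(3) by (simp add: word_def del: upt_Suc)
  qed (simp add: permutes_not_in[OF assms(1)] permutes_not_in[OF assms(2)])
qed

lemma word_surj:
  assumes "set w = {1..n}" "distinct w"
  obtains \<sigma> where "\<sigma> permutes {1..n}" "word n \<sigma> = w"
proof
  let ?\<sigma> = "\<lambda>i. if i \<in> {1..n} then w ! (i - 1) else i"
  have len: "length w = n" using assms distinct_card by fastforce
  have inj: "inj_on ?\<sigma> {1..n}"
    by (rule inj_onI) (use assms(2) len in \<open>auto simp: nth_eq_iff_index_eq\<close>)
  have sub: "?\<sigma> ` {1..n} \<subseteq> {1..n}"
  proof
    fix j assume "j \<in> ?\<sigma> ` {1..n}"
    then obtain i where "i \<in> {1..n}" "j = w ! (i - 1)" by auto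
    then show "j \<in> {1..n}" using len assms(1) nth_mem[of "i - 1" w] by auto
  qed
  have "bij_betw ?\<sigma> {1..n} {1..n}"
    by (rule bij_betw_imageI[OF inj endo_inj_surj[OF finite_atLeastAtMost sub inj]])
  then show "?\<sigma> permutes {1..n}" by (rule bij_imp_permutes) auto
  show "word n ?\<sigma> = w"
    unfolding word_def using len by (intro nth_equalityI) (auto simp del: upt_Suc)
qed

lemma word_Cons: "n \<ge> 1 \<Longrightarrow> word n \<sigma> = \<sigma> 1 # map \<sigma> [2..<Suc n]"
  unfolding word_def by (simp add: upt_conv_Cons numeral_2_eq_2 del: upt_Suc)

lemma translate_lie_omega_coeff:
  assumes "\<sigma> permutes {1..n}" "\<tau> permutes {1..n}" "n \<ge> 1" "\<sigma> 1 = \<tau> 1"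
  shows "finite_group.translate (sym_group n) \<sigma> (lie_omega n) \<tau> = (if \<sigma> = \<tau> then 1 else (0 :: 'f::field))"
proof -
  have "\<sigma> 1 \<notin> set (map \<sigma> [2..<Suc n])"
    using word_permutation(2)[OF assms(1)] word_Cons[OF assms(3), of \<sigma>] by (metis distinct.simps(2))
  then have "left_normed (word n \<sigma>) (word n \<tau>) = (if map \<tau> [2..<Suc n] = map \<sigma> [2..<Suc n] then 1 else (0 :: 'f))"
    using left_normed_leading_coeff[of "\<sigma> 1" "map \<sigma> [2..<Suc n]" "map \<tau> [2..<Suc n]"] assms(4)
    unfolding word_Cons[OF assms(3)] by simp
  also have "map \<tau> [2..<Suc n] = map \<sigma> [2..<Suc n] \<longleftrightarrow> \<sigma> = \<tau>"
    using word_inject[OF assms(1,2)] assms(4) unfolding word_Cons[OF assms(3)] by auto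
  finally show ?thesis
    using translate_lie_omega[OF assms(1,3), where 'f='f] assms(2) by simp
qed

definition lie_basis :: "nat \<Rightarrow> nat \<Rightarrow> ((nat \<Rightarrow> nat) \<Rightarrow> 'f::field) set" where
  "lie_basis n z = {finite_group.translate (sym_group n) \<rho> (lie_omega n) | \<rho>. \<rho> permutes {1..n} \<and> \<rho> 1 = z}"

lemma translate_lie_omega_in_lspan:
  assumes \<sigma>: "\<sigma> permutes {1..n}" and z: "z \<in> {1..n}"
  shows "finite_group.translate (sym_group n) \<sigma> (lie_omega n) \<in> lspan (lie_basis n z :: ((nat \<Rightarrow> nat) \<Rightarrow> 'f::field) set)"
proof -
  have n: "n \<ge> 1" using z by auto
  \<comment> \<open>from polynomials to the group algebra: evaluation at the words of permutations\<close>
  define T :: "(nat list \<Rightarrow> 'f) \<Rightarrow> ((nat \<Rightarrow> nat) \<Rightarrow> 'f)"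
    where "T = (\<lambda>f \<tau>. if \<tau> permutes {1..n} then f (word n \<tau>) else 0)"
  have T_br: "T (left_normed (word n \<rho>)) = finite_group.translate (sym_group n) \<rho> (lie_omega n)" if "\<rho> permutes {1..n}" for \<rho>
    unfolding T_def using translate_lie_omega[OF that n, where 'f='f] by simp
  have "T (left_normed (word n \<sigma>)) \<in> lspan (lie_basis n z)"
  proof (rule lspan_image[where T = T])
    show "T 0 = 0" by (simp add: T_def fun_eq_iff pointwise)
    show "T (f + g) = T f + T g" for f g by (simp add: T_def fun_eq_iff pointwise)
    show "T (\<lambda>a. c * f a) = (\<lambda>b. c * T f b)" for c f by (simp add: T_def fun_eq_iff)
    show "left_normed (word n \<sigma>) \<in> lspan {left_normed (z # v) | v. mset (z # v) = mset (word n \<sigma>)}"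
      by (rule left_normed_in_lspan) (use z word_permutation[OF \<sigma>] in simp)
    fix s :: "nat list \<Rightarrow> 'f" assume "s \<in> {left_normed (z # v) | v. mset (z # v) = mset (word n \<sigma>)}"
    then obtain v where v: "s = left_normed (z # v)" "mset (z # v) = mset (word n \<sigma>)" by blast
    have "set (z # v) = {1..n}" "distinct (z # v)"
      using mset_eq_setD[OF v(2)] mset_eq_imp_distinct_iff[OF v(2)] word_permutation[OF \<sigma>] by auto
    then obtain \<rho> where \<rho>: "\<rho> permutes {1..n}" "word n \<rho> = z # v" by (rule word_surj)
    then have "\<rho> 1 = z" using word_Cons[OF n, of \<rho>] by simp
    then show "T s \<in> lspan (lie_basis n z)"
      using \<rho> T_br[OF \<rho>(1)] v(1) unfolding lie_basis_def by (intro lspan_base) auto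
  qed
  then show ?thesis using T_br[OF \<sigma>] by simp
qed

lemma Lie_carrier: "carrier (Lie n) = {r \<otimes>\<^bsub>group_algebra (sym_group n)\<^esub> lie_omega n | r. r \<in> carrier (group_algebra (sym_group n))}"
  by (simp add: Lie_def principal_left_ideal_def)

lemma left_ideal_principal:
  fixes b :: "'g \<Rightarrow> 'f::field"
  assumes G: "finite_group G" and b: "b \<in> carrier (group_algebra G)"
  shows "finite_group.left_ideal G {r \<otimes>\<^bsub>group_algebra G\<^esub> b | r. r \<in> carrier (group_algebra G)}"
proof -
  interpret finite_group G by fact
  let ?A = "group_algebra G :: ('g \<Rightarrow> 'f) ring"
  interpret A: ring ?A by (rule group_algebra_ring[OF is_group finite_carrier])
  have add: "x \<oplus>\<^bsub>?A\<^esub> y = x + y" for x y by (simp add: group_algebra_def fun_eq_iff pointwise)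
  have zero: "\<zero>\<^bsub>?A\<^esub> = 0" by (simp add: group_algebra_def fun_eq_iff pointwise)
  show ?thesis unfolding left_ideal_def
  proof (intro conjI ballI allI impI)
    fix m x assume m: "m \<in> {r \<otimes>\<^bsub>?A\<^esub> b | r. r \<in> carrier ?A}" and x: "x \<notin> carrier G"
    then show "m x = 0" by (auto simp: group_algebra_def)
  next
    have "0 = \<zero>\<^bsub>?A\<^esub> \<otimes>\<^bsub>?A\<^esub> b" using A.l_null[OF b] zero by metis
    then show "0 \<in> {r \<otimes>\<^bsub>?A\<^esub> b | r. r \<in> carrier ?A}" by blast
  next
    fix m m' assume "m \<in> {r \<otimes>\<^bsub>?A\<^esub> b | r. r \<in> carrier ?A}" "m' \<in> {r \<otimes>\<^bsub>?A\<^esub> b | r. r \<in> carrier ?A}"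
    then obtain r r' where r: "m = r \<otimes>\<^bsub>?A\<^esub> b" "m' = r' \<otimes>\<^bsub>?A\<^esub> b" "r \<in> carrier ?A" "r' \<in> carrier ?A" by blast
    have "m + m' = (r \<oplus>\<^bsub>?A\<^esub> r') \<otimes>\<^bsub>?A\<^esub> b" using r b by (simp add: A.l_distr add[symmetric])
    then show "m + m' \<in> {r \<otimes>\<^bsub>?A\<^esub> b | r. r \<in> carrier ?A}" using r A.a_closed by blast
  next
    fix c m assume "m \<in> {r \<otimes>\<^bsub>?A\<^esub> b | r. r \<in> carrier ?A}"
    then obtain r where r: "m = r \<otimes>\<^bsub>?A\<^esub> b" "r \<in> carrier ?A" by blast
    have "(\<lambda>x. c * m x) = (\<lambda>x. c * r x) \<otimes>\<^bsub>?A\<^esub> b"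
      using r by (auto simp: group_algebra_def fun_eq_iff sum_distrib_left mult.assoc)
    moreover have "(\<lambda>x. c * r x) \<in> carrier ?A" using r by (simp add: group_algebra_def)
    ultimately show "(\<lambda>x. c * m x) \<in> {r \<otimes>\<^bsub>?A\<^esub> b | r. r \<in> carrier ?A}" by blast
  next
    fix g m assume g: "g \<in> carrier G" and "m \<in> {r \<otimes>\<^bsub>?A\<^esub> b | r. r \<in> carrier ?A}"
    then obtain r where r: "m = r \<otimes>\<^bsub>?A\<^esub> b" "r \<in> carrier ?A" by blast
    have gg: "group_elem g \<in> carrier ?A" by (rule group_elem_closed[OF g])
    have "translate g m = group_elem g \<otimes>\<^bsub>?A\<^esub> m" by (rule group_elem_mult_translate[OF G g, symmetric])
    also have "\<dots> = (group_elem g \<otimes>\<^bsub>?A\<^esub> r) \<otimes>\<^bsub>?A\<^esub> b" using r gg b by (simp add: A.m_assoc)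
    finally show "translate g m \<in> {r \<otimes>\<^bsub>?A\<^esub> b | r. r \<in> carrier ?A}" using gg r A.m_closed by blast
  qed
qed

lemma Lie_left_ideal: "finite_group.left_ideal (sym_group n) (carrier (Lie n :: (_ \<Rightarrow> 'f::field, _) module))"
  unfolding Lie_carrier by (rule left_ideal_principal[OF finite_group_sym lie_omega_closed])

lemma Lie_in_lspan:
  assumes z: "z \<in> {1..n}" and m: "m \<in> carrier (Lie n :: (_ \<Rightarrow> 'f::field, _) module)"
  shows "m \<in> lspan (lie_basis n z)"
proof -
  obtain r where r: "m = r \<otimes>\<^bsub>group_algebra (sym_group n)\<^esub> lie_omega n"
    using m by (auto simp: Lie_carrier)
  let ?f = "\<lambda>h x. r h * finite_group.translate (sym_group n) h (lie_omega n) x"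
  have "(\<Sum>h\<in>B. ?f h) \<in> lspan (lie_basis n z)" if "B \<subseteq> carrier (sym_group n)" for B
    using finite_subset[OF that finite_sym_group] that
  proof (induction B rule: finite_induct)
    case (insert h B)
    then have "?f h \<in> lspan (lie_basis n z)"
      by (intro lspan_scale translate_lie_omega_in_lspan[OF _ z]) (simp add: sym_group_carrier)
    then show ?case using insert by (simp add: lspan_add)
  qed (simp add: lspan_zero)
  moreover have "m = (\<Sum>h\<in>carrier (sym_group n). ?f h)"
    unfolding r group_algebra_mult_translate[OF finite_group_sym] by (simp add: fun_eq_iff sum_apply)
  ultimately show ?thesis by simp
qed

text \<open>
  Expanding \<open>m\<close> in the brackets \<open>\<rho> \<omega>\<close> with \<open>\<rho> 1 = z\<close>, the coefficient of \<open>\<rho> \<omega>\<close> is \<open>m \<rho>\<close>.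
\<close>

lemma Lie_determined:
  fixes m :: "(nat \<Rightarrow> nat) \<Rightarrow> 'f::field"
  assumes z: "z \<in> {1..n}" and m: "m \<in> carrier (Lie n)"
    and zero: "\<And>\<sigma>. \<sigma> permutes {1..n} \<Longrightarrow> \<sigma> 1 = z \<Longrightarrow> m \<sigma> = 0"
  shows "m = 0"
proof -
  let ?S = "{\<rho>. \<rho> permutes {1..n} \<and> \<rho> 1 = z}"
  let ?l = "\<lambda>\<rho>. finite_group.translate (sym_group n) \<rho> (lie_omega n) :: (nat \<Rightarrow> nat) \<Rightarrow> 'f"
  have n: "n \<ge> 1" using z by auto
  have fin: "finite ?S" by (rule finite_subset[OF _ finite_permutations[of "{1..n}"]]) auto
  have "x \<tau> = (\<Sum>\<rho>\<in>?S. x \<rho> * ?l \<rho> \<tau>)" if "x \<in> lspan (lie_basis n z)" for x \<tau>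
    using that
  proof induction
    case (lspan_base s)
    then obtain \<sigma> where \<sigma>: "\<sigma> permutes {1..n}" "\<sigma> 1 = z" "s = ?l \<sigma>" by (auto simp: lie_basis_def)
    have "(\<Sum>\<rho>\<in>?S. s \<rho> * ?l \<rho> \<tau>) = (\<Sum>\<rho>\<in>?S. if \<rho> = \<sigma> then ?l \<sigma> \<tau> else 0)"
      by (rule sum.cong[OF refl]) (use \<sigma> n in \<open>auto simp: translate_lie_omega_coeff\<close>)
    also have "\<dots> = s \<tau>" using fin \<sigma> by simp
    finally show ?case ..
  next
    case (lspan_scale x c)
    have "c * x \<tau> = c * (\<Sum>\<rho>\<in>?S. x \<rho> * ?l \<rho> \<tau>)" using lspan_scale by simp
    then show ?case by (simp add: sum_distrib_left mult.assoc)
  next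
    case (lspan_add x y)
    have "(x + y) \<tau> = (\<Sum>\<rho>\<in>?S. x \<rho> * ?l \<rho> \<tau>) + (\<Sum>\<rho>\<in>?S. y \<rho> * ?l \<rho> \<tau>)"
      using lspan_add.IH by (simp only: pointwise)
    also have "\<dots> = (\<Sum>\<rho>\<in>?S. (x + y) \<rho> * ?l \<rho> \<tau>)"
      by (simp add: pointwise sum.distrib distrib_right)
    finally show ?case .
  qed (simp add: pointwise)
  from this[OF Lie_in_lspan[OF z m]] show ?thesis
    using zero by (auto simp: fun_eq_iff pointwise)
qed

lemma Lie_extension:
  fixes \<phi> :: "(nat \<Rightarrow> nat) \<Rightarrow> 'f::field"
  assumes z: "z \<in> {1..n}"
  obtains m where "m \<in> carrier (Lie n)" "\<And>\<sigma>. \<sigma> permutes {1..n} \<Longrightarrow> \<sigma> 1 = z \<Longrightarrow> m \<sigma> = \<phi> \<sigma>"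
proof
  interpret S: finite_group "sym_group n" by (rule finite_group_sym)
  let ?S = "{\<rho>. \<rho> permutes {1..n} \<and> \<rho> 1 = z}"
  let ?l = "\<lambda>\<rho>. S.translate \<rho> (lie_omega n) :: (nat \<Rightarrow> nat) \<Rightarrow> 'f"
  let ?A = "group_algebra (sym_group n) :: ((nat \<Rightarrow> nat) \<Rightarrow> 'f) ring"
  let ?m = "\<Sum>\<rho>\<in>?S. (\<lambda>x. \<phi> \<rho> * ?l \<rho> x)"
  have n: "n \<ge> 1" using z by auto
  have fin: "finite ?S" by (rule finite_subset[OF _ finite_permutations[of "{1..n}"]]) auto
  have "?l \<rho> \<in> carrier (Lie n)" if "\<rho> \<in> ?S" for \<rho>
  proof -
    have "\<rho> \<in> carrier (sym_group n)" using that by (simp add: sym_group_carrier)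
    then show ?thesis
      using group_elem_mult_translate[OF finite_group_sym, of \<rho> n "lie_omega n :: (nat \<Rightarrow> nat) \<Rightarrow> 'f"] group_elem_closed[of \<rho> "sym_group n"]
      unfolding Lie_carrier by force
  qed
  then show "?m \<in> carrier (Lie n)"
    by (intro S.left_ideal_sum[OF Lie_left_ideal] S.left_ideal_scale[OF Lie_left_ideal])
  fix \<sigma> assume \<sigma>: "\<sigma> permutes {1..n}" "\<sigma> 1 = z"
  have "?m \<sigma> = (\<Sum>\<rho>\<in>?S. if \<rho> = \<sigma> then \<phi> \<sigma> else 0)"
    unfolding sum_apply by (rule sum.cong[OF refl]) (use \<sigma> n in \<open>auto simp: translate_lie_omega_coeff\<close>)
  then show "?m \<sigma> = \<phi> \<sigma>" using fin \<sigma> by simp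
qed

text \<open>
  The module \<open>X\<close> is coinduced from a Sylow \<open>p\<close>-subgroup \<open>P\<close>, and \<open>p^k\<close> is the length of an orbit
  of \<open>P\<close> on \<open>{1..n}\<close> that is not divisible by \<open>p^(m+1)\<close>.
\<close>

lemma Lie_free_res:
  fixes n :: nat
  assumes p: "CHAR('f::field) = p" "p > 0" and n: "n > 0" and m: "\<not> p ^ (m + 1) dvd n"
  defines "M \<equiv> carrier (Lie n :: (_ \<Rightarrow> 'f, _) module)"
  shows "\<exists>k\<le>m. \<exists>X i r q. finite_group.gmod (sym_group n) X \<and>
    finite_group.ghom (sym_group n) (finite_group.emb ` M) X i \<and>
    finite_group.ghom (sym_group n) X (finite_group.emb ` M) r \<and>
    inj_on (\<lambda>u. r (i u)) (finite_group.emb ` M) \<and>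
    (\<forall>t. finite_group.free_res (sym_group n) t ((partial_sums ^^ k) (\<lambda>j. if j = 0 then q else 0)) X)"
proof -
  interpret S: finite_group "sym_group n" by (rule finite_group_sym)
  have lid: "S.left_ideal M" unfolding M_def by (rule Lie_left_ideal)
  have pr: "prime p" using prime_CHAR_semidom[where 'a='f] p by simp
  have "Coset.order (sym_group n) \<noteq> 0"
    using S.finite_carrier S.one_closed by (auto simp: Coset.order_def)
  then obtain c where c: "Coset.order (sym_group n) = p ^ multiplicity p (Coset.order (sym_group n)) * c" "\<not> p dvd c"
    using multiplicity_decompose'[of "Coset.order (sym_group n)" p] pr by (metis not_prime_unit)
  then obtain a where a: "Coset.order (sym_group n) = p ^ a * c" by blast
  obtain P where P: "subgroup P (sym_group n)" "card P = p ^ a"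
    using sylow_thm[OF pr sym_group_is_group a S.finite_carrier] by blast
  have idx: "of_nat (card (rcosets\<^bsub>sym_group n\<^esub> P)) \<noteq> (0::'f)"
  proof -
    have "card (rcosets\<^bsub>sym_group n\<^esub> P) * p ^ a = p ^ a * c"
      using S.lagrange[OF P(1)] P(2) a by simp
    then have "card (rcosets\<^bsub>sym_group n\<^esub> P) = c" using p(2) by simp
    then show ?thesis using c(2) p(1) by (simp add: of_nat_eq_0_iff_char_dvd)
  qed
  let ?P = "sym_group n\<lparr>carrier := P\<rparr>"
  have Pperm: "g permutes {1..n}" if "g \<in> P" for g
    using that subgroup.subset[OF P(1)] by (auto simp: sym_group_carrier)
  interpret act: group_action ?P "{1..n}" "\<lambda>g. restrict g {1..n}"
  proof (rule group_actionI)
    show "group ?P" by (rule subgroup.subgroup_is_group[OF P(1) sym_group_is_group])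
    show "g x \<in> {1..n}" if "g \<in> carrier ?P" "x \<in> {1..n}" for g x
      using that permutes_in_image[OF Pperm, of g x] by simp
  qed (simp_all add: sym_group_mult sym_group_one)
  obtain z where z: "z \<in> {1..n}" "\<not> p ^ (m + 1) dvd card (orbit ?P (\<lambda>g. restrict g {1..n}) z)"
    using act.dvd_card_of_orbits[of "p ^ (m + 1)"] m by fastforce
  have oP: "Coset.order ?P = p ^ a" using P(2) by (simp add: Coset.order_def)
  define H where "H = stabilizer ?P (\<lambda>g. restrict g {1..n}) z"
  obtain k where k: "card (orbit ?P (\<lambda>g. restrict g {1..n}) z) = p ^ k" "p ^ k * card H = p ^ a"
    unfolding H_def by (rule act.card_orbit_prime_power[OF pr oP z(1)])
  have km: "k \<le> m"
  proof (rule ccontr)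
    assume "\<not> k \<le> m"
    then have "p ^ (m + 1) dvd p ^ k" by (intro le_imp_power_dvd) simp
    then show False using z(2) k(1) by simp
  qed
  have H: "subgroup H (sym_group n)"
    unfolding H_def by (rule S.incl_subgroup[OF P(1) act.stabilizer_subgroup[OF z(1)]])
  have HP: "H \<subseteq> P" by (auto simp: H_def stabilizer_def)
  have Hz: "h z = z" if "h \<in> H" for h using that z(1) by (simp add: H_def stabilizer_def)
  let ?\<Sigma> = "{\<sigma>. \<sigma> permutes {1..n} \<and> \<sigma> 1 = z}"
  have "\<exists>q. \<forall>t. S.free_res t (\<lambda>j. if j = 0 then q else 0) (S.coind M H)"
  proof (rule S.free_res_coind_free[OF lid H])
    show "?\<Sigma> \<subseteq> carrier (sym_group n)" by (auto simp: sym_group_carrier)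
    show "h \<otimes>\<^bsub>sym_group n\<^esub> s \<in> ?\<Sigma>" if "h \<in> H" "s \<in> ?\<Sigma>" for h s
      using that Hz HP Pperm permutes_compose[of s "{1..n}" h] by (auto simp: sym_group_mult)
    show "m = 0" if "m \<in> M" "\<And>s. s \<in> ?\<Sigma> \<Longrightarrow> m s = 0" for m
      using Lie_determined[OF z(1)] that unfolding M_def by blast
    show "\<exists>m\<in>M. \<forall>s\<in>?\<Sigma>. m s = \<phi> s" for \<phi>
      using Lie_extension[OF z(1), of \<phi>] unfolding M_def by (metis (mono_tags, lifting) mem_Collect_eq)
  qed blast
  then obtain q where q: "\<And>t. S.free_res t (\<lambda>j. if j = 0 then q else 0) (S.coind M H)" by blast
  have cardP: "card P = card H * p ^ k" using k(2) P(2) by (simp add: mult.commute)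
  have res: "S.free_res t ((partial_sums ^^ k) (\<lambda>j. if j = 0 then q else 0)) (S.coind M P)" for t
    by (rule S.free_res_coind_p_group[OF lid pr P H HP cardP q])
  from S.coind_retract[OF lid P(1) idx] obtain i r where
    ir: "S.ghom (S.emb ` M) (S.coind M P) i" "S.ghom (S.coind M P) (S.emb ` M) r"
    "inj_on (\<lambda>u. r (i u)) (S.emb ` M)" by (elim exE conjE)
  have gX: "S.gmod (S.coind M P)" by (rule S.gmod_coind[OF lid subgroup.subset[OF P(1)]])
  show ?thesis
    by (rule exI[of _ k], rule conjI[OF km], rule exI[of _ "S.coind M P"], rule exI[of _ i], rule exI[of _ r],
        rule exI[of _ q]) (simp only: gX ir res, simp)
qed


section \<open>Comparison with modules over the group algebra ring\<close>

context finite_group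
begin

text \<open>
  The submodule \<open>V\<close> of \<open>A^r\<close> as a module over the ring \<open>A\<close>, which acts on each coordinate.
\<close>

definition module_of :: "(nat \<Rightarrow> 'g \<Rightarrow> 'f::field) set \<Rightarrow> ('g \<Rightarrow> 'f, nat \<Rightarrow> 'g \<Rightarrow> 'f) module" where
  "module_of V = \<lparr>carrier = V, mult = (\<lambda>u v. 0), one = 0, zero = 0, add = (+),
     smult = (\<lambda>a u i. a \<otimes>\<^bsub>group_algebra G\<^esub> u i)\<rparr>"

lemma smult_eq_sum_act:
  "(\<lambda>i. a \<otimes>\<^bsub>group_algebra G\<^esub> u i) = (\<Sum>g\<in>carrier G. fscale (a g) (act g u))"
  by (auto simp: group_algebra_def fun_eq_iff sum_apply pointwise act_def)

lemma smult_in_gmod: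
  assumes V: "gmod V" and u: "u \<in> V"
  shows "(\<lambda>i. a \<otimes>\<^bsub>group_algebra G\<^esub> u i) \<in> V"
  unfolding smult_eq_sum_act
  by (intro fs.subspace_sum[OF gmod_subspace[OF V]] fs.subspace_scale[OF gmod_subspace[OF V]] gmod_act[OF V] u)

lemma ghom_smult:
  assumes V: "gmod V" and f: "ghom V W f" and u: "u \<in> V"
  shows "f (\<lambda>i. a \<otimes>\<^bsub>group_algebra G\<^esub> u i) = (\<lambda>i. a \<otimes>\<^bsub>group_algebra G\<^esub> f u i)"
  unfolding smult_eq_sum_act
  by (simp add: flinear_sum[OF ghom_flinear[OF f]] flinear_scale[OF ghom_flinear[OF f]] ghom_act[OF f] u)

lemma gmod_comp_closed:
  assumes "gmod V" "u \<in> V"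
  shows "u i \<in> carrier (group_algebra G)"
proof -
  obtain r where "V \<subseteq> free_mod r" using assms(1) by (auto simp: gmod_def)
  then have "u \<in> free_mod r" using assms(2) by blast
  then show ?thesis by (auto simp: group_algebra_def dest: free_modD)
qed

lemma group_algebra_add: "a \<oplus>\<^bsub>group_algebra G\<^esub> b = a + b"
  and group_algebra_zero: "\<zero>\<^bsub>group_algebra G\<^esub> = 0"
  by (auto simp: group_algebra_def fun_eq_iff pointwise)

lemma left_module_module_of:
  fixes V :: "(nat \<Rightarrow> 'g \<Rightarrow> 'f::field) set"
  assumes V: "gmod V"
  shows "left_module (group_algebra G) (module_of V)"
proof -
  interpret A: ring "group_algebra G :: ('g \<Rightarrow> 'f) ring" by (rule group_algebra_ring[OF is_group finite_carrier])
  note sub = gmod_subspace[OF V] and cl = gmod_comp_closed[OF V]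
  have "abelian_group (module_of V)"
  proof (rule abelian_groupI)
    fix u assume "u \<in> carrier (module_of V)"
    then show "\<exists>v\<in>carrier (module_of V). v \<oplus>\<^bsub>module_of V\<^esub> u = \<zero>\<^bsub>module_of V\<^esub>"
      using fs.subspace_neg[OF sub] by (intro bexI[of _ "- u"]) (simp_all add: module_of_def)
  qed (simp_all add: module_of_def fs.subspace_add[OF sub] fs.subspace_0[OF sub] add_ac)
  then show ?thesis
  proof (intro left_module.intro left_module_axioms.intro A.ring_axioms)
    fix a :: "'g \<Rightarrow> 'f" and u assume "a \<in> carrier (group_algebra G)" "u \<in> carrier (module_of V)"
    then show "a \<odot>\<^bsub>module_of V\<^esub> u \<in> carrier (module_of V)" using smult_in_gmod[OF V] by (simp add: module_of_def)
  next
    fix a b :: "'g \<Rightarrow> 'f" and u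
    assume "a \<in> carrier (group_algebra G)" "b \<in> carrier (group_algebra G)" "u \<in> carrier (module_of V)"
    then show "(a \<oplus>\<^bsub>group_algebra G\<^esub> b) \<odot>\<^bsub>module_of V\<^esub> u = a \<odot>\<^bsub>module_of V\<^esub> u \<oplus>\<^bsub>module_of V\<^esub> b \<odot>\<^bsub>module_of V\<^esub> u"
      "(a \<otimes>\<^bsub>group_algebra G\<^esub> b) \<odot>\<^bsub>module_of V\<^esub> u = a \<odot>\<^bsub>module_of V\<^esub> (b \<odot>\<^bsub>module_of V\<^esub> u)"
      using cl by (simp_all add: module_of_def A.l_distr A.m_assoc) (simp add: group_algebra_add plus_fun_def)
  next
    fix a :: "'g \<Rightarrow> 'f" and u v
    assume "a \<in> carrier (group_algebra G)" "u \<in> carrier (module_of V)" "v \<in> carrier (module_of V)"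
    then have "a \<otimes>\<^bsub>group_algebra G\<^esub> (u i + v i)
        = a \<otimes>\<^bsub>group_algebra G\<^esub> u i + a \<otimes>\<^bsub>group_algebra G\<^esub> v i" for i
      using cl by (simp add: module_of_def A.r_distr flip: group_algebra_add)
    then have "(\<lambda>i. a \<otimes>\<^bsub>group_algebra G\<^esub> (u + v) i)
        = (\<lambda>i. a \<otimes>\<^bsub>group_algebra G\<^esub> u i) + (\<lambda>i. a \<otimes>\<^bsub>group_algebra G\<^esub> v i)"
      by (intro ext) (simp only: plus_fun_apply)
    then show "a \<odot>\<^bsub>module_of V\<^esub> (u \<oplus>\<^bsub>module_of V\<^esub> v) = a \<odot>\<^bsub>module_of V\<^esub> u \<oplus>\<^bsub>module_of V\<^esub> a \<odot>\<^bsub>module_of V\<^esub> v"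
      by (simp add: module_of_def)
  next
    fix u assume "u \<in> carrier (module_of V)"
    then show "\<one>\<^bsub>group_algebra G\<^esub> \<odot>\<^bsub>module_of V\<^esub> u = u" using cl by (simp add: module_of_def)
  qed
qed

lemma ghom_module_hom:
  assumes "gmod V" "ghom V W f"
  shows "f \<in> LinearCombinations.module_hom (group_algebra G) (module_of V) (module_of W)"
  using assms ghom_closed[OF assms(2)] ghom_smult[OF assms]
  by (auto simp: LinearCombinations.module_hom_def module_of_def flinear_add[OF ghom_flinear[OF assms(2)]])

text \<open>
  The two models of \<open>A^r\<close> differ in the value outside the range of coordinates: \<open>undefined\<close> in the
  function space, and zero here. Restriction and extension by zero pass between them.
\<close>

lemma fg_projective_module_of:
  assumes P: "gproj (P :: (nat \<Rightarrow> 'g \<Rightarrow> 'f::field) set)"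
  shows "fg_projective (group_algebra G) (module_of P)"
proof -
  let ?A = "group_algebra G :: ('g \<Rightarrow> 'f) ring"
  interpret A: ring ?A by (rule group_algebra_ring[OF is_group finite_carrier])
  have gP: "gmod P" by (rule gproj_gmod[OF P])
  obtain r i q where i: "ghom P (free_mod r) i" and q: "ghom (free_mod r) P q" and qi: "\<forall>u\<in>P. q (i u) = u"
    using P by (auto simp: gproj_def)
  define ext :: "(nat \<Rightarrow> 'g \<Rightarrow> 'f) \<Rightarrow> (nat \<Rightarrow> 'g \<Rightarrow> 'f)" where "ext = (\<lambda>v j. if j < r then v j else 0)"
  have ext_in: "ext v \<in> free_mod r" if "v \<in> {..<r} \<rightarrow>\<^sub>E carrier ?A" for v
  proof -
    have "v j x = 0" if "j < r" "x \<notin> carrier G" for j x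
      using that \<open>v \<in> _\<close> by (auto simp: group_algebra_def dest!: PiE_mem[of v _ _ j])
    then show ?thesis by (auto simp: ext_def free_mod_def pointwise split: if_splits)
  qed
  have i': "(\<lambda>u. restrict (i u) {..<r}) \<in> LinearCombinations.module_hom ?A (module_of P) (A.func_space {..<r})"
    using ghom_smult[OF gP i] gmod_comp_closed[OF gmod_free_mod ghom_closed[OF i]]
    by (auto simp: LinearCombinations.module_hom_def module_of_def A.func_space_def group_algebra_add
        flinear_add[OF ghom_flinear[OF i]] pointwise fun_eq_iff)
  have q': "(\<lambda>v. q (ext v)) \<in> LinearCombinations.module_hom ?A (A.func_space {..<r}) (module_of P)"
    unfolding LinearCombinations.module_hom_def
  proof (intro CollectI conjI allI impI)
    show "(\<lambda>v. q (ext v)) \<in> carrier (A.func_space {..<r}) \<rightarrow> carrier (module_of P)"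
      using ext_in ghom_closed[OF q] by (auto simp: A.func_space_def module_of_def)
    fix v w assume vw: "v \<in> carrier (A.func_space {..<r}) \<and> w \<in> carrier (A.func_space {..<r})"
    have "ext (v \<oplus>\<^bsub>A.func_space {..<r}\<^esub> w) = ext v + ext w"
      by (auto simp: ext_def A.func_space_def group_algebra_add fun_eq_iff pointwise)
    then show "q (ext (v \<oplus>\<^bsub>A.func_space {..<r}\<^esub> w)) = q (ext v) \<oplus>\<^bsub>module_of P\<^esub> q (ext w)"
      by (simp add: module_of_def flinear_add[OF ghom_flinear[OF q]])
  next
    fix a v assume av: "a \<in> carrier ?A \<and> v \<in> carrier (A.func_space {..<r})"
    have "ext (a \<odot>\<^bsub>A.func_space {..<r}\<^esub> v) = (\<lambda>j. a \<otimes>\<^bsub>?A\<^esub> ext v j)"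
      using av A.r_null[of a] by (auto simp: ext_def A.func_space_def fun_eq_iff group_algebra_zero)
    then show "q (ext (a \<odot>\<^bsub>A.func_space {..<r}\<^esub> v)) = a \<odot>\<^bsub>module_of P\<^esub> q (ext v)"
      using ghom_smult[OF gmod_free_mod q ext_in, of v a] av by (simp add: module_of_def A.func_space_def)
  qed
  have qi': "\<forall>x\<in>carrier (module_of P). q (ext (restrict (i x) {..<r})) = x"
  proof
    fix u assume "u \<in> carrier (module_of P)"
    then have u: "u \<in> P" by (simp add: module_of_def)
    have "ext (restrict (i u) {..<r}) = i u"
    proof (intro ext)
      fix j x
      show "ext (restrict (i u) {..<r}) j x = i u j x"
        using free_modD[OF ghom_closed[OF i u], of j x] by (auto simp: ext_def pointwise)
    qed
    then show "q (ext (restrict (i u) {..<r})) = u" using qi u by simp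
  qed
  show ?thesis
    unfolding fg_projective_def
    by (rule conjI[OF left_module_module_of[OF gP]], rule exI[of _ r], rule bexI[OF _ i'], rule bexI[OF _ q'], rule qi')
qed

lemma fscale_eq_smult:
  assumes "u \<in> free_mod r"
  shows "(\<lambda>i. scalar_elem G c \<otimes>\<^bsub>group_algebra G\<^esub> u i) = fscale c u"
proof -
  have "(\<Sum>g\<in>carrier G. fscale (scalar_elem G c g) (act g u)) = (\<Sum>g\<in>carrier G. if g = \<one> then fscale c u else 0)"
    by (rule sum.cong[OF refl]) (simp add: scalar_elem_def act_one[OF assms])
  then show ?thesis unfolding smult_eq_sum_act using finite_carrier by simp
qed

lemma act_eq_smult:
  assumes "g \<in> carrier G"
  shows "(\<lambda>i. group_elem g \<otimes>\<^bsub>group_algebra G\<^esub> u i) = act g u"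
proof -
  have "(\<Sum>h\<in>carrier G. fscale (group_elem g h) (act h u)) = (\<Sum>h\<in>carrier G. if h = g then act g u else 0)"
    by (rule sum.cong[OF refl]) (simp add: group_elem_def)
  then show ?thesis unfolding smult_eq_sum_act using finite_carrier assms by simp
qed

text \<open>
  A submodule over the ring \<open>A\<close> is a stable subspace, as scalars and group elements belong to \<open>A\<close>. If
  its sum with the kernel of \<open>f\<close> is \<open>P\<close>, then it maps onto \<open>M\<close>.
\<close>

lemma superfluous_module_of:
  assumes cov: "gcover P M f"
  shows "superfluous (group_algebra G) (module_of P) (gker P f)"
  unfolding superfluous_def
proof (intro allI impI, elim conjE)
  fix N assume N: "Module.submodule N (group_algebra G) (module_of P)"
    and sum: "N <+>\<^bsub>module_of P\<^esub> gker P f = carrier (module_of P)"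
  have gP: "gmod P" by (rule gcover_gmod[OF cov])
  have f: "ghom P M f" "f ` P = M" using cov by (auto simp: gcover_def)
  interpret N: Module.submodule N "group_algebra G" "module_of P" by (rule N)
  have NP: "N \<subseteq> P" using N.subset by (simp add: module_of_def)
  obtain r where r: "P \<subseteq> free_mod r" using gP by (auto simp: gmod_def)
  have sm: "(\<lambda>i. a \<otimes>\<^bsub>group_algebra G\<^esub> u i) \<in> N" if "a \<in> carrier (group_algebra G)" "u \<in> N" for a u
    using N.smult_closed[OF that] by (simp add: module_of_def)
  have "gmod N"
  proof (rule gmod_subset[OF gP _ NP])
    show "fs.subspace N"
      unfolding fs.subspace_def
    proof (intro conjI ballI allI)
      show "0 \<in> N" using N.one_closed by (simp add: module_of_def)
      show "u + v \<in> N" if "u \<in> N" "v \<in> N" for u v using N.m_closed[OF that] by (simp add: module_of_def)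
      show "fscale c u \<in> N" if "u \<in> N" for c u
        using sm[of "scalar_elem G c" u] fscale_eq_smult[of u r c] that NP r
        by (auto simp: scalar_elem_def group_algebra_def)
    qed
    show "act g u \<in> N" if "g \<in> carrier G" "u \<in> N" for g u
      using sm[OF group_elem_closed[OF that(1)] that(2)] act_eq_smult[OF that(1), of u] by simp
  qed
  moreover have "f ` N = M"
  proof
    show "f ` N \<subseteq> M" using NP f by blast
    show "M \<subseteq> f ` N"
    proof
      fix y assume "y \<in> M"
      then obtain u where u: "u \<in> P" "y = f u" using f(2) by blast
      then have "u \<in> N <+>\<^bsub>module_of P\<^esub> gker P f" using sum by (simp add: module_of_def)
      then obtain v k where vk: "v \<in> N" "k \<in> gker P f" "u = v + k"
        by (auto simp: set_add_def set_mult_def module_of_def)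
      then show "y \<in> f ` N" using u flinear_add[OF ghom_flinear[OF f(1)]] by (auto simp: gker_def)
    qed
  qed
  ultimately have "N = P" using cov NP unfolding gcover_def by blast
  then show "N = carrier (module_of P)" by (simp add: module_of_def)
qed

text \<open>
  The target \<open>N\<close> may differ from \<open>module_of M\<close>, provided that \<open>h\<close> has the kernel of \<open>f\<close>; this allows
  the left ideal \<open>Lie(n)\<close> itself as the target of the augmentation.
\<close>

lemma projective_cover_module_of:
  assumes cov: "gcover P M f" and h: "h \<in> LinearCombinations.module_hom (group_algebra G) (module_of P) N"
    and surj: "h ` P = carrier N" and ker: "\<And>u. u \<in> P \<Longrightarrow> h u = zero N \<longleftrightarrow> f u = 0"
  shows "projective_cover (group_algebra G) (module_of P) N h"
proof -
  have "a_kernel (module_of P) N h = gker P f"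
    using ker by (auto simp: a_kernel_def kernel_def module_of_def gker_def)
  then show ?thesis
    unfolding projective_cover_def
    using superfluous_module_of[OF cov] fg_projective_module_of[of P] cov h surj
    by (simp add: gcover_def module_of_def)
qed

text \<open>
  A basis of \<open>V\<close> generates the underlying vector space.
\<close>

lemma module_dim_module_of_le:
  assumes V: "gmod (V :: (nat \<Rightarrow> 'g \<Rightarrow> 'f::field) set)"
  shows "module_dim G (module_of V) \<le> fs.dim V"
proof -
  let ?U = "underlying_space G (module_of V)"
  obtain r where r: "V \<subseteq> free_mod r" using V by (auto simp: gmod_def)
  interpret U: vectorspace "class_ring :: 'f ring" ?U
    by (rule underlying_space_vectorspace[OF is_group finite_carrier left_module_module_of[OF V]])
  obtain B where B: "B \<subseteq> V" "finite B" "fs.span B = V" "card B = fs.dim V"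
    using fin_dim_space_basis[OF gmod_fin_dim[OF V]] by metis
  have car: "carrier ?U = V" and add: "u \<oplus>\<^bsub>?U\<^esub> v = u + v" and zero: "\<zero>\<^bsub>?U\<^esub> = 0" for u v
    by (simp_all add: underlying_space_def module_of_def)
  have sm: "c \<odot>\<^bsub>?U\<^esub> u = fscale c u" if "u \<in> V" for c u
    using fscale_eq_smult[of u r c] that r by (auto simp: underlying_space_def module_of_def)
  have BU: "B \<subseteq> carrier ?U" using B car by simp
  have subm: "LinearCombinations.submodule (class_ring :: 'f ring) (U.span B) ?U"
    by (rule U.span_is_submodule[OF BU])
  interpret sp: LinearCombinations.submodule "class_ring :: 'f ring" "U.span B" ?U by (rule subm)
  have spV: "U.span B \<subseteq> V" using sp.subset car by simp
  have "x \<in> U.span B" if "x \<in> fs.span B" for x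
    using that
  proof (induction rule: fs.span_induct_alt)
    case base
    show ?case using sp.zero_closed zero by simp
  next
    case (step c x y)
    have "x \<in> U.span B" using U.in_own_span[OF BU] step by blast
    then have xV: "x \<in> V" using spV by blast
    have "c \<odot>\<^bsub>?U\<^esub> x \<in> U.span B" using \<open>x \<in> U.span B\<close> by (intro sp.smult_closed) simp
    then have "fscale c x \<in> U.span B" by (simp only: sm[OF xV])
    then show ?case using sp.m_closed[of "fscale c x" y] step add by simp
  qed
  then have "U.span B = carrier ?U" using B(3) spV car by auto
  then have "U.dim \<le> card B" by (rule U.gen_ge_dim[OF B(2) BU])
  then show ?thesis using B by (simp add: module_dim_def)
qed

end

section \<open>The complexity bound\<close>

lemma complexity_le:
  fixes P :: "nat \<Rightarrow> ('g \<Rightarrow> 'f::field, nat \<Rightarrow> 'g \<Rightarrow> 'f) module"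
  assumes "minimal_projective_resolution (group_algebra G) M P e d" "K > 0"
    "\<forall>\<^sub>F j in sequentially. real (module_dim G (P j)) \<le> K * real j powi (int c - 1)"
  shows "complexity G M \<le> c"
  unfolding complexity_def by (rule Least_le) (use assms in blast)

theorem theorem13:
  fixes p n m :: nat
  assumes "CHAR('f::alg_closed_field) = p" and "p > 0"
    and "n > 0"
    and "p ^ m dvd n" and "\<not> p ^ (m + 1) dvd n"
  shows "complexity (sym_group n) (Lie n :: ((nat \<Rightarrow> nat) \<Rightarrow> 'f, (nat \<Rightarrow> nat) \<Rightarrow> 'f) module) \<le> m"
proof -
  interpret S: finite_group "sym_group n" by (rule finite_group_sym)
  let ?A = "group_algebra (sym_group n) :: ((nat \<Rightarrow> nat) \<Rightarrow> 'f) ring"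
  let ?L = "Lie n :: ((nat \<Rightarrow> nat) \<Rightarrow> 'f, (nat \<Rightarrow> nat) \<Rightarrow> 'f) module"
  let ?M = "S.emb ` carrier ?L"
  from Lie_free_res[OF assms(1,2,3,5)] obtain k X i r q where k: "k \<le> m" and X: "S.gmod X" "S.ghom ?M X i" "S.ghom X ?M r"
    "inj_on (\<lambda>u. r (i u)) ?M" "\<forall>t. S.free_res t ((partial_sums ^^ k) (\<lambda>j. if j = 0 then q else 0)) X"
    by (elim exE conjE)
  have gM: "S.gmod ?M" by (rule S.gmod_emb[OF Lie_left_ideal])
  obtain P f where Pf: "S.min_res ?M P f" by (rule S.min_res_exists[OF gM])
  have c0: "S.gcover (P 0) ?M (f 0)" and cS: "S.gcover (P (Suc j)) (S.gker (P j) (f j)) (f (Suc j))" for j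
    using Pf by (simp_all add: S.min_res_def)
  have gP: "S.gmod (P j)" for j by (cases j) (auto intro: S.gcover_gmod[OF c0] S.gcover_gmod[OF cS])
  have f0: "S.ghom (P 0) ?M (f 0)" "f 0 ` P 0 = ?M" using c0 by (simp_all add: S.gcover_def)
  have fS: "S.ghom (P (Suc j)) (S.gker (P j) (f j)) (f (Suc j))" "f (Suc j) ` P (Suc j) = S.gker (P j) (f j)" for j
    using cS[of j] by (simp_all add: S.gcover_def)
  define e where "e = (\<lambda>u. f 0 u 0)"
  have f0_emb: "f 0 u = S.emb (e u)" if u: "u \<in> P 0" for u
  proof -
    obtain l where "f 0 u = S.emb l" using S.ghom_closed[OF f0(1) u] by blast
    then show ?thesis by (simp add: e_def S.emb_apply)
  qed
  have rec_upd: "(S.module_of V)\<lparr>carrier := W\<rparr> = S.module_of W" for V W :: "(nat \<Rightarrow> (nat \<Rightarrow> nat) \<Rightarrow> 'f) set"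
    by (simp add: S.module_of_def)
  have L: "add ?L = (\<lambda>x y. x + y)" "zero ?L = 0" "smult ?L = mult ?A"
    by (simp_all add: Lie_def principal_left_ideal_def S.group_algebra_zero fun_eq_iff S.group_algebra_add)
  have e_surj: "e ` P 0 = carrier ?L"
  proof -
    have "e ` P 0 = (\<lambda>v. v 0) ` f 0 ` P 0" by (auto simp: e_def image_image)
    then show ?thesis using f0(2) by (simp add: image_image S.emb_apply)
  qed
  have e_hom: "e \<in> LinearCombinations.module_hom ?A (S.module_of (P 0)) ?L"
    using e_surj S.ghom_smult[OF gP f0(1)] flinear_add[OF S.ghom_flinear[OF f0(1)]]
    by (auto simp: LinearCombinations.module_hom_def S.module_of_def L e_def plus_fun_apply)
  have e_ker: "e u = \<zero>\<^bsub>?L\<^esub> \<longleftrightarrow> f 0 u = 0" if "u \<in> P 0" for u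
  proof -
    have "S.emb x = 0 \<longleftrightarrow> x = 0" for x :: "(nat \<Rightarrow> nat) \<Rightarrow> 'f"
      by (auto simp: S.emb_def fun_eq_iff pointwise)
    then show ?thesis using f0_emb[OF that] by (simp add: L)
  qed
  have cov0: "projective_cover ?A (S.module_of (P 0)) ?L e"
    by (rule S.projective_cover_module_of[OF c0 e_hom e_surj e_ker])
  have covS: "projective_cover ?A (S.module_of (P (Suc j))) (S.module_of (S.gker (P j) (f j))) (f (Suc j))" for j
    by (rule S.projective_cover_module_of[OF cS S.ghom_module_hom[OF gP fS(1)]])
       (simp_all add: S.module_of_def fS(2))
  have ker0: "a_kernel (S.module_of (P 0)) ?L e = S.gker (P 0) (f 0)"
    using e_ker by (auto simp: a_kernel_def kernel_def S.module_of_def S.gker_def)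
  have kerS: "a_kernel (S.module_of (P (Suc j))) (S.module_of (P j)) (f (Suc j)) = S.gker (P (Suc j)) (f (Suc j))" for j
    by (simp add: a_kernel_def kernel_def S.module_of_def S.gker_def)
  have res: "minimal_projective_resolution ?A ?L (\<lambda>j. S.module_of (P j)) e (\<lambda>j. f (Suc j))"
    unfolding minimal_projective_resolution_def
    using cov0 covS[of 0] covS[of "Suc j" for j] by (simp add: rec_upd ker0 kerS)
  let ?a = "(partial_sums ^^ k) (\<lambda>j. if j = 0 then q else 0)"
  let ?N = "card (carrier (sym_group n))"
  have dim: "module_dim (sym_group n) (S.module_of (P j)) \<le> ?a j * ?N" for j
    using S.module_dim_module_of_le[OF gP[of j]] S.min_res_dim_le_of_retract[of ?M X P f i r j ?a, OF gM X(1) Pf X(2,3,4) X(5)[THEN spec]]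
    by linarith
  have "\<exists>K>0. \<forall>\<^sub>F j in sequentially. real (module_dim (sym_group n) (S.module_of (P j))) \<le> K * real j powi (int k - 1)"
  proof (cases k)
    case 0
    have "real (module_dim (sym_group n) (S.module_of (P j))) \<le> 1 * real j powi (int k - 1)" if "j \<ge> 1" for j
      using dim[of j] that 0 by simp
    then show ?thesis unfolding eventually_sequentially by (intro exI[of _ 1]) auto
  next
    case (Suc l)
    have "real (module_dim (sym_group n) (S.module_of (P j))) \<le> real (q * 2 ^ l * ?N + 1) * real j powi (int k - 1)"
      if j: "j \<ge> 1" for j
    proof -
      have "(j + 1) ^ l \<le> (2 * j) ^ l" using j by (intro power_mono) auto
      then have "?a j \<le> q * (2 ^ l * j ^ l)"
        using partial_sums_iter_bound[of l q j] unfolding Suc power_mult_distrib by (meson mult_le_mono2 order_trans)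
      then have "?a j * ?N \<le> q * (2 ^ l * j ^ l) * ?N" by (rule mult_le_mono1)
      moreover have "q * (2 ^ l * j ^ l) * ?N \<le> (q * 2 ^ l * ?N + 1) * j ^ l" by (simp add: algebra_simps)
      ultimately have "module_dim (sym_group n) (S.module_of (P j)) \<le> (q * 2 ^ l * ?N + 1) * j ^ l"
        using dim[of j] \<open>q * (2 ^ l * j ^ l) * ?N \<le> (q * 2 ^ l * ?N + 1) * j ^ l\<close> by linarith
      then have "real (module_dim (sym_group n) (S.module_of (P j))) \<le> real ((q * 2 ^ l * ?N + 1) * j ^ l)"
        by (rule of_nat_mono)
      then show ?thesis using Suc by (simp add: algebra_simps)
    qed
    \<comment> \<open>the summand \<open>1\<close> keeps the constant positive for \<open>q = 0\<close>\<close>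
    moreover have "0 < real (q * 2 ^ l * ?N + 1)" by (simp only: of_nat_0_less_iff)
    ultimately show ?thesis unfolding eventually_sequentially by blast
  qed
  then obtain K where K: "K > 0" "\<forall>\<^sub>F j in sequentially.
      real (module_dim (sym_group n) (S.module_of (P j))) \<le> K * real j powi (int k - 1)" by blast
  have "complexity (sym_group n) ?L \<le> k" by (rule complexity_le[OF res K])
  then show ?thesis using k by simp
qed

end
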